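(* Let $\boldsymbol{u} = (u_n)_{n \geq 0}$ be a nondegenerate Lucas sequence with parameters $a_1, a_2$ such that $D_{\boldsymbol{u}} = a_1^2 + 4a_2$ is not a square and the discriminant of the quadratic field $\mathbb{Q}(\sqrt{D_{\boldsymbol{u}}})$ is not equal to $-3$ or to $-4$. Then there exist a positive integer $h$ and a periodic function $G_{\boldsymbol{u}}$ on the positive integers with rational values such that $$\delta_{\boldsymbol{u}}(t) = A\, F_{2h}(t)\, G_{\boldsymbol{u}}(t)$$ for every positive integer $t$.
   Context: A Lucas sequence with parameters $a_1, a_2$ (fixed nonzero integers) is the sequence of integers $\boldsymbol{u} = (u_n)_{n\ge 0}$ with $u_0 = 0$, $u_1 = 1$, and $u_n = a_1 u_{n-1} + a_2 u_{n-2}$ for every integer $n \geq 2$. Put $D_{\boldsymbol{u}} := a_1^2 + 4a_2$. Let $\alpha, \beta$ be the two roots of $X^2 - a_1 X - a_2$ and put $\gamma := \alpha/\beta$. The sequence $\boldsymbol{u}$ is nondegenerate if $\gamma$ is not a root of unity. Let $K := \mathbb{Q}(\sqrt{D_{\boldsymbol{u}}})$ (a quadratic field containing $\gamma$), $\zeta_n := e^{2\pi \mathbf{i}/n}$, and for every positive integer $n$ fix an $n$th root $\gamma^{1/n}$ of $\gamma$ and put $K_n := K(\zeta_n, \gamma^{1/n})$, which is Galois over $\mathbb{Q}$. If there exists $\sigma \in \mathrm{Gal}(K_n/\mathbb{Q})$ with $\sigma(\zeta_n) = \zeta_n^{-1}$ and $\sigma(\gamma^{1/n}) = (\gamma^{1/n})^{-1}$,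 let $C_n := \{\mathrm{id}, \sigma\}$; otherwise let $C_n := \{\mathrm{id}\}$. For every positive integer $t$, $\delta_{\boldsymbol{u}}(t)$ is defined by the absolutely convergent series $$\delta_{\boldsymbol{u}}(t) := \sum_{n=1}^\infty \frac{\mu(n)\, \#C_{nt}}{[K_{nt} : \mathbb{Q}]},$$ where $\mu$ is the Möbius function. (This is the constant such that, under the Generalized Riemann Hypothesis, the number of primes $p \le x$ with index of appearance $t$ in $\boldsymbol{u}$ is asymptotically $\delta_{\boldsymbol{u}}(t)\, x/\log x$ up to lower-order terms.) The Artin constant is $A := \prod_p \big(1 - \frac{1}{p(p-1)}\big)$, the product over all primes. For positive integers $h, t$, $$F_h(t) := \frac{(t,h)}{\varphi(t)\,t} \prod_{\substack{p > 2 \\ p \mid t}} \left(1 - \frac{(pt,h)}{p^2 (t,h)}\right)\left(1 - \frac{(p,h)}{p(p-1)}\right)^{-1},$$ where $p$ runs over odd primes dividing $t$, $(\cdot,\cdot)$ is the greatest common divisor, and $\varphi$ is the Euler totient function. *)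

theory Defs
  imports
    "HOL-Algebra.Algebraic_Closure_Type"
    "HOL-Algebra.Finite_Extensions"
    "HOL-Algebra.Generated_Fields"
    "HOL-Algebra.Bij"
    "Jordan_Normal_Form.Determinant"
    "HOL-Computational_Algebra.Computational_Algebra"
    "HOL-Computational_Algebra.Nth_Powers"
    "HOL-Number_Theory.Totient"
    "HOL-Analysis.Infinite_Sum"
    "HOL-Analysis.Infinite_Products"
begin

section \<open>Subfields of the complex numbers\<close>

abbreviation complex_ring :: "complex ring"
  where "complex_ring \<equiv> ring_of_type_algebra"

definition field_adjoin :: "complex set \<Rightarrow> complex set"
  where "field_adjoin S = generate_field complex_ring (\<rat> \<union> S)"

definition degree_over_rats :: "complex set \<Rightarrow> nat"
  where "degree_over_rats L = ring.dim complex_ring \<rat> L"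

text \<open>As in \<^const>\<open>Bij\<close>, automorphisms are taken to be extensional functions, so that
  each automorphism of \<open>L\<close> is represented by exactly one HOL function.\<close>

definition galois_group :: "complex set \<Rightarrow> (complex \<Rightarrow> complex) set"
  where "galois_group L =
    {\<sigma> \<in> Ring.ring_hom (complex_ring\<lparr>carrier := L\<rparr>) (complex_ring\<lparr>carrier := L\<rparr>) \<inter> Bij L.
       \<forall>x \<in> \<rat>. \<sigma> x = x}"

definition complex_embeddings :: "complex set \<Rightarrow> (complex \<Rightarrow> complex) set"
  where "complex_embeddings L =
    Ring.ring_hom (complex_ring\<lparr>carrier := L\<rparr>) complex_ring \<inter> extensional L"

definition ring_of_integers :: "complex set \<Rightarrow> complex set"
  where "ring_of_integers L = {x \<in> L. algebraic_int x}"

definition integral_basis :: "complex set \<Rightarrow> complex list \<Rightarrow> bool"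
  where "integral_basis L ws \<longleftrightarrow> set ws \<subseteq> ring_of_integers L \<and>
    (\<forall>x \<in> ring_of_integers L. \<exists>!cs :: int list.
       length cs = length ws \<and> x = (\<Sum>i<length ws. of_int (cs ! i) * ws ! i))"

text \<open>The discriminant of a number field is \<open>det (\<sigma>\<^sub>i(\<omega>\<^sub>j))\<^sup>2\<close> for an integral basis
  \<open>\<omega>\<close> and an enumeration \<open>\<sigma>\<close> of the complex embeddings. It does not depend on these choices,
  so it is introduced as a relation between the field and the integer.\<close>

definition has_field_discriminant :: "complex set \<Rightarrow> int \<Rightarrow> bool"
  where "has_field_discriminant L d \<longleftrightarrow> (\<exists>ws \<sigma>s.
    integral_basis L ws \<and> distinct \<sigma>s \<and> set \<sigma>s = complex_embeddings L \<and>
    length \<sigma>s = length ws \<and>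
    of_int d = (Determinant.det (Matrix.mat (length ws) (length ws)
                  (\<lambda>(i, j). (\<sigma>s ! i) (ws ! j)))) ^ 2)"


section \<open>Lucas sequences\<close>

definition lucas_sequence :: "int \<Rightarrow> int \<Rightarrow> (nat \<Rightarrow> int) \<Rightarrow> bool"
  where "lucas_sequence a1 a2 u \<longleftrightarrow> a1 \<noteq> 0 \<and> a2 \<noteq> 0 \<and> u 0 = 0 \<and> u 1 = 1 \<and>
    (\<forall>n\<ge>2. u n = a1 * u (n - 1) + a2 * u (n - 2))"

definition lucas_discr :: "int \<Rightarrow> int \<Rightarrow> int"
  where "lucas_discr a1 a2 = a1 ^ 2 + 4 * a2"

definition characteristic_roots :: "int \<Rightarrow> int \<Rightarrow> complex \<Rightarrow> complex \<Rightarrow> bool"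
  where "characteristic_roots a1 a2 \<alpha> \<beta> \<longleftrightarrow>
    {z. z ^ 2 - of_int a1 * z - of_int a2 = 0} = {\<alpha>, \<beta>}"

definition root_of_unity :: "complex \<Rightarrow> bool"
  where "root_of_unity z \<longleftrightarrow> (\<exists>n>0. z ^ n = 1)"

definition quadratic_field :: "int \<Rightarrow> complex set"
  where "quadratic_field D = field_adjoin {csqrt (of_int D)}"

definition zeta :: "nat \<Rightarrow> complex"
  where "zeta n = exp (2 * of_real pi * \<i> / of_nat n)"

text \<open>In the following definitions, \<open>r n\<close> is the chosen \<open>n\<close>-th root of \<open>\<gamma>\<close>.\<close>

definition kummer_field :: "int \<Rightarrow> (nat \<Rightarrow> complex) \<Rightarrow> nat \<Rightarrow> complex set"
  where "kummer_field D r n = field_adjoin (quadratic_field D \<union> {zeta n, r n})"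

definition inverting_automorphism ::
    "int \<Rightarrow> (nat \<Rightarrow> complex) \<Rightarrow> nat \<Rightarrow> (complex \<Rightarrow> complex) \<Rightarrow> bool"
  where "inverting_automorphism D r n \<sigma> \<longleftrightarrow> \<sigma> \<in> galois_group (kummer_field D r n) \<and>
    \<sigma> (zeta n) = inverse (zeta n) \<and> \<sigma> (r n) = inverse (r n)"

definition C_set :: "int \<Rightarrow> (nat \<Rightarrow> complex) \<Rightarrow> nat \<Rightarrow> (complex \<Rightarrow> complex) set"
  where "C_set D r n =
    (if \<exists>\<sigma>. inverting_automorphism D r n \<sigma>
     then {(\<lambda>x \<in> kummer_field D r n. x), (SOME \<sigma>. inverting_automorphism D r n \<sigma>)}
     else {(\<lambda>x \<in> kummer_field D r n. x)})"

definition moebius :: "nat \<Rightarrow> int"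
  where "moebius n = (if squarefree n then (-1) ^ card (prime_factors n) else 0)"

definition lucas_delta :: "int \<Rightarrow> int \<Rightarrow> (nat \<Rightarrow> complex) \<Rightarrow> nat \<Rightarrow> real"
  where "lucas_delta a1 a2 r t = (\<Sum>\<^sub>\<infinity>n\<in>{1..}.
    of_int (moebius n) * real (card (C_set (lucas_discr a1 a2) r (n * t)))
      / real (degree_over_rats (kummer_field (lucas_discr a1 a2) r (n * t))))"


section \<open>The Artin constant and the functions \<open>F\<^sub>h\<close>\<close>

definition artin_constant :: real
  where "artin_constant =
    prodinf (\<lambda>p. if Factorial_Ring.prime p then 1 - 1 / (real p * (real p - 1)) else 1)"

definition F_fun :: "nat \<Rightarrow> nat \<Rightarrow> real"
  where "F_fun h t = real (gcd t h) / (real (totient t) * real t) *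
    (\<Prod>p | Factorial_Ring.prime p \<and> p > 2 \<and> p dvd t.
       (1 - real (gcd (p * t) h) / (real p ^ 2 * real (gcd t h))) *
       inverse (1 - real (gcd p h) / (real p * (real p - 1))))"

definition periodic_on_positive :: "(nat \<Rightarrow> 'a) \<Rightarrow> bool"
  where "periodic_on_positive G \<longleftrightarrow> (\<exists>T>0. \<forall>t>0. G (t + T) = G t)"

end

theory Submission
  imports Defs "Jordan_Normal_Form.Char_Poly"
begin

text \<open>
  Every automorphism of the field of algebraic numbers sends \<open>\<gamma>\<close> to \<open>\<gamma>\<close> or \<open>\<gamma>\<^sup>-\<^sup>1\<close>, and the
  degree of \<open>K\<^sub>n\<close> is the number of conjugates of the pair \<open>(\<zeta>\<^sub>n, \<gamma>\<^bsup>1/n\<^esup>)\<close>. This number divides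
  \<open>2 n \<phi>(n)\<close>, and the quotient \<open>e(n)\<close> is bounded: it is essentially the largest \<open>d\<close> such that
  \<open>\<gamma>\<close> is a \<open>d\<close>-th power in the abelian extension \<open>K(\<zeta>\<^sub>n)\<close>, and commuting automorphisms
  (Schinzel's argument) turn such a root into a \<open>d\<close>-th root of a fixed power of \<open>\<gamma>\<close> lying in \<open>K\<close>,
  which is impossible for large \<open>d\<close> as \<open>\<gamma>\<close> is not a root of unity. Since \<open>e\<close> is monotone for
  divisibility, it is maximal at some \<open>N\<close>, and comparing degrees over \<open>K\<^sub>N\<close> shows that \<open>e(n)\<close>,
  and with it the existence of the inverting automorphism, depends only on \<open>gcd(n, N)\<close>.

  So the \<open>n\<close>-th term of the series is \<open>\<mu>(n)\<close> times a function of \<open>gcd(n t, N)\<close> divided by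
  \<open>n t \<phi>(n t)\<close>. Splitting off the finitely many primes dividing \<open>N\<close> leaves an Euler product
  that differs from the Artin constant in finitely many factors. The exponent \<open>h\<close> plays no role
  in the argument: changing it changes \<open>F\<^bsub>2h\<^esub>\<close> by a periodic factor only, so \<open>h = 1\<close> will do.
\<close>

section \<open>Complex numbers as a ring in the sense of HOL-Algebra\<close>

text \<open>One group acts throughout, the automorphisms of the field of all algebraic numbers,
  instead of the Galois groups of the separate K_n. Restriction maps between the K_n are avoided,
  degrees become sizes of orbits, and the tower law becomes a count of fibres
  (\<open>card_orbit_append\<close>). The price is that enough automorphisms must be shown to exist:
  \<open>alg_aut_extend\<close> obtains them from Zorn's lemma, and
  \<open>alg_aut_root_of_unity_power\<close> needs the irreducibility of cyclotomic polynomials.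

  The bound on e(n) calls for an integer j coprime to d such that j^2 - 1 is nonzero and does not
  vary with d. No single j > 1 is coprime to every d, so d is split into its 2-part, handled with j
  = 3, and its odd part, handled with j = 2.

  Non-squareness of \<open>lucas_discr a1 a2\<close> supplies an automorphism that inverts \<gamma>.
  Roots in K of powers of \<gamma> then have norm 1 or -1, so their squares x have a rational trace
  x + 1/x, whose denominator and size bound the index d.\<close>

lemma field_complex_ring: "field complex_ring"
  by (rule field_from_type_algebra)

lemma domain_complex_ring: "domain complex_ring"
  by (rule field.axioms(1)[OF field_complex_ring])

interpretation cr: ring complex_ring
  by (rule ring_from_type_algebra)

lemma complex_ring_simps [simp]:
  "carrier complex_ring = UNIV"
  "x \<otimes>\<^bsub>complex_ring\<^esub> y = x * y"
  "x \<oplus>\<^bsub>complex_ring\<^esub> y = x + y"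
  "\<one>\<^bsub>complex_ring\<^esub> = 1"
  "\<zero>\<^bsub>complex_ring\<^esub> = 0"
  by (simp_all add: ring_of_type_algebra_def)

lemma complex_ring_a_inv [simp]: "\<ominus>\<^bsub>complex_ring\<^esub> x = - x"
  by (rule cr.minus_equality) simp_all

lemma complex_ring_m_inv [simp]: "x \<noteq> 0 \<Longrightarrow> inv\<^bsub>complex_ring\<^esub> x = inverse x"
  by (rule comm_monoid.comm_inv_char[OF cring.axioms(2)[OF cring_from_type_algebra]]) simp_all

lemma complex_ring_nat_pow [simp]: "x [^]\<^bsub>complex_ring\<^esub> (n :: nat) = x ^ n"
  by (induction n) simp_all

text \<open>A form of \<open>subfield\<close> in the arithmetic of the type \<open>complex\<close>.
  Closure under inverses makes no exception for 0, since \<open>inverse 0 = 0\<close>.\<close>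

definition is_subfield :: "complex set \<Rightarrow> bool"
  where "is_subfield F \<longleftrightarrow> 1 \<in> F \<and> (\<forall>x\<in>F. \<forall>y\<in>F. x - y \<in> F \<and> x * y \<in> F) \<and> (\<forall>x\<in>F. inverse x \<in> F)"

lemma is_subfieldD:
  assumes "is_subfield F"
  shows is_subfield_1: "1 \<in> F" and is_subfield_0: "0 \<in> F"
    and is_subfield_diff: "\<And>x y. x \<in> F \<Longrightarrow> y \<in> F \<Longrightarrow> x - y \<in> F"
    and is_subfield_uminus: "\<And>x. x \<in> F \<Longrightarrow> - x \<in> F"
    and is_subfield_add: "\<And>x y. x \<in> F \<Longrightarrow> y \<in> F \<Longrightarrow> x + y \<in> F"
    and is_subfield_mult: "\<And>x y. x \<in> F \<Longrightarrow> y \<in> F \<Longrightarrow> x * y \<in> F"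
    and is_subfield_inverse: "\<And>x. x \<in> F \<Longrightarrow> inverse x \<in> F"
    and is_subfield_divide: "\<And>x y. x \<in> F \<Longrightarrow> y \<in> F \<Longrightarrow> x / y \<in> F"
    and is_subfield_power: "\<And>x n. x \<in> F \<Longrightarrow> x ^ n \<in> F"
proof -
  show 1: "1 \<in> F" and d: "\<And>x y. x \<in> F \<Longrightarrow> y \<in> F \<Longrightarrow> x - y \<in> F"
    and m: "\<And>x y. x \<in> F \<Longrightarrow> y \<in> F \<Longrightarrow> x * y \<in> F"
    and i: "\<And>x. x \<in> F \<Longrightarrow> inverse x \<in> F"
    using assms by (auto simp: is_subfield_def)
  show 0: "0 \<in> F" using d[OF 1 1] by simp
  show u: "- x \<in> F" if "x \<in> F" for x using d[OF 0 that] by simp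
  show "x + y \<in> F" if "x \<in> F" "y \<in> F" for x y using d[OF that(1) u[OF that(2)]] by simp
  show "x / y \<in> F" if "x \<in> F" "y \<in> F" for x y
    using m[OF that(1) i[OF that(2)]] by (simp add: divide_inverse)
  show "x ^ n \<in> F" if "x \<in> F" for x n by (induction n) (auto intro: 1 m that)
qed

lemma is_subfield_iff: "is_subfield F \<longleftrightarrow> subfield F complex_ring"
proof
  assume F: "is_subfield F"
  show "subfield F complex_ring"
  proof (rule field.subfieldI'[OF field_complex_ring])
    show "subring F complex_ring"
      by (rule cr.subringI) (use is_subfieldD[OF F] in auto)
  qed (use is_subfieldD[OF F] in auto)
next
  assume F: "subfield F complex_ring"
  note sr = subfieldE(1)[OF F]
  have "x - y \<in> F" if "x \<in> F" "y \<in> F" for x y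
    using subringE(7)[OF sr that(1) subringE(5)[OF sr that(2)]] by simp
  moreover have "inverse x \<in> F" if "x \<in> F" for x
  proof (cases "x = 0")
    case False
    then show ?thesis using cr.subfield_m_inv(1)[OF F, of x] that by simp
  qed (use that in auto)
  ultimately show "is_subfield F"
    using subringE(3)[OF sr] subringE(6)[OF sr] by (auto simp: is_subfield_def)
qed

lemma is_subfield_Rats: "is_subfield \<rat>"
  by (auto simp: is_subfield_def)

text \<open>Polynomials of HOL-Algebra are lists with the leading coefficient first, whereas
  \<open>Poly\<close> expects the constant term first; hence the reversal.\<close>

lemma complex_ring_eval: "cr.eval p x = poly (Poly (rev p)) x"
proof (induction p)
  case (Cons a p)
  then show ?case
    by (cases p) (auto simp: Poly_append poly_monom)
qed auto

lemma polynomial_Rats_imp_Poly: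
  assumes "polynomial\<^bsub>complex_ring\<^esub> \<rat> p" "p \<noteq> []"
  shows "\<forall>i. coeff (Poly (rev p)) i \<in> \<rat>" "Poly (rev p) \<noteq> 0"
proof -
  have s: "set p \<subseteq> \<rat>" "hd p \<noteq> 0" using assms by (auto simp: polynomial_def)
  have "coeff (Poly (rev p)) i \<in> \<rat>" for i
  proof (cases "i < length (rev p)")
    case True
    then have "rev p ! i \<in> set (rev p)" by (rule nth_mem)
    then show ?thesis using s True by (auto simp: nth_default_def coeff_Poly_eq)
  qed (auto simp: nth_default_def coeff_Poly_eq)
  then show "\<forall>i. coeff (Poly (rev p)) i \<in> \<rat>" ..
  have "coeff (Poly (rev p)) (length p - 1) \<noteq> 0"
    using assms(2) s by (auto simp: nth_default_def coeff_Poly_eq rev_nth hd_conv_nth)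
  then show "Poly (rev p) \<noteq> 0" by (metis coeff_0)
qed

lemma rev_coeffs_in_carrier:
  assumes "\<forall>i. coeff p i \<in> \<rat>" "p \<noteq> 0"
  shows "rev (coeffs p) \<in> carrier (\<rat>[X]\<^bsub>complex_ring\<^esub>)"
proof -
  have "set (coeffs p) \<subseteq> \<rat>" using assms(1) by (auto simp: coeffs_def)
  moreover have "hd (rev (coeffs p)) \<noteq> 0"
    using assms(2) by (simp add: hd_rev last_coeffs_eq_coeff_degree)
  ultimately show ?thesis by (simp add: univ_poly_carrier[symmetric] polynomial_def)
qed

text \<open>This bridge imports the closure of the algebraic numbers under field operations
  (\<open>is_subfield_alg_numbers\<close>) from the theory of algebraic elements in
  HOL-Algebra.\<close>

lemma algebraic_over_Rats_iff:
  "(cr.algebraic over \<rat>) x \<longleftrightarrow> algebraic x"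
proof
  have sr: "subring \<rat> complex_ring"
    using is_subfield_Rats by (simp add: is_subfield_iff subfieldE(1))
  show "algebraic x" if a: "(cr.algebraic over \<rat>) x"
  proof -
    obtain p where p: "p \<in> carrier (\<rat>[X]\<^bsub>complex_ring\<^esub>)" "p \<noteq> []" "cr.eval p x = 0"
      using domain.algebraicE[OF domain_complex_ring sr _ a] by auto
    then have "polynomial\<^bsub>complex_ring\<^esub> \<rat> p" by (simp add: univ_poly_carrier)
    from polynomial_Rats_imp_Poly[OF this p(2)] show ?thesis
      using p(3) unfolding algebraic_altdef complex_ring_eval by blast
  qed
  show "(cr.algebraic over \<rat>) x" if a: "algebraic x"
  proof -
    obtain p where p: "\<forall>i. coeff p i \<in> \<rat>" "p \<noteq> 0" "poly p x = 0"
      using a unfolding algebraic_altdef by blast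
    show ?thesis
      using rev_coeffs_in_carrier[OF p(1,2)] p(2,3)
      by (intro cr.algebraicI[of "rev (coeffs p)"]) (simp_all add: complex_ring_eval)
  qed
qed

abbreviation alg_numbers :: "complex set"
  where "alg_numbers \<equiv> {x. algebraic x}"

lemma is_subfield_alg_numbers: "is_subfield alg_numbers"
  using field.subfield_of_algebraics[OF field_complex_ring is_subfield_Rats[unfolded is_subfield_iff]]
  by (simp add: algebraic_over_Rats_iff is_subfield_iff)

section \<open>Partial automorphisms as relations\<close>

text \<open>
  Isomorphisms between subrings of the complex numbers, represented by their graphs: unions of
  chains and inverses are then just unions and converses, and a graph that is maximal among these
  is the graph of a field isomorphism.
\<close>

definition ring_graph :: "(complex \<times> complex) set \<Rightarrow> bool"
  where "ring_graph R \<longleftrightarrow> (1, 1) \<in> R \<and>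
    (\<forall>(x, x')\<in>R. \<forall>(y, y')\<in>R. (x - y, x' - y') \<in> R \<and> (x * y, x' * y') \<in> R) \<and>
    (\<forall>(x, x')\<in>R. x = 0 \<longleftrightarrow> x' = 0)"

lemma ring_graphI:
  assumes "(1, 1) \<in> R"
    and "\<And>x x' y y'. (x, x') \<in> R \<Longrightarrow> (y, y') \<in> R \<Longrightarrow> (x - y, x' - y') \<in> R"
    and "\<And>x x' y y'. (x, x') \<in> R \<Longrightarrow> (y, y') \<in> R \<Longrightarrow> (x * y, x' * y') \<in> R"
    and "\<And>x x'. (x, x') \<in> R \<Longrightarrow> x = 0 \<longleftrightarrow> x' = 0"
  shows "ring_graph R"
  using assms unfolding ring_graph_def by blast

text \<open>Applied to a difference, the condition that 0 is paired with 0 only makes the relation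
  single-valued; read backwards it makes it injective.\<close>

lemma ring_graphD:
  assumes "ring_graph R"
  shows ring_graph_1: "(1, 1) \<in> R"
    and ring_graph_0: "(0, 0) \<in> R"
    and ring_graph_diff: "\<And>x x' y y'. (x, x') \<in> R \<Longrightarrow> (y, y') \<in> R \<Longrightarrow> (x - y, x' - y') \<in> R"
    and ring_graph_add: "\<And>x x' y y'. (x, x') \<in> R \<Longrightarrow> (y, y') \<in> R \<Longrightarrow> (x + y, x' + y') \<in> R"
    and ring_graph_mult: "\<And>x x' y y'. (x, x') \<in> R \<Longrightarrow> (y, y') \<in> R \<Longrightarrow> (x * y, x' * y') \<in> R"
    and ring_graph_zero_iff: "\<And>x x'. (x, x') \<in> R \<Longrightarrow> x = 0 \<longleftrightarrow> x' = 0"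
    and ring_graph_functional: "\<And>x x' x''. (x, x') \<in> R \<Longrightarrow> (x, x'') \<in> R \<Longrightarrow> x' = x''"
proof -
  show 1: "(1, 1) \<in> R"
    and d: "\<And>x x' y y'. (x, x') \<in> R \<Longrightarrow> (y, y') \<in> R \<Longrightarrow> (x - y, x' - y') \<in> R"
    and "\<And>x x' y y'. (x, x') \<in> R \<Longrightarrow> (y, y') \<in> R \<Longrightarrow> (x * y, x' * y') \<in> R"
    and z: "\<And>x x'. (x, x') \<in> R \<Longrightarrow> x = 0 \<longleftrightarrow> x' = 0"
    using assms unfolding ring_graph_def by blast+
  show 0: "(0, 0) \<in> R" using d[OF 1 1] by simp
  show "(x + y, x' + y') \<in> R" if "(x, x') \<in> R" "(y, y') \<in> R" for x x' y y'
    using d[OF that(1) d[OF 0 that(2)]] by simp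
  show "x' = x''" if "(x, x') \<in> R" "(x, x'') \<in> R" for x x' x''
    using z[OF d[OF that]] by simp
qed

text \<open>This symmetry reduces surjectivity in \<open>alg_aut_extend\<close> to totality of the
  converse.\<close>

lemma ring_graph_converse: "ring_graph (R\<inverse>) \<longleftrightarrow> ring_graph R"
proof -
  have "ring_graph (S\<inverse>)" if "ring_graph S" for S
    by (rule ring_graphI) (use ring_graphD(1,3,5,6)[OF that] in simp_all)
  from this[of R] this[of "R\<inverse>"] show ?thesis by auto
qed

lemma ring_graph_Union:
  assumes "\<C> \<noteq> {}" "\<And>R. R \<in> \<C> \<Longrightarrow> ring_graph R" "\<And>R S. R \<in> \<C> \<Longrightarrow> S \<in> \<C> \<Longrightarrow> R \<subseteq> S \<or> S \<subseteq> R"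
  shows "ring_graph (\<Union>\<C>)"
proof -
  have *: "\<exists>R\<in>\<C>. a \<in> R \<and> b \<in> R" if "a \<in> \<Union>\<C>" "b \<in> \<Union>\<C>" for a b
    using that assms(3) by blast
  show ?thesis
  proof (rule ring_graphI)
    show "(1, 1) \<in> \<Union>\<C>" using assms(1,2) ring_graph_1 by blast
    show "(x - y, x' - y') \<in> \<Union>\<C>" "(x * y, x' * y') \<in> \<Union>\<C>"
      if "(x, x') \<in> \<Union>\<C>" "(y, y') \<in> \<Union>\<C>" for x x' y y'
      using *[OF that] assms(2) ring_graph_diff ring_graph_mult by blast+
    show "x = 0 \<longleftrightarrow> x' = 0" if "(x, x') \<in> \<Union>\<C>" for x x'
      using that assms(2) ring_graph_zero_iff by blast
  qed
qed

text \<open>The induced isomorphism of fraction fields. Independence of the chosen fraction needs no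
  proof of its own, since it follows from the zero condition in \<open>ring_graph\<close>.\<close>

definition fraction_graph :: "(complex \<times> complex) set \<Rightarrow> (complex \<times> complex) set"
  where "fraction_graph R = {(x / y, x' / y') |x x' y y'. (x, x') \<in> R \<and> (y, y') \<in> R \<and> y \<noteq> 0}"

lemma ring_graph_fraction_graph:
  assumes "ring_graph R"
  shows "ring_graph (fraction_graph R)" "R \<subseteq> fraction_graph R"
    "\<And>x x'. (x, x') \<in> R \<Longrightarrow> (inverse x, inverse x') \<in> fraction_graph R"
proof -
  note R = ring_graphD[OF assms]
  have I: "(x / y, x' / y') \<in> fraction_graph R" if "(x, x') \<in> R" "(y, y') \<in> R" "y \<noteq> 0" for x x' y y'
    using that unfolding fraction_graph_def by blast
  show "R \<subseteq> fraction_graph R"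
    using I[OF _ R(1)] by auto
  show "(inverse x, inverse x') \<in> fraction_graph R" if "(x, x') \<in> R" for x x'
  proof (cases "x = 0")
    case True
    then show ?thesis using R(6)[OF that] I[OF R(2) R(1)] by simp
  next
    case False
    then show ?thesis using I[OF R(1) that] by (simp add: divide_inverse)
  qed
  show "ring_graph (fraction_graph R)"
  proof (rule ring_graphI)
    show "(1, 1) \<in> fraction_graph R" using I[OF R(1) R(1)] by simp
  next
    fix u u' v v' assume "(u, u') \<in> fraction_graph R" "(v, v') \<in> fraction_graph R"
    then obtain x x' y y' z z' w w' where *: "u = x / y" "u' = x' / y'" "v = z / w" "v' = z' / w'"
      "(x, x') \<in> R" "(y, y') \<in> R" "(z, z') \<in> R" "(w, w') \<in> R" "y \<noteq> 0" "w \<noteq> 0"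
      unfolding fraction_graph_def by blast
    have nz: "y' \<noteq> 0" "w' \<noteq> 0" using * R(6) by blast+
    have "((x * w - z * y) / (y * w), (x' * w' - z' * y') / (y' * w')) \<in> fraction_graph R"
      by (intro I R(3,5) *) (use * in auto)
    also have "((x * w - z * y) / (y * w), (x' * w' - z' * y') / (y' * w')) = (u - v, u' - v')"
      unfolding *(1-4) using * nz by (simp add: diff_frac_eq)
    finally show "(u - v, u' - v') \<in> fraction_graph R" .
    have "((x * z) / (y * w), (x' * z') / (y' * w')) \<in> fraction_graph R"
      by (intro I R(3,5) *) (use * in auto)
    then show "(u * v, u' * v') \<in> fraction_graph R" using * by simp
  next
    fix u u' assume "(u, u') \<in> fraction_graph R"
    then show "u = 0 \<longleftrightarrow> u' = 0"
      unfolding fraction_graph_def using R(6) by fastforce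
  qed
qed

definition field_graph :: "(complex \<times> complex) set \<Rightarrow> bool"
  where "field_graph R \<longleftrightarrow> ring_graph R \<and> (\<forall>(x, x')\<in>R. (inverse x, inverse x') \<in> R)"

lemma field_graph_imp_ring_graph: "field_graph R \<Longrightarrow> ring_graph R"
  by (simp add: field_graph_def)

lemma field_graph_inverse: "field_graph R \<Longrightarrow> (x, x') \<in> R \<Longrightarrow> (inverse x, inverse x') \<in> R"
  by (auto simp: field_graph_def)

section \<open>Polynomials and division with remainder along an isomorphism\<close>

definition poly_graph :: "(complex \<times> complex) set \<Rightarrow> complex poly \<Rightarrow> complex poly \<Rightarrow> bool"
  where "poly_graph R p p' \<longleftrightarrow> (\<forall>i. (coeff p i, coeff p' i) \<in> R)"

context
  fixes R :: "(complex \<times> complex) set"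
  assumes R: "ring_graph R"
begin

lemma poly_graph_0: "poly_graph R 0 0"
  using ring_graph_0[OF R] by (simp add: poly_graph_def)

lemma poly_graph_monom: "(c, c') \<in> R \<Longrightarrow> poly_graph R (monom c n) (monom c' n)"
  using ring_graph_0[OF R] by (simp add: poly_graph_def)

lemma poly_graph_const: "(c, c') \<in> R \<Longrightarrow> poly_graph R [:c:] [:c':]"
  using poly_graph_monom[of c c' 0] by (simp add: monom_0)

lemma poly_graph_X: "poly_graph R [:0, 1:] [:0, 1:]"
  using poly_graph_monom[OF ring_graph_1[OF R], of 1] by (simp add: monom_Suc monom_0)

lemma poly_graph_add:
  "poly_graph R p p' \<Longrightarrow> poly_graph R q q' \<Longrightarrow> poly_graph R (p + q) (p' + q')"
  using ring_graph_add[OF R] by (simp add: poly_graph_def)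

lemma poly_graph_diff:
  "poly_graph R p p' \<Longrightarrow> poly_graph R q q' \<Longrightarrow> poly_graph R (p - q) (p' - q')"
  using ring_graph_diff[OF R] by (simp add: poly_graph_def)

lemma poly_graph_mult:
  assumes "poly_graph R p p'" "poly_graph R q q'"
  shows "poly_graph R (p * q) (p' * q')"
proof -
  have "((\<Sum>i\<le>n. coeff p i * coeff q (m i)), (\<Sum>i\<le>n. coeff p' i * coeff q' (m i))) \<in> R" for n :: nat and m
    using assms ring_graph_mult[OF R] ring_graph_add[OF R] 
    by (induction n) (auto simp: poly_graph_def)
  then show ?thesis by (simp add: poly_graph_def coeff_mult)
qed

lemma poly_graph_degree: "poly_graph R p p' \<Longrightarrow> degree p = degree p'"
proof -
  assume "poly_graph R p p'"
  then have "coeff p i = 0 \<longleftrightarrow> coeff p' i = 0" for i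
    using ring_graph_zero_iff[OF R] unfolding poly_graph_def by blast
  then show ?thesis by (simp add: degree_def)
qed

lemma poly_graph_zero_iff: "poly_graph R p p' \<Longrightarrow> p = 0 \<longleftrightarrow> p' = 0"
proof -
  assume "poly_graph R p p'"
  then have "coeff p i = 0 \<longleftrightarrow> coeff p' i = 0" for i
    using ring_graph_zero_iff[OF R] unfolding poly_graph_def by blast
  then show ?thesis by (simp add: poly_eq_iff)
qed

text \<open>Long division uses only field operations on coefficients, so it runs on both sides of
  the isomorphism in parallel.\<close>

lemma poly_graph_division:
  assumes fg: "field_graph R"
    and f: "poly_graph R f f'" "f \<noteq> 0"
    and p: "poly_graph R p p'"
  shows "\<exists>q q' r r'. poly_graph R q q' \<and> poly_graph R r r' \<and> p = f * q + r \<and> p' = f' * q' + r' \<and>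
           (r = 0 \<or> degree r < degree f)"
  using p
proof (induction "degree p" arbitrary: p p' rule: less_induct)
  case less
  show ?case
  proof (cases "p = 0 \<or> degree p < degree f")
    case True
    then show ?thesis using less.prems poly_graph_0 by force
  next
    case False
    define k where "k = degree p - degree f"
    define c where "c = lead_coeff p * inverse (lead_coeff f)"
    define c' where "c' = lead_coeff p' * inverse (lead_coeff f')"
    have c: "(c, c') \<in> R"
      unfolding c_def c'_def using less.prems f poly_graph_degree[OF f(1)] poly_graph_degree[OF less.prems]
      by (intro ring_graph_mult[OF R] field_graph_inverse[OF fg]) (auto simp: poly_graph_def)
    have c0: "c \<noteq> 0" using False f by (auto simp: c_def)
    define p1 where "p1 = p - f * monom c k"
    define p1' where "p1' = p' - f' * monom c' k"
    have p1: "poly_graph R p1 p1'"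
      unfolding p1_def p1'_def by (intro poly_graph_diff poly_graph_mult poly_graph_monom less.prems f c)
    have deg: "degree (f * monom c k) = degree p"
    proof -
      have "degree (f * monom c k) = degree f + k"
        by (metis degree_mult_eq degree_monom_eq c0 f(2) monom_eq_0_iff)
      then show ?thesis using False by (simp add: k_def)
    qed
    have lc: "lead_coeff (f * monom c k) = lead_coeff p"
      unfolding lead_coeff_mult lead_coeff_monom using f by (simp add: c_def)
    have "p1 = 0 \<or> degree p1 < degree p"
    \<comment> \<open>Cancelling the leading term of a constant cannot lower the degree, so in that
      case the difference itself has to vanish.\<close>
    proof (cases "degree p = 0")
      case True
      then have "p = [:coeff p 0:]" "f * monom c k = [:coeff (f * monom c k) 0:]"
        using deg by (metis degree_0_id)+
      then show ?thesis unfolding p1_def using lc deg True by simp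
    next
      case False
      have "degree p1 \<noteq> degree p"
      proof
        assume "degree p1 = degree p"
        then have "lead_coeff p1 = 0" using lc deg by (simp add: p1_def)
        then show False using False \<open>degree p1 = degree p\<close> by (metis degree_0 leading_coeff_0_iff)
      qed
      moreover have "degree p1 \<le> degree p"
        unfolding p1_def by (rule degree_diff_le) (use deg in auto)
      ultimately show ?thesis by simp
    qed
    then obtain q q' r r' where q: "poly_graph R q q'" "poly_graph R r r'" "p1 = f * q + r" "p1' = f' * q' + r'"
      "r = 0 \<or> degree r < degree f"
    proof
      assume "p1 = 0"
      then have "p1' = 0" using poly_graph_zero_iff[OF p1] by simp
      then show ?thesis using that[OF poly_graph_0 poly_graph_0] \<open>p1 = 0\<close> by simp
    next
      assume "degree p1 < degree p"
      from less.hyps[OF this p1] show ?thesis using that by blast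
    qed
    have "p = f * (monom c k + q) + r" "p' = f' * (monom c' k + q') + r'"
      using q(3,4) by (simp_all add: p1_def p1'_def algebra_simps)
    moreover have "poly_graph R (monom c k + q) (monom c' k + q')"
      by (intro poly_graph_add poly_graph_monom c q)
    ultimately show ?thesis using q by blast
  qed
qed

end

section \<open>Adjoining one algebraic number to an isomorphism\<close>

context
  fixes R :: "(complex \<times> complex) set"
  assumes fg: "field_graph R"
begin

private lemmas rg = field_graph_imp_ring_graph[OF fg]
private lemmas inv = field_graph_inverse[OF fg]

text \<open>The new graph pairs the values at \<open>x\<close> and \<open>y\<close> of corresponding
  polynomials. It satisfies the zero condition because corresponding polynomials vanish at
  \<open>x\<close> and \<open>y\<close> simultaneously: both directions divide by \<open>f\<close>,
  using its minimality at \<open>x\<close> and that of \<open>f'\<close> at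
  \<open>y\<close>.\<close>

lemma ring_graph_simple_extension:
  assumes f: "poly_graph R f f'" "f \<noteq> 0" "poly f x = 0"
    and min': "\<forall>p p'. poly_graph R p p' \<longrightarrow> p \<noteq> 0 \<longrightarrow> poly p x = 0 \<longrightarrow> degree f \<le> degree p"
    and y: "poly f' y = 0"
  shows "\<exists>R'. ring_graph R' \<and> R \<subseteq> R' \<and> (x, y) \<in> R'"
proof -
  note min = min'[rule_format]
  note div = poly_graph_division[OF rg fg]
  note zero_iff = poly_graph_zero_iff[OF rg] and deg = poly_graph_degree[OF rg]
  have y_if_x: "poly p' y = 0" if p: "poly_graph R p p'" "poly p x = 0" for p p'
  proof -
    obtain q q' r r' where d: "poly_graph R q q'" "poly_graph R r r'" "p = f * q + r" "p' = f' * q' + r'"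
      "r = 0 \<or> degree r < degree f"
      using div[OF f(1,2) p(1)] by blast
    have "poly r x = 0" using d(3) p(2) f(3) by simp
    then have "r = 0" using min[OF d(2)] d(5) by force
    then have "r' = 0" using zero_iff[OF d(2)] by simp
    then show ?thesis using d(4) y by simp
  qed
  have f'0: "f' \<noteq> 0" using zero_iff[OF f(1)] f(2) by simp
  \<comment> \<open>Minimality at \<open>y\<close> is not given. A minimal \<open>g'\<close> there
    divides \<open>f'\<close>, so \<open>f = g * q\<close> and one factor vanishes at
    \<open>x\<close>. As \<open>g\<close> is not constant, minimality of \<open>f\<close> excludes
    \<open>q\<close>, and \<open>f\<close> has degree at most that of \<open>g\<close>.\<close>
  have min': "degree f' \<le> degree p'" if "poly_graph R p p'" "p' \<noteq> 0" "poly p' y = 0" for p p'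
  proof -
    define P where "P n \<longleftrightarrow> (\<exists>p p'. poly_graph R p p' \<and> p' \<noteq> 0 \<and> poly p' y = 0 \<and> degree p' = n)" for n
    have "P (degree p')" using that unfolding P_def by blast
    then have P: "P (LEAST n. P n)" and le: "(LEAST n. P n) \<le> degree p'"
      by (rule LeastI, rule Least_le)
    from P obtain g g' where g: "poly_graph R g g'" "g' \<noteq> 0" "poly g' y = 0" "degree g' = (LEAST n. P n)"
      unfolding P_def by blast
    have g0: "g \<noteq> 0" using zero_iff[OF g(1)] g(2) by simp
    obtain q q' r r' where d: "poly_graph R q q'" "poly_graph R r r'" "f = g * q + r" "f' = g' * q' + r'"
      "r = 0 \<or> degree r < degree g"
      using div[OF g(1) g0 f(1)] by blast
    have "r' = 0"
    proof (rule ccontr)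
      assume r': "r' \<noteq> 0"
      then have "P (degree r')" using d g y by (auto simp: P_def)
      then have "degree g' \<le> degree r'" using g(4) by (simp add: Least_le)
      then show False
        using r' d(5) zero_iff[OF d(2)] deg[OF d(2)] deg[OF g(1)] by simp
    qed
    then have r: "r = 0" "r' = 0" using zero_iff[OF d(2)] by simp_all
    then have "q \<noteq> 0" "poly g x = 0 \<or> poly q x = 0" using d f by auto
    moreover have "degree f = degree g + degree q" using d(3) r \<open>q \<noteq> 0\<close> g0 by (simp add: degree_mult_eq)
    moreover have "degree g \<noteq> 0"
    proof
      assume "degree g = 0"
      then have "degree g' = 0" using deg[OF g(1)] by simp
      then show False using g(2,3) by (metis degree_0_id poly_const_conv pCons_0_0 poly_0)
    qed
    ultimately have "degree f \<le> degree g"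
      using min[OF g(1) g0] min[OF d(1) \<open>q \<noteq> 0\<close>] by linarith
    then show ?thesis using le g(4) deg[OF g(1)] deg[OF f(1)] by simp
  qed
  have x_if_y: "poly p x = 0" if p: "poly_graph R p p'" "poly p' y = 0" for p p'
  proof -
    obtain q q' r r' where d: "poly_graph R q q'" "poly_graph R r r'" "p = f * q + r" "p' = f' * q' + r'"
      "r = 0 \<or> degree r < degree f"
      using div[OF f(1,2) p(1)] by blast
    have "poly r' y = 0" using d(4) p(2) y by simp
    then have "r' = 0" using min'[OF d(2)] d(5) deg[OF d(2)] deg[OF f(1)] zero_iff[OF d(2)] by force
    then have "r = 0" using zero_iff[OF d(2)] by simp
    then show ?thesis using d(3) f(3) by simp
  qed
  define R' where "R' = {(poly p x, poly p' y) |p p'. poly_graph R p p'}"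
  have I: "(poly p x, poly p' y) \<in> R'" if "poly_graph R p p'" for p p'
    using that unfolding R'_def by blast
  have "ring_graph R'"
  proof (rule ring_graphI)
    show "(1, 1) \<in> R'"
      using I[OF poly_graph_const[OF rg ring_graph_1[OF rg]]] by simp
  next
    fix u u' v v' assume "(u, u') \<in> R'" "(v, v') \<in> R'"
    then obtain p p' q q' where *: "poly_graph R p p'" "poly_graph R q q'"
      "u = poly p x" "u' = poly p' y" "v = poly q x" "v' = poly q' y"
      unfolding R'_def by blast
    show "(u - v, u' - v') \<in> R'" "(u * v, u' * v') \<in> R'"
      using I[OF poly_graph_diff[OF rg *(1,2)]] I[OF poly_graph_mult[OF rg *(1,2)]] *(3-) by simp_all
  next
    fix u u' assume "(u, u') \<in> R'"
    then obtain p p' where p: "poly_graph R p p'" "u = poly p x" "u' = poly p' y"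
      unfolding R'_def by blast
    show "u = 0 \<longleftrightarrow> u' = 0"
      using y_if_x[OF p(1)] x_if_y[OF p(1)] unfolding p(2,3) by blast
  qed
  moreover have "R \<subseteq> R'"
    using I[OF poly_graph_const[OF rg]] by auto
  moreover have "(x, y) \<in> R'"
    using I[OF poly_graph_X[OF rg]] by simp
  ultimately show ?thesis by blast
qed

lemma ring_graph_Rats:
  assumes "q \<in> \<rat>"
  shows "(q, q) \<in> R"
proof -
  have nat: "(of_nat n, of_nat n) \<in> R" for n
    by (induction n) (auto intro: ring_graph_0[OF rg] ring_graph_add[OF rg] ring_graph_1[OF rg])
  have int: "(of_int n, of_int n) \<in> R" for n
  proof (cases n)
    case (neg m)
    then show ?thesis using ring_graph_diff[OF rg ring_graph_0[OF rg] nat[of "Suc m"]] by simp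
  qed (use nat in auto)
  obtain a b where "q = of_int a / of_int b"
    using assms by (auto elim!: Rats_cases')
  then show ?thesis
    using ring_graph_mult[OF rg int[of a] inv[OF int[of b]]] by (simp add: divide_inverse)
qed

lemma minimal_poly_graph:
  assumes "algebraic x"
  obtains f f' where "poly_graph R f f'" "f \<noteq> 0" "poly f x = 0"
    "\<forall>p p'. poly_graph R p p' \<longrightarrow> p \<noteq> 0 \<longrightarrow> poly p x = 0 \<longrightarrow> degree f \<le> degree p"
proof -
  obtain p where p: "\<forall>i. coeff p i \<in> \<rat>" "p \<noteq> 0" "poly p x = 0"
    using assms unfolding algebraic_altdef by blast
  define P where "P n \<longleftrightarrow> (\<exists>p p'. poly_graph R p p' \<and> p \<noteq> 0 \<and> poly p x = 0 \<and> degree p = n)" for n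
  have "poly_graph R p p" using p ring_graph_Rats by (simp add: poly_graph_def)
  then have "P (degree p)" using p unfolding P_def by blast
  then have "P (LEAST n. P n)" by (rule LeastI)
  then obtain f f' where "poly_graph R f f'" "f \<noteq> 0" "poly f x = 0" "degree f = (LEAST n. P n)"
    unfolding P_def by blast
  then show ?thesis using that[of f f'] by (auto simp: P_def intro!: Least_le)
qed

text \<open>The image of the minimal polynomial has a complex root \<open>y\<close> by the
  fundamental theorem of algebra; adjoining \<open>(x, y)\<close> cannot enlarge a maximal
  graph.\<close>

lemma algebraic_in_maximal_ring_graph:
  assumes max: "\<forall>R'. ring_graph R' \<longrightarrow> R \<subseteq> R' \<longrightarrow> R' = R"
    and x: "algebraic x"
  shows "\<exists>y. (x, y) \<in> R"
proof -
  obtain f f' where f: "poly_graph R f f'" "f \<noteq> 0" "poly f x = 0"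
    "\<forall>p p'. poly_graph R p p' \<longrightarrow> p \<noteq> 0 \<longrightarrow> poly p x = 0 \<longrightarrow> degree f \<le> degree p"
    using minimal_poly_graph[OF x] by blast
  have "degree f \<noteq> 0"
    using f(2,3) by (metis degree_0_id poly_const_conv pCons_0_0 poly_0)
  then have "\<not> constant (poly f')"
    using poly_graph_degree[OF rg f(1)] by (simp add: constant_degree)
  then obtain y where y: "poly f' y = 0"
    using fundamental_theorem_of_algebra by blast
  show ?thesis
    using ring_graph_simple_extension[OF f(1-4) y] max by blast
qed

end

section \<open>Maximal graphs and automorphisms of the algebraic numbers\<close>

lemma maximal_ring_graph_field_graph:
  assumes R: "ring_graph R" and max: "\<forall>R'. ring_graph R' \<longrightarrow> R \<subseteq> R' \<longrightarrow> R' = R"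
  shows "field_graph R"
proof -
  have "fraction_graph R = R"
    using max ring_graph_fraction_graph(1,2)[OF R] by blast
  then show ?thesis
    using R ring_graph_fraction_graph(3)[OF R] by (auto simp: field_graph_def)
qed

lemma maximal_ring_graph_exists:
  assumes R: "ring_graph R"
  shows "\<exists>M. ring_graph M \<and> R \<subseteq> M \<and> (\<forall>R'. ring_graph R' \<longrightarrow> M \<subseteq> R' \<longrightarrow> R' = M)"
proof -
  have "\<exists>M\<in>{S. ring_graph S \<and> R \<subseteq> S}. \<forall>N\<in>{S. ring_graph S \<and> R \<subseteq> S}. M \<subseteq> N \<longrightarrow> N = M"
  proof (rule subset_Zorn_nonempty)
    fix \<C> assume C: "\<C> \<noteq> {}" "subset.chain {S. ring_graph S \<and> R \<subseteq> S} \<C>"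
    then have "ring_graph (\<Union>\<C>)"
      by (intro ring_graph_Union) (auto simp: subset_chain_def)
    moreover have "R \<subseteq> \<Union>\<C>"
      using C unfolding subset_chain_def by blast
    ultimately show "\<Union>\<C> \<in> {S. ring_graph S \<and> R \<subseteq> S}" by simp
  qed (use R in auto)
  then obtain M where M: "ring_graph M" "R \<subseteq> M"
    "\<And>N. ring_graph N \<Longrightarrow> R \<subseteq> N \<Longrightarrow> M \<subseteq> N \<Longrightarrow> N = M" by auto
  show ?thesis
    by (rule exI[of _ M]) (use M in \<open>simp add: order.trans[OF M(2)]\<close>)
qed

text \<open>Values at transcendental numbers are left arbitrary, so automorphisms are compared at
  algebraic arguments only.\<close>

definition alg_aut :: "(complex \<Rightarrow> complex) \<Rightarrow> bool"
  where "alg_aut \<sigma> \<longleftrightarrow> bij_betw \<sigma> alg_numbers alg_numbers \<and> \<sigma> 1 = 1 \<and>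
    (\<forall>x\<in>alg_numbers. \<forall>y\<in>alg_numbers. \<sigma> (x - y) = \<sigma> x - \<sigma> y \<and> \<sigma> (x * y) = \<sigma> x * \<sigma> y)"

lemma ring_graph_algebraic_image:
  assumes fg: "field_graph R" and xy: "(x, y) \<in> R" and x: "algebraic x"
  shows "algebraic y"
proof -
  note R = field_graph_imp_ring_graph[OF fg]
  obtain p where p: "\<forall>i. coeff p i \<in> \<rat>" "p \<noteq> 0" "poly p x = 0"
    using x unfolding algebraic_altdef by blast
  have pg: "poly_graph R p p" using p ring_graph_Rats[OF fg] by (simp add: poly_graph_def)
  have "(poly q x, poly q' y) \<in> R" if "poly_graph R q q'" for q q'
  proof -
    have "((\<Sum>i\<le>n. coeff q i * x ^ i), (\<Sum>i\<le>n. coeff q' i * y ^ i)) \<in> R" for n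
    proof -
      have "(x ^ k, y ^ k) \<in> R" for k
        by (induction k) (auto intro: xy ring_graph_1[OF R] ring_graph_mult[OF R])
      then have *: "(coeff q k * x ^ k, coeff q' k * y ^ k) \<in> R" for k
        using that ring_graph_mult[OF R] unfolding poly_graph_def by blast
      show ?thesis
        by (induction n) (use *[of 0] in \<open>auto simp del: power_Suc intro: ring_graph_add[OF R] *\<close>)
    qed
    from this[of "degree q"] show ?thesis
      using poly_graph_degree[OF R that] by (simp add: poly_altdef)
  qed
  from this[OF pg] have "poly p y = 0" using p(3) ring_graph_zero_iff[OF R] by metis
  then show ?thesis using p unfolding algebraic_altdef by blast
qed

text \<open>A maximal graph above \<open>R\<close> has a maximal converse, so the totality argument
  applies twice: once for the domain, once for surjectivity onto the algebraic numbers.\<close>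

theorem alg_aut_extend:
  assumes "ring_graph R"
  obtains \<sigma> where "alg_aut \<sigma>" "\<And>x y. (x, y) \<in> R \<Longrightarrow> algebraic x \<Longrightarrow> \<sigma> x = y"
proof -
  obtain M where M: "ring_graph M" "R \<subseteq> M" and max: "\<forall>R'. ring_graph R' \<longrightarrow> M \<subseteq> R' \<longrightarrow> R' = M"
    using maximal_ring_graph_exists[OF assms] by blast
  note inv = maximal_ring_graph_field_graph[OF M(1) max]
  have M': "ring_graph (M\<inverse>)" using M(1) by (simp add: ring_graph_converse)
  have max': "\<forall>R'. ring_graph R' \<longrightarrow> M\<inverse> \<subseteq> R' \<longrightarrow> R' = M\<inverse>"
  proof (intro allI impI)
    fix R' assume "ring_graph R'" "M\<inverse> \<subseteq> R'"
    then have "ring_graph (R'\<inverse>)" "M \<subseteq> R'\<inverse>"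
      by (auto simp: ring_graph_converse)
    then have "R'\<inverse> = M" using max by blast
    then show "R' = M\<inverse>" by (metis converse_converse)
  qed
  note inv' = maximal_ring_graph_field_graph[OF M' max']
  have total: "\<exists>y. (x, y) \<in> M" if "algebraic x" for x
    using algebraic_in_maximal_ring_graph[OF inv max that] by blast
  have total': "\<exists>x. (x, y) \<in> M" if "algebraic y" for y
    using algebraic_in_maximal_ring_graph[OF inv' max' that] by blast
  define \<sigma> where "\<sigma> x = (THE y. (x, y) \<in> M)" for x
  have eq: "\<sigma> x = y" if "(x, y) \<in> M" for x y
    unfolding \<sigma>_def by (rule the_equality, rule that) (rule ring_graph_functional[OF M(1) _ that])
  have in_M: "(x, \<sigma> x) \<in> M" if "algebraic x" for x
    using total[OF that] eq by blast
  have "alg_aut \<sigma>"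
    unfolding alg_aut_def
  proof (intro conjI ballI)
    show "bij_betw \<sigma> alg_numbers alg_numbers"
      unfolding bij_betw_def
    proof
      show "inj_on \<sigma> alg_numbers"
      proof (rule inj_onI)
        fix x y assume "x \<in> alg_numbers" "y \<in> alg_numbers" "\<sigma> x = \<sigma> y"
        then have "(\<sigma> x, x) \<in> M\<inverse>" "(\<sigma> x, y) \<in> M\<inverse>" using in_M[of x] in_M[of y] by simp_all
        then show "x = y" by (rule ring_graph_functional[OF M'])
      qed
      have "\<sigma> x \<in> alg_numbers" if "x \<in> alg_numbers" for x
        using ring_graph_algebraic_image[OF inv in_M] that by auto
      moreover have "y \<in> \<sigma> ` alg_numbers" if "y \<in> alg_numbers" for y
      proof -
        obtain x where x: "(x, y) \<in> M" using total' \<open>y \<in> alg_numbers\<close> by blast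
        then have "algebraic x"
          using ring_graph_algebraic_image[OF inv', of y x] \<open>y \<in> alg_numbers\<close> by auto
        then show ?thesis using eq[OF x] by blast
      qed
      ultimately show "\<sigma> ` alg_numbers = alg_numbers" by blast
    qed
    show "\<sigma> 1 = 1" using eq ring_graph_1[OF M(1)] by blast
    show "\<sigma> (x - y) = \<sigma> x - \<sigma> y" "\<sigma> (x * y) = \<sigma> x * \<sigma> y" if "x \<in> alg_numbers" "y \<in> alg_numbers" for x y
      using ring_graph_diff[OF M(1) in_M in_M, of x y] ring_graph_mult[OF M(1) in_M in_M, of x y] that
      by (simp_all add: eq)
  qed
  moreover have "\<sigma> x = y" if "(x, y) \<in> R" for x y
    using eq M(2) that by blast
  ultimately show ?thesis using that by blast
qed

section \<open>Automorphisms of the field of algebraic numbers\<close>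

lemma alg_autD:
  assumes "alg_aut \<sigma>"
  shows alg_aut_bij: "bij_betw \<sigma> alg_numbers alg_numbers"
    and alg_aut_closed: "\<And>x. algebraic x \<Longrightarrow> algebraic (\<sigma> x)"
    and alg_aut_inj: "\<And>x y. algebraic x \<Longrightarrow> algebraic y \<Longrightarrow> \<sigma> x = \<sigma> y \<longleftrightarrow> x = y"
    and alg_aut_1: "\<sigma> 1 = 1"
    and alg_aut_diff: "\<And>x y. algebraic x \<Longrightarrow> algebraic y \<Longrightarrow> \<sigma> (x - y) = \<sigma> x - \<sigma> y"
    and alg_aut_mult: "\<And>x y. algebraic x \<Longrightarrow> algebraic y \<Longrightarrow> \<sigma> (x * y) = \<sigma> x * \<sigma> y"
  using assms by (auto simp: alg_aut_def bij_betw_def inj_on_def)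

lemmas algebraic_closed =
  is_subfieldD(1-9)[OF is_subfield_alg_numbers, unfolded mem_Collect_eq]

lemma alg_aut_0: "alg_aut \<sigma> \<Longrightarrow> \<sigma> 0 = 0"
  using alg_aut_diff[of \<sigma> 1 1] algebraic_closed by simp

lemma alg_aut_uminus: "alg_aut \<sigma> \<Longrightarrow> algebraic x \<Longrightarrow> \<sigma> (- x) = - \<sigma> x"
  using alg_aut_diff[of \<sigma> 0 x] algebraic_closed by (simp add: alg_aut_0)

lemma alg_aut_add:
  "alg_aut \<sigma> \<Longrightarrow> algebraic x \<Longrightarrow> algebraic y \<Longrightarrow> \<sigma> (x + y) = \<sigma> x + \<sigma> y"
  using alg_aut_diff[of \<sigma> x "- y"] algebraic_closed by (simp add: alg_aut_uminus)

lemma alg_aut_eq_0_iff: "alg_aut \<sigma> \<Longrightarrow> algebraic x \<Longrightarrow> \<sigma> x = 0 \<longleftrightarrow> x = 0"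
  using alg_aut_inj[of \<sigma> x 0] algebraic_closed by (simp add: alg_aut_0)

lemma alg_aut_inverse: "alg_aut \<sigma> \<Longrightarrow> algebraic x \<Longrightarrow> \<sigma> (inverse x) = inverse (\<sigma> x)"
  using alg_aut_mult[of \<sigma> x "inverse x"] algebraic_closed
  by (cases "x = 0") (auto simp: alg_aut_0 alg_aut_1 alg_aut_eq_0_iff inverse_unique)

lemma alg_aut_divide:
  "alg_aut \<sigma> \<Longrightarrow> algebraic x \<Longrightarrow> algebraic y \<Longrightarrow> \<sigma> (x / y) = \<sigma> x / \<sigma> y"
  using alg_aut_mult[of \<sigma> x "inverse y"] algebraic_closed by (simp add: alg_aut_inverse divide_inverse)

lemma alg_aut_power: "alg_aut \<sigma> \<Longrightarrow> algebraic x \<Longrightarrow> \<sigma> (x ^ n) = \<sigma> x ^ n"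
  by (induction n) (auto simp: alg_aut_1 alg_aut_mult algebraic_closed)

lemma alg_aut_field_graph:
  assumes "alg_aut \<sigma>"
  shows "field_graph {(x, \<sigma> x) |x. algebraic x}"
  unfolding field_graph_def
proof
  show "ring_graph {(x, \<sigma> x) |x. algebraic x}"
    using assms alg_aut_1[OF assms] alg_aut_diff[OF assms] alg_aut_mult[OF assms] alg_aut_eq_0_iff[OF assms]
    by (intro ring_graphI) (auto simp: algebraic_closed intro!: exI)
qed (use assms alg_aut_inverse algebraic_closed in auto)

lemma alg_aut_Rats: "alg_aut \<sigma> \<Longrightarrow> q \<in> \<rat> \<Longrightarrow> \<sigma> q = q"
  using ring_graph_Rats[OF alg_aut_field_graph] by fastforce

lemma algebraic_Rats: "(q :: complex) \<in> \<rat> \<Longrightarrow> algebraic q"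
  using rat_imp_algebraic by blast

lemma alg_aut_sum:
  "alg_aut \<sigma> \<Longrightarrow> (\<And>i. i \<in> A \<Longrightarrow> algebraic (f i)) \<Longrightarrow>
    algebraic (sum f A) \<and> \<sigma> (sum f A) = (\<Sum>i\<in>A. \<sigma> (f i))"
  by (induction A rule: infinite_finite_induct) (auto simp: alg_aut_0 alg_aut_add algebraic_closed)

lemma alg_aut_poly:
  assumes "alg_aut \<sigma>" "\<forall>i. coeff p i \<in> \<rat>" "algebraic x"
  shows "algebraic (poly p x)" "\<sigma> (poly p x) = poly p (\<sigma> x)"
proof -
  have "algebraic (coeff p i * x ^ i)" "\<sigma> (coeff p i * x ^ i) = coeff p i * \<sigma> x ^ i" for i
    using assms algebraic_Rats by (simp_all add: algebraic_closed alg_aut_mult alg_aut_power alg_aut_Rats)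
  then show "algebraic (poly p x)" "\<sigma> (poly p x) = poly p (\<sigma> x)"
    using alg_aut_sum[OF assms(1), of "{..degree p}" "\<lambda>i. coeff p i * x ^ i"] by (simp_all add: poly_altdef)
qed

lemma alg_aut_id: "alg_aut id" "alg_aut (\<lambda>x. x)"
  by (simp_all add: alg_aut_def id_def bij_betw_def)

lemma alg_aut_comp: "alg_aut \<sigma> \<Longrightarrow> alg_aut \<tau> \<Longrightarrow> alg_aut (\<sigma> \<circ> \<tau>)"
  by (auto simp: alg_aut_def alg_aut_closed intro: bij_betw_trans)

text \<open>The converse of the graph is again a ring graph, so it extends to an automorphism and no
  homomorphism law has to be verified for the inverse.\<close>

lemma alg_aut_inv_exists:
  assumes "alg_aut \<sigma>"
  obtains \<rho> where "alg_aut \<rho>" "\<And>x. algebraic x \<Longrightarrow> \<rho> (\<sigma> x) = x"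
    "\<And>x. algebraic x \<Longrightarrow> \<sigma> (\<rho> x) = x"
proof -
  have "ring_graph ({(x, \<sigma> x) |x. algebraic x}\<inverse>)"
    using alg_aut_field_graph[OF assms] field_graph_imp_ring_graph ring_graph_converse by blast
  then obtain \<rho> where \<rho>: "alg_aut \<rho>"
      "\<And>x y. (x, y) \<in> {(x, \<sigma> x) |x. algebraic x}\<inverse> \<Longrightarrow> algebraic x \<Longrightarrow> \<rho> x = y"
    by (rule alg_aut_extend) blast
  have *: "\<rho> (\<sigma> x) = x" if "algebraic x" for x
    using \<rho>(2)[of "\<sigma> x" x] alg_aut_closed[OF assms] that by blast
  moreover have "\<sigma> (\<rho> y) = y" if "algebraic y" for y
  proof -
    have "\<rho> (\<sigma> (\<rho> y)) = \<rho> y" using *[OF alg_aut_closed[OF \<rho>(1) that]] .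
    then show ?thesis
      using alg_aut_inj[OF \<rho>(1)] that alg_aut_closed[OF assms] alg_aut_closed[OF \<rho>(1)] by blast
  qed
  ultimately show ?thesis using that \<rho>(1) by blast
qed

section \<open>Conjugates over a subfield and fixed fields\<close>

lemma field_graph_Id_on: "is_subfield F \<Longrightarrow> field_graph (Id_on F)"
  unfolding field_graph_def
  by (intro conjI ring_graphI) (auto simp: is_subfieldD)

text \<open>The identity on \<open>F\<close> is a field graph. Its extension by any pair of
  \<open>x\<close> and a root of \<open>f\<close> extends further to an automorphism, so
  automorphisms over \<open>F\<close> act transitively on the roots.\<close>

lemma minimal_poly_over_subfield:
  assumes F: "is_subfield F" and x: "algebraic x"
  obtains f where "\<forall>i. coeff f i \<in> F" "f \<noteq> 0" "poly f x = 0"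
    "\<forall>p. (\<forall>i. coeff p i \<in> F) \<longrightarrow> p \<noteq> 0 \<longrightarrow> poly p x = 0 \<longrightarrow> degree f \<le> degree p"
    "\<forall>y. poly f y = 0 \<longrightarrow>
      (\<exists>\<sigma>. alg_aut \<sigma> \<and> (\<forall>z\<in>F. algebraic z \<longrightarrow> \<sigma> z = z) \<and> \<sigma> x = y)"
proof -
  note fg = field_graph_Id_on[OF F]
  have pg: "poly_graph (Id_on F) p p' \<longleftrightarrow> p' = p \<and> (\<forall>i. coeff p i \<in> F)" for p p'
    by (auto simp: poly_graph_def Id_on_iff poly_eq_iff)
  obtain f where f: "\<forall>i. coeff f i \<in> F" "f \<noteq> 0" "poly f x = 0"
    "\<forall>p. (\<forall>i. coeff p i \<in> F) \<longrightarrow> p \<noteq> 0 \<longrightarrow> poly p x = 0 \<longrightarrow> degree f \<le> degree p"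
    using minimal_poly_graph[OF fg x] unfolding pg by metis
  have "\<exists>\<sigma>. alg_aut \<sigma> \<and> (\<forall>z\<in>F. algebraic z \<longrightarrow> \<sigma> z = z) \<and> \<sigma> x = y" if y: "poly f y = 0" for y
  proof -
    have "poly_graph (Id_on F) f f" using f(1) by (simp add: pg)
    then have "\<exists>R'. ring_graph R' \<and> Id_on F \<subseteq> R' \<and> (x, y) \<in> R'"
      by (rule ring_graph_simple_extension[OF fg]) (use f y in \<open>auto simp: pg\<close>)
    then obtain R' where R': "ring_graph R'" "Id_on F \<subseteq> R'" "(x, y) \<in> R'" by auto
    obtain \<sigma> where \<sigma>: "alg_aut \<sigma>" "\<And>x y. (x, y) \<in> R' \<Longrightarrow> algebraic x \<Longrightarrow> \<sigma> x = y"
      by (rule alg_aut_extend[OF R'(1)]) blast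
    have "\<sigma> z = z" if "z \<in> F" "algebraic z" for z
      using \<sigma>(2)[of z z] R'(2) that by auto
    then show ?thesis using \<sigma>(1) \<sigma>(2)[OF R'(3) x] by blast
  qed
  then show ?thesis using that[OF f] by blast
qed

text \<open>The only root of the minimal polynomial is \<open>x\<close>, by transitivity on roots. A
  double root would also be a root of the derivative, of smaller degree, so the polynomial is linear
  and \<open>x\<close> is a quotient of its coefficients.\<close>

theorem in_subfield_if_alg_aut_fixed:
  assumes F: "is_subfield F" and x: "algebraic x"
    and fixed: "\<And>\<sigma>. alg_aut \<sigma> \<Longrightarrow> (\<forall>y\<in>F. algebraic y \<longrightarrow> \<sigma> y = y) \<Longrightarrow> \<sigma> x = x"
  shows "x \<in> F"
proof -
  obtain f where f: "\<forall>i. coeff f i \<in> F" "f \<noteq> 0" "poly f x = 0"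
    "\<forall>p. (\<forall>i. coeff p i \<in> F) \<longrightarrow> p \<noteq> 0 \<longrightarrow> poly p x = 0 \<longrightarrow> degree f \<le> degree p"
    and conj: "\<forall>y. poly f y = 0 \<longrightarrow>
      (\<exists>\<sigma>. alg_aut \<sigma> \<and> (\<forall>z\<in>F. algebraic z \<longrightarrow> \<sigma> z = z) \<and> \<sigma> x = y)"
    by (rule minimal_poly_over_subfield[OF F x]) blast
  have root: "y = x" if "poly f y = 0" for y
    using conj fixed that by blast
  have d0: "degree f \<noteq> 0"
    using f(2,3) by (metis degree_0_id poly_const_conv pCons_0_0 poly_0)
  obtain g where g: "f = [:- x, 1:] * g" using f(3) by (auto simp: poly_eq_0_iff_dvd dvd_def)
  then have g0: "g \<noteq> 0" using f(2) by auto
  have deg: "degree f = degree g + 1" unfolding g using g0 by (subst degree_mult_eq) auto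
  have "degree g = 0"
  proof (rule ccontr)
    assume "degree g \<noteq> 0"
    then have "\<not> constant (poly g)" by (simp add: constant_degree)
    then obtain y where "poly g y = 0" using fundamental_theorem_of_algebra by blast
    moreover from this have "y = x" using root[of y] g by simp
    ultimately have "poly (pderiv f) x = 0" unfolding g by (simp add: pderiv_mult pderiv_pCons del: mult_pCons_left)
    moreover have "\<forall>i. coeff (pderiv f) i \<in> F"
    proof
      fix i
      have "of_nat (Suc i) \<in> F" using ring_graph_Rats[OF field_graph_Id_on[OF F], of "of_nat (Suc i)"] by (auto simp: Id_on_iff)
      then show "coeff (pderiv f) i \<in> F"
        unfolding coeff_pderiv using f(1) is_subfield_mult[OF F] by blast
    qed
    moreover have "pderiv f \<noteq> 0" using d0 by (simp add: pderiv_eq_0_iff)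
    ultimately have "degree f \<le> degree (pderiv f)" using f(4) by blast
    then show False using d0 by (simp add: degree_pderiv)
  qed
  then obtain c where c: "g = [:c:]" by (metis degree_0_id)
  then have "c \<noteq> 0" "f = [:- x * c, c:]" using g g0 by auto
  then have "coeff f 0 = - x * c" "coeff f 1 = c" by simp_all
  then have "- x * c \<in> F" "c \<in> F" using f(1) by metis+
  then have "- (- x * c / c) \<in> F"
    by (intro is_subfield_uminus[OF F] is_subfield_divide[OF F])
  then show ?thesis using \<open>c \<noteq> 0\<close> by simp
qed

theorem in_Rats_if_alg_aut_fixed:
  assumes "algebraic x" "\<And>\<sigma>. alg_aut \<sigma> \<Longrightarrow> \<sigma> x = x"
  shows "x \<in> \<rat>"
  using in_subfield_if_alg_aut_fixed[OF is_subfield_Rats] assms by blast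

text \<open>Evaluation of integer polynomials at \<open>x\<close> and \<open>y\<close> already gives
  a ring graph, and \<open>alg_aut_extend\<close> does not ask for a field graph, so rational
  coefficients are never introduced.\<close>

theorem alg_aut_conjugate:
  assumes "algebraic x"
    and "\<And>p. poly (map_poly of_int p) x = 0 \<longleftrightarrow> poly (map_poly of_int p) y = 0"
  obtains \<sigma> where "alg_aut \<sigma>" "\<sigma> x = y"
proof -
  define R where "R = {(poly (map_poly of_int p) x, poly (map_poly of_int p) y) |p. True}"
  have I: "(poly (map_poly of_int p) x, poly (map_poly of_int p) y) \<in> R" for p
    by (auto simp: R_def)
  have "ring_graph R"
  proof (rule ring_graphI)
    show "(1, 1) \<in> R" using I[of 1] by simp
  next
    fix u u' v v' assume "(u, u') \<in> R" "(v, v') \<in> R"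
    then obtain p q where *: "u = poly (map_poly of_int p) x" "u' = poly (map_poly of_int p) y"
      "v = poly (map_poly of_int q) x" "v' = poly (map_poly of_int q) y"
      by (auto simp: R_def)
    show "(u - v, u' - v') \<in> R" "(u * v, u' * v') \<in> R"
      using I[of "p - q"] I[of "p * q"] unfolding * by (simp_all add: of_int_poly_hom.hom_mult of_int_poly_hom.hom_minus)
  qed (use assms(2) in \<open>auto simp: R_def\<close>)
  have xy: "(x, y) \<in> R" using I[of "[:0, 1:]"] by simp
  obtain \<sigma> where \<sigma>: "alg_aut \<sigma>" "\<And>x y. (x, y) \<in> R \<Longrightarrow> algebraic x \<Longrightarrow> \<sigma> x = y"
    by (rule alg_aut_extend[OF \<open>ring_graph R\<close>]) blast
  show ?thesis by (rule that[OF \<sigma>(1) \<sigma>(2)[OF xy assms(1)]])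
qed

section \<open>Irreducibility of cyclotomic polynomials\<close>

abbreviation ipoly :: "int poly \<Rightarrow> complex \<Rightarrow> complex"
  where "ipoly p z \<equiv> poly (of_int_poly p) z"

lemma ipoly_simps [simp]:
  "ipoly (p + q) z = ipoly p z + ipoly q z"
  "ipoly (p - q) z = ipoly p z - ipoly q z"
  "ipoly (p * q) z = ipoly p z * ipoly q z"
  "ipoly (smult c p) z = of_int c * ipoly p z"
  "ipoly (p ^ k) z = ipoly p z ^ k"
  "ipoly (pCons c p) z = of_int c + z * ipoly p z"
  "ipoly 0 z = 0"
  by (simp_all add: hom_distribs)

text \<open>Gauss's lemma: contents multiply, so \<open>c\<close> divides the content of the
  cofactor and can be cancelled there.\<close>

lemma primitive_dvd_smult_cancel:
  fixes f p :: "int poly"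
  assumes "content f = 1" "c \<noteq> 0" "f dvd smult c p"
  shows "f dvd p"
proof -
  obtain q where q: "smult c p = f * q" using assms(3) by (auto simp: dvd_def)
  have "content (smult c p) = content q" unfolding q by (simp add: content_mult assms(1))
  then have "c dvd content q"
    by (metis content_smult dvd_triv_left normalize_dvd_iff dvd_mult2 dvd_refl)
  then have "[:c:] dvd q" by (simp add: const_poly_dvd_iff_dvd_content)
  then obtain q' where "q = smult c q'" by (auto simp: dvd_def)
  then have "smult c p = smult c (f * q')" using q by simp
  then have "p = f * q'" using assms(2) by (metis smult_cancel)
  then show ?thesis by simp
qed

text \<open>Taking the primitive part makes divisibility hold over the integers, not merely over the
  rationals: the scalar introduced by pseudo-division can be removed.\<close>

lemma int_minimal_poly_exists:
  assumes "p0 \<noteq> 0" "ipoly p0 z = 0"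
  obtains f where "f \<noteq> 0" "content f = 1" "ipoly f z = 0"
    "\<And>p. p \<noteq> 0 \<Longrightarrow> ipoly p z = 0 \<Longrightarrow> degree f \<le> degree p"
    "\<And>p. ipoly p z = 0 \<Longrightarrow> f dvd p"
proof -
  define P where "P n \<longleftrightarrow> (\<exists>p. p \<noteq> 0 \<and> ipoly p z = 0 \<and> degree p = n)" for n
  have "P (degree p0)" using assms by (auto simp: P_def)
  then have "P (LEAST n. P n)" by (rule LeastI)
  then obtain g where g: "g \<noteq> 0" "ipoly g z = 0" "degree g = (LEAST n. P n)" by (auto simp: P_def)
  define f where "f = primitive_part g"
  have gf: "g = smult (content g) f" by (simp add: f_def)
  have f0: "f \<noteq> 0" using g(1) gf by auto
  have c0: "content g \<noteq> 0" using g(1) by simp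
  have fz: "ipoly f z = 0" using g(2) c0 by (subst (asm) gf) simp
  have min: "degree f \<le> degree p" if "p \<noteq> 0" "ipoly p z = 0" for p
  proof -
    have "degree g \<le> degree p" unfolding g(3) by (rule Least_le) (use that in \<open>auto simp: P_def\<close>)
    then show ?thesis by (simp add: f_def)
  qed
  have cf: "content f = 1" using g(1) by (simp add: f_def)
  have "f dvd p" if "ipoly p z = 0" for p
  proof -
    obtain q r where qr: "pseudo_divmod p f = (q, r)" by force
    define c where "c = lead_coeff f ^ (Suc (degree p) - degree f)"
    have d: "smult c p = f * q + r" "r = 0 \<or> degree r < degree f"
      using pseudo_divmod[OF f0 qr] by (simp_all add: c_def)
    have "ipoly r z = ipoly (smult c p - f * q) z" unfolding d(1) by simp
    also have "\<dots> = 0" using that fz by simp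
    finally have "r = 0" using d(2) min[of r] by force
    then have "f dvd smult c p" using d(1) by simp
    moreover have "c \<noteq> 0" using f0 by (simp add: c_def)
    ultimately show ?thesis using primitive_dvd_smult_cancel[OF cf] by blast
  qed
  then show ?thesis using that[OF f0 cf fz min] by blast
qed

lemma freshman_dream:
  fixes x y :: "'a :: comm_ring_1"
  assumes "prime (q :: nat)"
  shows "\<exists>w. (x + y) ^ q = x ^ q + y ^ q + of_nat q * w"
proof -
  have q: "q > 0" using assms prime_gt_0_nat by blast
  have "\<exists>w. of_nat (q choose k) * x ^ k * y ^ (q - k) = of_nat q * w" if k: "k \<in> {1..<q}" for k
  proof -
    have "q dvd k * (q choose k)" using k times_binomial_minus1_eq[of k q] by simp
    moreover have "\<not> q dvd k" using k by (auto dest: dvd_imp_le)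
    ultimately have "q dvd (q choose k)" using assms prime_dvd_mult_iff by blast
    then obtain m where "q choose k = q * m" by (auto simp: dvd_def)
    then have "of_nat (q choose k) * x ^ k * y ^ (q - k) = of_nat q * (of_nat m * x ^ k * y ^ (q - k))"
      by (simp add: mult.assoc)
    then show ?thesis by blast
  qed
  then obtain w where w: "\<And>k. k \<in> {1..<q} \<Longrightarrow> of_nat (q choose k) * x ^ k * y ^ (q - k) = of_nat q * w k"
    by metis
  have "(x + y) ^ q = (\<Sum>k\<le>q. of_nat (q choose k) * x ^ k * y ^ (q - k))"
    by (rule binomial_ring)
  also have "{..q} = insert 0 (insert q {1..<q})" using q by auto
  also have "(\<Sum>k\<in>insert 0 (insert q {1..<q}). of_nat (q choose k) * x ^ k * y ^ (q - k)) =
      y ^ q + (x ^ q + (\<Sum>k\<in>{1..<q}. of_nat (q choose k) * x ^ k * y ^ (q - k)))"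
    using q by simp
  also have "(\<Sum>k\<in>{1..<q}. of_nat (q choose k) * x ^ k * y ^ (q - k)) = of_nat q * (\<Sum>k\<in>{1..<q}. w k)"
    unfolding sum_distrib_left by (intro sum.cong refl w)
  finally show ?thesis by (auto simp: add_ac)
qed

lemma fermat_int:
  fixes a :: int
  assumes "prime (q :: nat)"
  shows "\<exists>b. a ^ q = a + int q * b"
proof (induction a rule: int_induct[where k = 0])
  case base
  show ?case using prime_gt_0_nat[OF assms] by (intro exI[of _ 0]) simp
next
  case (step1 a)
  then obtain b where "a ^ q = a + int q * b" by blast
  moreover obtain w where "(a + 1) ^ q = a ^ q + 1 ^ q + of_nat q * w" using freshman_dream[OF assms] by blast
  ultimately show ?case by (intro exI[of _ "b + w"]) (simp add: algebra_simps)
next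
  case (step2 a)
  then obtain b where "a ^ q = a + int q * b" by blast
  moreover obtain w where "(a - 1 + 1) ^ q = (a - 1) ^ q + 1 ^ q + of_nat q * w" using freshman_dream[OF assms] by blast
  ultimately show ?case by (intro exI[of _ "b - w"]) (simp add: algebra_simps)
qed

text \<open>The congruence of f(X^q) and f(X)^q modulo q, with an explicit cofactor so that it can
  be evaluated at complex numbers.\<close>

lemma ipoly_frobenius:
  assumes "prime (q :: nat)"
  shows "\<exists>h. \<forall>z. ipoly f (z ^ q) = ipoly f z ^ q + of_nat q * ipoly h z"
proof (induction f)
  case 0
  show ?case using prime_gt_0_nat[OF assms] by (intro exI[of _ 0]) simp
next
  case (pCons a f)
  then obtain h where h: "\<And>z. ipoly f (z ^ q) = ipoly f z ^ q + of_nat q * ipoly h z" by blast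
  obtain b where b: "a ^ q = a + int q * b" using fermat_int[OF assms] by blast
  obtain w where w: "([:a:] + [:0, 1:] * f) ^ q = [:a:] ^ q + ([:0, 1:] * f) ^ q + of_nat q * w"
    using freshman_dream[OF assms] by blast
  define H where "H = [:0, 1:] ^ q * h - [:b:] - w"
  have "ipoly (pCons a f) (z ^ q) = ipoly (pCons a f) z ^ q + of_nat q * ipoly H z" for z
  proof -
    have "ipoly (pCons a f) z ^ q = ipoly (([:a:] + [:0, 1:] * f) ^ q) z" by simp
    also have "\<dots> = of_int (a ^ q) + (z * ipoly f z) ^ q + of_nat q * ipoly w z"
      unfolding w ipoly_simps by (simp add: of_nat_poly)
    also have "\<dots> = of_int a + of_nat q * of_int b + (z * ipoly f z) ^ q + of_nat q * ipoly w z"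
      unfolding b by simp
    finally show ?thesis by (simp add: H_def h algebra_simps power_mult_distrib)
  qed
  then show ?case by blast
qed

text \<open>Dedekind's argument, carried out in \<int>[z] instead of over the field with q elements.
  If the minimal polynomial f of z does not vanish at w = z^q, differentiating X^n - 1 = f g at w
  shows that f(w) divides n in \<int>[z], while the Frobenius congruence shows that q divides f(w).
  An integer divisible by q in \<int>[z] is divisible by q in \<int>, against the hypothesis on
  q.\<close>

lemma ipoly_root_of_unity_prime_power:
  assumes z: "z ^ n = 1" "n > 0" and q: "prime q" "\<not> q dvd n" and p: "ipoly p z = 0"
  shows "ipoly p (z ^ q) = 0"
proof -
  define u :: "int poly" where "u = monom 1 n - 1"
  have u: "ipoly u x = x ^ n - 1" for x by (simp add: u_def poly_monom)
  have "coeff u n = 1" using z by (simp add: u_def)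
  then have "u \<noteq> 0" by auto
  then obtain f where f: "f \<noteq> 0" "content f = 1" "ipoly f z = 0"
    "\<And>p. p \<noteq> 0 \<Longrightarrow> ipoly p z = 0 \<Longrightarrow> degree f \<le> degree p"
    "\<And>p. ipoly p z = 0 \<Longrightarrow> f dvd p"
    using int_minimal_poly_exists[of u z] u z(1) by auto
  have "f dvd u" using f(5)[of u] u z(1) by simp
  then obtain g where g: "u = f * g" by (auto simp: dvd_def)
  have deg_u: "degree u = n"
  proof (rule antisym)
    show "degree u \<le> n" unfolding u_def by (rule degree_diff_le) (simp_all add: degree_monom_le)
    show "n \<le> degree u" using \<open>coeff u n = 1\<close> by (intro le_degree) simp
  qed
  \<comment> \<open>A factor of a monic integer polynomial has a unit as leading coefficient, so the
    scalar \<open>c\<close> of the later pseudo-division is a unit too.\<close>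
  have "lead_coeff f * lead_coeff g = 1"
    using \<open>coeff u n = 1\<close> deg_u lead_coeff_mult[of f g] g by simp
  then have lc: "lead_coeff f dvd 1" by (metis dvd_triv_left)
  define w where "w = z ^ q"
  have "ipoly f w = 0"
  proof (rule ccontr)
    assume fw: "ipoly f w \<noteq> 0"
    have "w ^ n = 1" unfolding w_def using z(1) by (metis power_commutes power_mult power_one mult.commute)
    then have gw: "ipoly g w = 0" using u[of w] fw unfolding g by simp
    have "pderiv u = monom (int n) (n - 1)"
      by (simp add: u_def pderiv_diff pderiv_monom)
    then have "ipoly (pderiv u) w = of_nat n * w ^ (n - 1)" by (simp add: poly_monom)
    moreover have "ipoly (pderiv u) w = ipoly f w * ipoly (pderiv g) w"
      unfolding g pderiv_mult using gw by simp
    ultimately have "of_nat n * w ^ (n - 1) * w = ipoly f w * ipoly (pderiv g) w * w" by simp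
    also have "of_nat n * w ^ (n - 1) * w = of_nat n"
      using \<open>w ^ n = 1\<close> z(2) by (metis mult.assoc mult_1_right power_minus_mult)
    finally have n: "of_nat n = ipoly f w * ipoly (pderiv g) w * w" .
    obtain h where "\<And>z. ipoly f (z ^ q) = ipoly f z ^ q + of_nat q * ipoly h z"
      using ipoly_frobenius[OF q(1)] by metis
    then have fw': "ipoly f w = of_nat q * ipoly h z"
      using f(3) prime_gt_0_nat[OF q(1)] by (simp add: w_def)
    define H where "H = h * (pderiv g \<circ>\<^sub>p monom 1 q) * monom 1 q"
    have "ipoly (pderiv g \<circ>\<^sub>p monom 1 q) z = ipoly (pderiv g) w"
      by (simp add: of_int_hom.map_poly_pcompose poly_pcompose poly_monom w_def)
    then have nH: "of_nat n = of_nat q * ipoly H z"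
      using n fw' by (simp add: H_def poly_monom w_def)
    obtain a r where ar: "pseudo_divmod H f = (a, r)" by force
    define c where "c = lead_coeff f ^ (Suc (degree H) - degree f)"
    have d: "smult c H = f * a + r" "r = 0 \<or> degree r < degree f"
      using pseudo_divmod[OF f(1) ar] by (simp_all add: c_def)
    define s where "s = smult (int q) r - [:c * int n:]"
    have "of_int c * ipoly H z = ipoly r z"
      using f(3) arg_cong[OF d(1), of "\<lambda>p. ipoly p z"] by simp
    then have "ipoly s z = 0"
      unfolding s_def ipoly_simps by (simp add: nH mult_ac flip: \<open>of_int c * ipoly H z = ipoly r z\<close>)
    moreover have "degree f \<noteq> 0"
    proof
      assume "degree f = 0"
      then obtain k where "f = [:k:]" by (metis degree_0_id)
      then show False using f(1,3) by simp
    qed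
    then have "degree s < degree f"
      using d(2) unfolding s_def
      by (intro degree_diff_less) (auto intro: le_less_trans[OF degree_smult_le])
    \<comment> \<open>Below the degree of the minimal polynomial an integer relation is trivial, so
      \<open>q * r\<close> and \<open>c * n\<close> agree coefficientwise; the constant term gives
      the divisibility.\<close>
    ultimately have "s = 0" using f(4)[of s] by linarith
    then have "coeff s 0 = 0" by simp
    then have "int q * coeff r 0 = c * int n" by (simp add: s_def)
    then have "int q dvd c * int n" by (metis dvd_triv_left)
    moreover have "c dvd 1" using lc unfolding c_def by (metis dvd_power_same power_one)
    ultimately have "int q dvd int n" by (metis dvd_trans mult_dvd_mono dvd_refl mult_1)
    then show False using q(2) by simp
  qed
  moreover have "f dvd p" using f(5)[OF p] .
  ultimately show ?thesis by (auto simp: dvd_def w_def)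
qed

lemma ipoly_root_of_unity_power:
  assumes "z ^ n = 1" "n > 0" "coprime k n" "ipoly p z = 0"
  shows "ipoly p (z ^ k) = 0"
  using assms
proof (induction k arbitrary: z rule: less_induct)
  case (less k)
  consider "k = 0" | "k = 1" | "k > 1" by linarith
  then show ?case
  proof cases
    case 1
    then have "n = 1" using less.prems by simp
    then show ?thesis using less.prems 1 by simp
  next
    case 3
    then obtain q where q: "prime q" "q dvd k" using prime_factor_nat by (metis less_irrefl)
    then obtain m where m: "k = q * m" by (auto simp: dvd_def)
    have "m < k" using m 3 prime_gt_1_nat[OF q(1)] 3 by (cases "m = 0") auto
    moreover have "coprime m n" "coprime q n" using less.prems(3) m by simp_all
    moreover have "\<not> q dvd n" using \<open>coprime q n\<close> q(1) by (metis coprime_absorb_left not_prime_unit)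
    moreover have "(z ^ q) ^ n = 1" using less.prems(1) by (metis mult.commute power_mult power_one)
    ultimately show ?thesis
      using less.IH[of m "z ^ q"] ipoly_root_of_unity_prime_power[OF less.prems(1,2) q(1)] less.prems m
      by (simp add: power_mult)
  qed (use less.prems in simp)
qed

lemma algebraic_root:
  assumes "z ^ n = c" "n > 0" "algebraic c"
  shows "algebraic (z :: complex)"
proof -
  obtain p where p: "\<forall>i. coeff p i \<in> \<int>" "p \<noteq> 0" "poly p c = 0"
    using assms(3) unfolding algebraic_def by blast
  define p' where "p' = p \<circ>\<^sub>p monom 1 n"
  have "coeff p' i \<in> \<int>" for i
    using p(1) by (auto simp: p'_def intro!: coeff_pcompose_semiring_closed)
  moreover have "p' \<noteq> 0" using p(2) assms(2) by (simp add: p'_def pcompose_eq_0_iff degree_monom_eq)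
  moreover have "poly p' z = 0" using p(3) assms(1) by (simp add: p'_def poly_pcompose poly_monom)
  ultimately show ?thesis unfolding algebraic_def by blast
qed

text \<open>The numbers \<open>z\<close> and \<open>z ^ k\<close> are roots of the same integer
  polynomials: the converse direction raises \<open>z ^ k\<close> to an inverse of \<open>k\<close>
  modulo \<open>n\<close>.\<close>

theorem alg_aut_root_of_unity_power:
  assumes z: "z ^ n = 1" "n > 0" and k: "coprime k n"
  obtains \<sigma> where "alg_aut \<sigma>" "\<sigma> z = z ^ k"
proof (rule alg_aut_conjugate)
  show "algebraic z"
    using algebraic_root[OF z] algebraic_closed(1) by blast
  fix p
  obtain k' where k': "[k * k' = 1] (mod n)" using cong_solve_coprime_nat[OF k] by auto
  have pw: "z ^ a = z ^ (a mod n)" for a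
    by (metis z(1) mult_1 div_mult_mod_eq mult.commute power_add power_mult power_one)
  have "(z ^ k) ^ k' = z"
    using k' pw[of "k * k'"] pw[of 1] by (simp add: power_mult cong_def)
  moreover have "coprime k' n"
    using k' by (metis cong_imp_coprime cong_sym coprime_1_left coprime_mult_left_iff)
  moreover have "(z ^ k) ^ n = 1" using z(1) by (metis mult.commute power_mult power_one)
  ultimately show "ipoly p z = 0 \<longleftrightarrow> ipoly p (z ^ k) = 0"
    using ipoly_root_of_unity_power[OF z k] ipoly_root_of_unity_power[of "z ^ k" n k' p] z(2) by auto
qed

section \<open>Degrees of number fields\<close>

lemma is_subfield_field_adjoin: "is_subfield (field_adjoin S)"
  using field.generate_field_is_subfield[OF field_complex_ring, of "\<rat> \<union> S"]
  by (simp add: field_adjoin_def is_subfield_iff)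

lemma field_adjoin_incl: "S \<subseteq> field_adjoin S" "\<rat> \<subseteq> field_adjoin S"
  by (auto simp: field_adjoin_def intro: generate_field.incl)

lemma field_adjoin_subset:
  assumes "is_subfield F" "S \<subseteq> F"
  shows "field_adjoin S \<subseteq> F"
proof
  fix x assume "x \<in> field_adjoin S"
  then show "x \<in> F"
    unfolding field_adjoin_def
  proof (induction rule: generate_field.induct)
    case (incl h)
    then show ?case using assms(2) ring_graph_Rats[OF field_graph_Id_on[OF assms(1)]] by auto
  qed (use is_subfieldD[OF assms(1)] in auto)
qed

text \<open>By transitivity the conjugates are all the roots of \<open>f\<close>, and they are
  simple: a multiple root could be moved to \<open>x\<close>, where the derivative of
  \<open>f\<close> would contradict minimality.\<close>

lemma minimal_poly_over_Rats:
  assumes x: "algebraic x"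
  obtains f where "\<forall>i. coeff f i \<in> \<rat>" "f \<noteq> 0" "poly f x = 0"
    "\<forall>p. (\<forall>i. coeff p i \<in> \<rat>) \<longrightarrow> p \<noteq> 0 \<longrightarrow> poly p x = 0 \<longrightarrow> degree f \<le> degree p"
    "degree f = card {\<sigma> x |\<sigma>. alg_aut \<sigma>}"
proof -
  obtain f where f: "\<forall>i. coeff f i \<in> \<rat>" "f \<noteq> 0" "poly f x = 0"
    and min: "\<forall>p. (\<forall>i. coeff p i \<in> \<rat>) \<longrightarrow> p \<noteq> 0 \<longrightarrow> poly p x = 0 \<longrightarrow> degree f \<le> degree p"
    and conj: "\<forall>y. poly f y = 0 \<longrightarrow>
      (\<exists>\<sigma>. alg_aut \<sigma> \<and> (\<forall>z\<in>\<rat>. algebraic z \<longrightarrow> \<sigma> z = z) \<and> \<sigma> x = y)"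
    by (rule minimal_poly_over_subfield[OF is_subfield_Rats x]) blast
  have roots: "{\<sigma> x |\<sigma>. alg_aut \<sigma>} = {y. poly f y = 0}"
  proof (intro equalityI subsetI)
    fix y assume "y \<in> {\<sigma> x |\<sigma>. alg_aut \<sigma>}"
    then obtain \<sigma> where \<sigma>: "alg_aut \<sigma>" "y = \<sigma> x" by blast
    have "poly f (\<sigma> x) = \<sigma> 0" using alg_aut_poly(2)[OF \<sigma>(1) f(1) x] f(3) by simp
    then show "y \<in> {y. poly f y = 0}" using \<sigma> by (simp add: alg_aut_0)
  qed (use conj in blast)
  have d0: "degree f \<noteq> 0"
    using f(2,3) by (metis degree_0_id poly_const_conv pCons_0_0 poly_0)
  have "rsquarefree f"
    unfolding rsquarefree_roots
  proof (intro allI notI)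
    fix y assume y: "poly f y = 0 \<and> poly (pderiv f) y = 0"
    then obtain \<sigma> where \<sigma>: "alg_aut \<sigma>" "\<sigma> x = y" using conj by blast
    have rat: "\<forall>i. coeff (pderiv f) i \<in> \<rat>"
      using f(1) by (auto simp: coeff_pderiv simp del: of_nat_Suc intro!: Rats_mult)
    have "\<sigma> (poly (pderiv f) x) = 0"
      using alg_aut_poly(2)[OF \<sigma>(1) rat x] y \<sigma>(2) by simp
    then have "poly (pderiv f) x = 0"
      using alg_aut_eq_0_iff[OF \<sigma>(1)] alg_aut_poly(1)[OF \<sigma>(1) rat x] by blast
    moreover have "pderiv f \<noteq> 0" using d0 by (simp add: pderiv_eq_0_iff)
    ultimately have "degree f \<le> degree (pderiv f)" using min rat by blast
    then show False using d0 by (simp add: degree_pderiv)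
  qed
  then have c: "count (proots f) y = 1" if "y \<in> set_mset (proots f)" for y
    using that f(2) unfolding rsquarefree_def by (metis One_nat_def count_proots not_in_iff)
  have "degree f = size (proots f)" by (simp add: size_proots_complex)
  also have "\<dots> = card {y. poly f y = 0}"
    using c f(2) by (simp add: size_multiset_overloaded_eq)
  finally show ?thesis using that[OF f min] roots by simp
qed

text \<open>The last assumption says in terms of automorphisms that \<open>\<theta>\<close> is a
  primitive element; \<open>in_subfield_if_alg_aut_fixed\<close> turns it into equality of the field
  with \<rat>(\<theta>).\<close>

theorem degree_over_rats_eq_card_conjugates:
  assumes S: "S \<subseteq> alg_numbers" and \<theta>: "\<theta> \<in> field_adjoin S"
    and prim: "\<And>\<sigma> x. alg_aut \<sigma> \<Longrightarrow> \<sigma> \<theta> = \<theta> \<Longrightarrow> x \<in> S \<Longrightarrow> \<sigma> x = x"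
  shows "degree_over_rats (field_adjoin S) = card {\<sigma> \<theta> |\<sigma>. alg_aut \<sigma>}"
proof -
  have alg: "algebraic \<theta>"
    using field_adjoin_subset[OF is_subfield_alg_numbers S] \<theta> by blast
  have Q: "subfield \<rat> complex_ring" and alg': "(cr.algebraic over \<rat>) \<theta>"
    using is_subfield_Rats alg by (simp_all add: is_subfield_iff algebraic_over_Rats_iff)
  note Qr = subfieldE(1)[OF Q]
  have \<theta>c: "\<theta> \<in> carrier complex_ring" by simp
  define T where "T = cr.simple_extension \<rat> \<theta>"
  have T: "is_subfield T"
    unfolding T_def is_subfield_iff
    using domain.simple_extension_is_subfield[OF domain_complex_ring Q \<theta>c] alg' by blast
  have \<theta>T: "\<theta> \<in> T" unfolding T_def by (rule cr.simple_extension_mem[OF Qr \<theta>c])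
  have "S \<subseteq> T"
  proof
    fix x assume x: "x \<in> S"
    then have "algebraic x" using S by blast
    then show "x \<in> T"
    proof (rule in_subfield_if_alg_aut_fixed[OF T])
      fix \<sigma> assume "alg_aut \<sigma>" "\<forall>y\<in>T. algebraic y \<longrightarrow> \<sigma> y = y"
      then show "\<sigma> x = x" using prim x \<theta>T alg by blast
    qed
  qed
  then have "field_adjoin S \<subseteq> T" by (rule field_adjoin_subset[OF T])
  moreover have "T \<subseteq> field_adjoin S"
    unfolding T_def using is_subfield_field_adjoin[of S] \<theta> field_adjoin_incl(2)
    by (intro cr.simple_extension_subring_incl) (simp_all add: is_subfield_iff subfieldE(1))
  ultimately have T_eq: "field_adjoin S = T" by blast
  obtain f where f: "\<forall>i. coeff f i \<in> \<rat>" "f \<noteq> 0" "poly f \<theta> = 0"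
    "\<forall>p. (\<forall>i. coeff p i \<in> \<rat>) \<longrightarrow> p \<noteq> 0 \<longrightarrow> poly p \<theta> = 0 \<longrightarrow> degree f \<le> degree p"
    "degree f = card {\<sigma> \<theta> |\<sigma>. alg_aut \<sigma>}"
    using minimal_poly_over_Rats[OF alg] by blast
  define I where "I = cr.Irr \<rat> \<theta>"
  note IrrE = domain.IrrE[OF domain_complex_ring Q \<theta>c alg', folded I_def]
  have Ip: "polynomial\<^bsub>complex_ring\<^esub> \<rat> I" using IrrE(1) by (simp add: univ_poly_carrier)
  have I0: "I \<noteq> []"
    using cr.pirreducible_degree[OF Q IrrE(1,2)] by auto
  have dim: "degree_over_rats T = length I - 1"
    using cr.dimI[OF Q domain.dimension_simple_extension[OF domain_complex_ring Q \<theta>c alg']]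
    by (simp add: degree_over_rats_def T_def I_def over_def)
  \<comment> \<open>\<open>I\<close> and \<open>f\<close> are minimal polynomials of the same number
    in two encodings. Each is minimal in its own, so comparing degrees in both directions avoids
    identifying them.\<close>
  have "length I - 1 \<le> degree f"
  proof -
    note fl = rev_coeffs_in_carrier[OF f(1,2)]
    have "cr.eval (rev (coeffs f)) \<theta> = \<zero>\<^bsub>complex_ring\<^esub>" using f(3) by (simp add: complex_ring_eval)
    from domain.Irr_minimal[OF domain_complex_ring Q \<theta>c alg' fl this, folded I_def]
    have "length I - 1 \<le> length (rev (coeffs f)) - 1"
      by (intro domain.pdivides_imp_degree_le[OF domain_complex_ring Qr IrrE(1) fl]) (use f(2) in auto)
    then show ?thesis by (simp add: length_coeffs_degree f(2))
  qed
  moreover have "degree f \<le> length I - 1"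
  proof -
    note polynomial_Rats_imp_Poly[OF Ip I0]
    moreover have "poly (Poly (rev I)) \<theta> = 0" using IrrE(4) by (simp add: complex_ring_eval)
    ultimately have "degree f \<le> degree (Poly (rev I))" using f(4) by blast
    also have "\<dots> \<le> length I - 1"
      by (rule degree_le) (auto simp: coeff_Poly_eq nth_default_def)
    finally show ?thesis .
  qed
  ultimately show ?thesis using T_eq dim f(5) by simp
qed

section \<open>Kummer extensions\<close>

lemma is_subfield_alg_aut_vimage:
  assumes "alg_aut \<sigma>" "is_subfield F"
  shows "is_subfield {x. algebraic x \<and> \<sigma> x \<in> F}"
  unfolding is_subfield_def
  using is_subfieldD[OF assms(2)] assms(1)
  by (auto simp: algebraic_closed alg_aut_1 alg_aut_diff alg_aut_mult alg_aut_inverse)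

lemma is_subfield_alg_aut_fixed:
  assumes "alg_aut \<sigma>"
  shows "is_subfield {x. algebraic x \<and> \<sigma> x = x}"
  unfolding is_subfield_def using assms
  by (auto simp: algebraic_closed alg_aut_1 alg_aut_diff alg_aut_mult alg_aut_inverse)

lemma zeta_pow: "n > 0 \<Longrightarrow> zeta n ^ n = 1"
  by (simp add: zeta_def flip: exp_of_nat_mult)

lemma zeta_nonzero [simp]: "zeta n \<noteq> 0"
  by (simp add: zeta_def)

lemma zeta_power_dvd: "d dvd n \<Longrightarrow> n > 0 \<Longrightarrow> zeta n ^ (n div d) = zeta d"
  by (auto simp: zeta_def real_of_nat_div field_simps simp flip: exp_of_nat_mult)

lemma roots_of_unity_eq_zeta_powers:
  assumes "z ^ n = 1" "n > 0"
  obtains k where "k < n" "z = zeta n ^ k"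
proof -
  have "z \<in> {z. z ^ n = 1}" using assms(1) by simp
  then have "z \<in> (\<lambda>k. cis (2 * pi * real k / real n)) ` {..<n}"
    using Complex.bij_betw_roots_unity[OF assms(2)] by (simp add: bij_betw_def)
  then obtain k where k: "k < n" "z = cis (2 * pi * real k / real n)" by auto
  have "z = zeta n ^ k"
    unfolding k(2) zeta_def by (simp add: cis_conv_exp field_simps flip: exp_of_nat_mult)
  then show ?thesis using that k(1) by blast
qed

lemma algebraic_zeta: "n > 0 \<Longrightarrow> algebraic (zeta n)"
  using algebraic_root[OF zeta_pow] algebraic_closed(1) by blast

text \<open>What the degree computations use of the Lucas sequence. \<open>sqrt_fixed\<close>
  expresses that the square root of \<open>D\<close> lies in \<rat>(\<gamma>), so the quadratic
  field contributes no generator beyond \<open>zeta n\<close> and \<open>r n\<close>.\<close>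

locale kummer =
  fixes D :: int and \<gamma> :: complex and r :: "nat \<Rightarrow> complex"
  assumes not_root_of_unity: "\<not> root_of_unity \<gamma>"
    and r_pow: "\<And>n. n > 0 \<Longrightarrow> r n ^ n = \<gamma>"
    and algebraic_\<gamma>: "algebraic \<gamma>"
    and sqrt_fixed: "\<And>\<sigma>. alg_aut \<sigma> \<Longrightarrow> \<sigma> \<gamma> = \<gamma> \<Longrightarrow> \<sigma> (csqrt (of_int D)) = csqrt (of_int D)"
    and \<gamma>_conjugate: "\<And>\<sigma>. alg_aut \<sigma> \<Longrightarrow> \<sigma> \<gamma> = \<gamma> \<or> \<sigma> \<gamma> = inverse \<gamma>"
    and \<gamma>_inverted: "\<exists>\<sigma>. alg_aut \<sigma> \<and> \<sigma> \<gamma> = inverse \<gamma>"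
    and \<gamma>_nonzero: "\<gamma> \<noteq> 0"
begin

lemma r_nonzero: "n > 0 \<Longrightarrow> r n \<noteq> 0"
  using r_pow[of n] \<gamma>_nonzero by (auto simp: power_0_left)

lemma algebraic_r: "n > 0 \<Longrightarrow> algebraic (r n)"
  using algebraic_root[OF r_pow _ algebraic_\<gamma>] by blast

lemma \<gamma>_power_neq_1: "m > 0 \<Longrightarrow> \<gamma> ^ m \<noteq> 1"
  using not_root_of_unity unfolding root_of_unity_def by blast

lemma \<gamma>_neq_inverse: "\<gamma> \<noteq> inverse \<gamma>"
proof
  assume "\<gamma> = inverse \<gamma>"
  then have "\<gamma> ^ 2 = 1" using \<gamma>_nonzero by (simp add: power2_eq_square field_simps)
  then show False using \<gamma>_power_neq_1[of 2] by simp
qed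

definition conjugates :: "nat \<Rightarrow> (complex \<times> complex) set"
  where "conjugates n = {(\<sigma> (zeta n), \<sigma> (r n)) |\<sigma>. alg_aut \<sigma>}"

lemma conjugates_subset:
  assumes "n > 0"
  shows "conjugates n \<subseteq> {z. z ^ n = 1} \<times> ({w. w ^ n = \<gamma>} \<union> {w. w ^ n = inverse \<gamma>})"
proof (clarsimp simp: conjugates_def)
  fix \<sigma> assume \<sigma>: "alg_aut \<sigma>"
  have "\<sigma> (zeta n) ^ n = \<sigma> (zeta n ^ n)" "\<sigma> (r n) ^ n = \<sigma> (r n ^ n)"
    using \<sigma> assms by (simp_all add: alg_aut_power algebraic_zeta algebraic_r)
  then show "\<sigma> (zeta n) ^ n = 1 \<and> (\<sigma> (r n) ^ n = \<gamma> \<or> \<sigma> (r n) ^ n = inverse \<gamma>)"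
    using \<gamma>_conjugate[OF \<sigma>] assms \<sigma> by (simp add: zeta_pow r_pow alg_aut_1)
qed

lemma finite_conjugates: "n > 0 \<Longrightarrow> finite (conjugates n)"
  using finite_subset[OF conjugates_subset[of n]] finite_nth_roots by blast

text \<open>The usual primitive element \<open>zeta n + q * r n\<close>. The finite set
  \<open>B\<close> contains every \<open>q\<close> for which two distinct conjugate pairs would give
  the same value, so some natural number avoids it.\<close>

theorem degree_kummer_field:
  assumes n: "n > 0"
  shows "degree_over_rats (kummer_field D r n) = card (conjugates n)"
proof -
  define B where "B = (\<lambda>((z, w), (z', w')). (z' - z) / (w - w')) ` (conjugates n \<times> conjugates n)"
  have "finite B" using finite_conjugates[OF n] by (simp add: B_def)
  moreover have "inj (of_nat :: nat \<Rightarrow> complex)" by (simp add: inj_on_def)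
  then have "infinite (range (of_nat :: nat \<Rightarrow> complex))" by (rule range_inj_infinite)
  ultimately have "\<not> range (of_nat :: nat \<Rightarrow> complex) \<subseteq> B" using finite_subset by blast
  then obtain q :: nat where q: "(of_nat q :: complex) \<notin> B" by blast
  define \<theta> where "\<theta> = zeta n + of_nat q * r n"
  note alg = algebraic_zeta[OF n] algebraic_r[OF n]
  have alg_q: "algebraic (of_nat q :: complex)" by (simp add: algebraic_Rats)
  have \<sigma>\<theta>: "\<sigma> \<theta> = \<sigma> (zeta n) + of_nat q * \<sigma> (r n)" if "alg_aut \<sigma>" for \<sigma>
    using that alg alg_q by (simp add: \<theta>_def alg_aut_add alg_aut_mult algebraic_closed alg_aut_Rats)
  have inj: "inj_on (\<lambda>(z, w). z + of_nat q * w) (conjugates n)"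
  proof (rule inj_onI, clarify)
    fix z w z' w' assume *: "(z, w) \<in> conjugates n" "(z', w') \<in> conjugates n"
      "z + of_nat q * w = z' + of_nat q * w'"
    have "w = w'"
    proof (rule ccontr)
      assume "w \<noteq> w'"
      then have "of_nat q = (z' - z) / (w - w')" using *(3) by (simp add: field_simps)
      then have "of_nat q \<in> B" unfolding B_def using *(1,2) by force
      then show False using q by simp
    qed
    then show "z = z' \<and> w = w'" using *(3) by simp
  qed
  define S where "S = quadratic_field D \<union> {zeta n, r n}"
  have sqrt: "algebraic (csqrt (of_int D))"
    by (rule algebraic_root[of _ 2 "of_int D"]) (simp_all add: algebraic_Rats)
  have qf: "quadratic_field D \<subseteq> F" if "is_subfield F" "csqrt (of_int D) \<in> F" for F
    unfolding quadratic_field_def using that by (intro field_adjoin_subset) auto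
  have S: "S \<subseteq> alg_numbers"
    using qf[OF is_subfield_alg_numbers] sqrt alg by (simp add: S_def)
  have "degree_over_rats (field_adjoin S) = card {\<sigma> \<theta> |\<sigma>. alg_aut \<sigma>}"
  proof (rule degree_over_rats_eq_card_conjugates[OF S])
    have "zeta n \<in> field_adjoin S" "r n \<in> field_adjoin S" "of_nat q \<in> field_adjoin S"
      using field_adjoin_incl[of S] by (auto simp: S_def)
    then show "\<theta> \<in> field_adjoin S"
      unfolding \<theta>_def by (intro is_subfield_add is_subfield_mult is_subfield_field_adjoin)
    fix \<sigma> x assume \<sigma>: "alg_aut \<sigma>" "\<sigma> \<theta> = \<theta>" and x: "x \<in> S"
    have "(\<sigma> (zeta n), \<sigma> (r n)) \<in> conjugates n" "(zeta n, r n) \<in> conjugates n"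
      using \<sigma>(1) unfolding conjugates_def mem_Collect_eq
      by (blast, intro exI[of _ "\<lambda>x. x"]) (simp add: alg_aut_id)
    then have "(\<sigma> (zeta n), \<sigma> (r n)) = (zeta n, r n)"
      by (rule inj_onD[OF inj, rotated]) (use \<sigma>\<theta>[OF \<sigma>(1)] \<sigma>(2) in \<open>simp add: \<theta>_def\<close>)
    then have fixed: "\<sigma> (zeta n) = zeta n" "\<sigma> (r n) = r n" by simp_all
    have "\<sigma> \<gamma> = \<gamma>"
      using alg_aut_power[OF \<sigma>(1) alg(2), of n] fixed(2) r_pow[OF n] by simp
    then have "\<sigma> (csqrt (of_int D)) = csqrt (of_int D)" by (rule sqrt_fixed[OF \<sigma>(1)])
    then have "quadratic_field D \<subseteq> {x. algebraic x \<and> \<sigma> x = x}"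
      using qf[OF is_subfield_alg_aut_fixed[OF \<sigma>(1)]] sqrt by blast
    then show "\<sigma> x = x" using x fixed by (auto simp: S_def)
  qed
  also have "{\<sigma> \<theta> |\<sigma>. alg_aut \<sigma>} = (\<lambda>(z, w). z + of_nat q * w) ` conjugates n"
    using \<sigma>\<theta> by (force simp: conjugates_def)
  also have "card \<dots> = card (conjugates n)" by (rule card_image[OF inj])
  finally show ?thesis by (simp add: kummer_field_def S_def)
qed

lemma kummer_field_alg: "n > 0 \<Longrightarrow> kummer_field D r n \<subseteq> alg_numbers"
  unfolding kummer_field_def quadratic_field_def
  using algebraic_root[of "csqrt (of_int D)" 2 "of_int D"] algebraic_Rats
  by (intro field_adjoin_subset is_subfield_alg_numbers Un_least)
     (auto simp: algebraic_zeta algebraic_r)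

lemma alg_aut_maps_kummer_field:
  assumes n: "n > 0" and \<sigma>: "alg_aut \<sigma>" "\<sigma> (zeta n) = inverse (zeta n)" "\<sigma> (r n) = inverse (r n)"
    and x: "x \<in> kummer_field D r n"
  shows "\<sigma> x \<in> kummer_field D r n"
proof -
  define s where "s = csqrt (of_int D)"
  have alg: "algebraic s"
    unfolding s_def by (rule algebraic_root[of _ 2 "of_int D"]) (simp_all add: algebraic_Rats)
  have K: "is_subfield (kummer_field D r n)"
    unfolding kummer_field_def by (rule is_subfield_field_adjoin)
  have gens: "quadratic_field D \<union> {zeta n, r n} \<subseteq> kummer_field D r n"
    unfolding kummer_field_def by (rule field_adjoin_incl)
  have s: "s \<in> kummer_field D r n"
    using gens field_adjoin_incl(1)[of "{s}"] unfolding quadratic_field_def s_def by blast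
  have "(\<sigma> s) ^ 2 = s ^ 2"
    using alg_aut_power[OF \<sigma>(1) alg, of 2] alg_aut_Rats[OF \<sigma>(1), of "of_int D"] by (simp add: s_def)
  then have "\<sigma> s = s \<or> \<sigma> s = - s" by (simp add: power2_eq_iff)
  then have "\<sigma> s \<in> kummer_field D r n" using s is_subfield_uminus[OF K] by auto
  note F = is_subfield_alg_aut_vimage[OF \<sigma>(1) K]
  have "quadratic_field D \<subseteq> {x. algebraic x \<and> \<sigma> x \<in> kummer_field D r n}"
    unfolding quadratic_field_def using \<open>\<sigma> s \<in> _\<close> alg
    by (intro field_adjoin_subset[OF F]) (simp add: s_def)
  then have "kummer_field D r n \<subseteq> {x. algebraic x \<and> \<sigma> x \<in> kummer_field D r n}"
    using gens is_subfield_inverse[OF K] \<sigma> n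
    by (subst kummer_field_def, intro field_adjoin_subset[OF F]) (auto simp: algebraic_zeta algebraic_r)
  then show ?thesis using x by blast
qed

text \<open>An automorphism of the Kummer field extends to the algebraic numbers. Conversely
  \<open>\<sigma>\<close> is restricted; its inverse inverts both generators as well, hence also
  maps the field into itself, which makes the restriction bijective.\<close>

lemma inverting_automorphism_iff:
  assumes n: "n > 0"
  shows "(\<exists>\<sigma>. inverting_automorphism D r n \<sigma>) \<longleftrightarrow> (inverse (zeta n), inverse (r n)) \<in> conjugates n"
proof
  define K where "K = kummer_field D r n"
  have K: "is_subfield K" unfolding K_def kummer_field_def by (rule is_subfield_field_adjoin)
  have gens: "zeta n \<in> K" "r n \<in> K"
    using field_adjoin_incl(1)[of "quadratic_field D \<union> {zeta n, r n}"]
    unfolding K_def kummer_field_def by simp_all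
  have Kalg: "algebraic x" if "x \<in> K" for x
    using kummer_field_alg[OF n] that by (auto simp: K_def)
  {
    assume "\<exists>\<sigma>. inverting_automorphism D r n \<sigma>"
    then obtain \<tau> where \<tau>: "\<tau> \<in> Ring.ring_hom (complex_ring\<lparr>carrier := K\<rparr>) (complex_ring\<lparr>carrier := K\<rparr>)"
      "\<tau> \<in> Bij K" "\<tau> (zeta n) = inverse (zeta n)" "\<tau> (r n) = inverse (r n)"
      unfolding inverting_automorphism_def galois_group_def K_def by blast
    have add: "\<tau> (x + y) = \<tau> x + \<tau> y" and mult: "\<tau> (x * y) = \<tau> x * \<tau> y" if "x \<in> K" "y \<in> K" for x y
      using ring_hom_add[OF \<tau>(1)] ring_hom_mult[OF \<tau>(1)] that by auto
    have one: "\<tau> 1 = 1" using ring_hom_one[OF \<tau>(1)] by simp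
    have diff: "\<tau> (x - y) = \<tau> x - \<tau> y" if "x \<in> K" "y \<in> K" for x y
      using add[of "x - y" y] that is_subfield_diff[OF K] by (simp add: algebra_simps)
    have inj: "inj_on \<tau> K" using \<tau>(2) by (auto simp: Bij_def bij_betw_def)
    have zero: "\<tau> 0 = 0" using diff[of 1 1] is_subfield_1[OF K] by simp
    have "ring_graph {(x, \<tau> x) |x. x \<in> K}"
    proof (rule ring_graphI)
      show "x = 0 \<longleftrightarrow> x' = 0" if "(x, x') \<in> {(x, \<tau> x) |x. x \<in> K}" for x x'
        using that zero inj_onD[OF inj, of x 0] is_subfield_0[OF K] by auto
    qed (use is_subfieldD[OF K] one diff mult in auto)
    then obtain \<sigma> where "alg_aut \<sigma>"
      "\<And>x y. (x, y) \<in> {(x, \<tau> x) |x. x \<in> K} \<Longrightarrow> algebraic x \<Longrightarrow> \<sigma> x = y"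
      by (rule alg_aut_extend) blast
    then have "alg_aut \<sigma>" "\<sigma> (zeta n) = inverse (zeta n)" "\<sigma> (r n) = inverse (r n)"
      using gens \<tau>(3,4) Kalg by auto
    then show "(inverse (zeta n), inverse (r n)) \<in> conjugates n"
      unfolding conjugates_def mem_Collect_eq by (intro exI[of _ \<sigma>]) simp
  next
    assume "(inverse (zeta n), inverse (r n)) \<in> conjugates n"
    then obtain \<sigma> where \<sigma>: "alg_aut \<sigma>" "\<sigma> (zeta n) = inverse (zeta n)" "\<sigma> (r n) = inverse (r n)"
      unfolding conjugates_def by force
    obtain \<rho> where \<rho>: "alg_aut \<rho>" "\<And>x. algebraic x \<Longrightarrow> \<rho> (\<sigma> x) = x"
      "\<And>x. algebraic x \<Longrightarrow> \<sigma> (\<rho> x) = x"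
      by (rule alg_aut_inv_exists[OF \<sigma>(1)]) blast
    have "\<rho> (zeta n) = inverse (zeta n)" "\<rho> (r n) = inverse (r n)"
      using \<rho>(2)[of "inverse (zeta n)"] \<rho>(2)[of "inverse (r n)"] \<sigma> algebraic_zeta[OF n] algebraic_r[OF n]
      by (simp_all add: algebraic_closed alg_aut_inverse)
    note \<rho>K = alg_aut_maps_kummer_field[OF n \<rho>(1) this, folded K_def]
    note \<sigma>K = alg_aut_maps_kummer_field[OF n \<sigma>, folded K_def]
    define \<tau> where "\<tau> = restrict \<sigma> K"
    have "bij_betw \<sigma> K K"
      by (rule bij_betw_byWitness[where f' = \<rho>]) (use \<rho>(2,3) \<sigma>K \<rho>K Kalg in auto)
    then have "\<tau> \<in> Bij K"
      by (auto simp: \<tau>_def Bij_def cong: bij_betw_cong)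
    moreover have "\<tau> \<in> Ring.ring_hom (complex_ring\<lparr>carrier := K\<rparr>) (complex_ring\<lparr>carrier := K\<rparr>)"
      using \<sigma>K is_subfieldD[OF K] Kalg \<sigma>(1)
      by (auto simp: Ring.ring_hom_def \<tau>_def alg_aut_add alg_aut_mult alg_aut_1)
    moreover have "\<forall>x\<in>\<rat>. \<tau> x = x"
      using alg_aut_Rats[OF \<sigma>(1)] field_adjoin_incl(2) unfolding \<tau>_def K_def kummer_field_def by auto
    ultimately show "\<exists>\<sigma>. inverting_automorphism D r n \<sigma>"
      using \<sigma>(2,3) gens unfolding inverting_automorphism_def galois_group_def
      by (intro exI[of _ \<tau>]) (simp add: \<tau>_def K_def)
  }
qed

text \<open>The two listed elements of \<open>C_set\<close> differ: if \<open>r n\<close> were its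
  own inverse, so would be its power \<gamma>, which is not a root of unity.\<close>

lemma card_C_set:
  assumes n: "n > 0"
  shows "card (C_set D r n) = (if (inverse (zeta n), inverse (r n)) \<in> conjugates n then 2 else 1)"
proof (cases "\<exists>\<sigma>. inverting_automorphism D r n \<sigma>")
  case True
  define \<sigma> where "\<sigma> = (SOME \<sigma>. inverting_automorphism D r n \<sigma>)"
  have "inverting_automorphism D r n \<sigma>" unfolding \<sigma>_def by (rule someI_ex[OF True])
  then have \<sigma>: "\<sigma> (r n) = inverse (r n)" by (simp add: inverting_automorphism_def)
  have "r n \<noteq> inverse (r n)"
  proof
    assume "r n = inverse (r n)"
    then have "r n ^ n = inverse (r n ^ n)" by (metis power_inverse)
    then show False using r_pow[OF n] \<gamma>_neq_inverse by simp
  qed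
  moreover have "r n \<in> kummer_field D r n"
    using field_adjoin_incl(1)[of "quadratic_field D \<union> {zeta n, r n}"]
    unfolding kummer_field_def by simp
  ultimately have "(\<lambda>x\<in>kummer_field D r n. x) \<noteq> \<sigma>" using \<sigma> by force
  then show ?thesis
    using True inverting_automorphism_iff[OF n] by (simp add: C_set_def \<sigma>_def)
next
  case False
  then show ?thesis using inverting_automorphism_iff[OF n] by (simp add: C_set_def)
qed

end

section \<open>Orbits under groups of automorphisms\<close>

definition fixing :: "complex set \<Rightarrow> (complex \<Rightarrow> complex) \<Rightarrow> bool"
  where "fixing C \<sigma> \<longleftrightarrow> alg_aut \<sigma> \<and> (\<forall>c\<in>C. \<sigma> c = c)"

lemma fixing_empty [simp]: "fixing {} \<sigma> \<longleftrightarrow> alg_aut \<sigma>"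
  by (simp add: fixing_def)

lemma fixing_alg_aut: "fixing C \<sigma> \<Longrightarrow> alg_aut \<sigma>"
  by (simp add: fixing_def)

lemma fixing_id: "fixing C (\<lambda>x. x)"
  by (simp add: fixing_def alg_aut_id)

lemma fixing_comp: "fixing C \<sigma> \<Longrightarrow> fixing C \<tau> \<Longrightarrow> fixing C (\<sigma> \<circ> \<tau>)"
  by (simp add: fixing_def alg_aut_comp)

lemma fixing_inv_exists:
  assumes "fixing C \<sigma>" "C \<subseteq> alg_numbers"
  obtains \<rho> where "fixing C \<rho>" "\<And>x. algebraic x \<Longrightarrow> \<rho> (\<sigma> x) = x"
    "\<And>x. algebraic x \<Longrightarrow> \<sigma> (\<rho> x) = x"
proof -
  have \<sigma>: "alg_aut \<sigma>" using assms(1) by (rule fixing_alg_aut)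
  obtain \<rho> where \<rho>: "alg_aut \<rho>" "\<And>x. algebraic x \<Longrightarrow> \<rho> (\<sigma> x) = x"
      "\<And>x. algebraic x \<Longrightarrow> \<sigma> (\<rho> x) = x"
    by (rule alg_aut_inv_exists[OF \<sigma>]) blast
  have "\<rho> c = c" if "c \<in> C" for c
  proof -
    have "\<sigma> c = c" "algebraic c" using that assms by (auto simp: fixing_def)
    then show ?thesis using \<rho>(2)[of c] by simp
  qed
  then have "fixing C \<rho>" using \<rho>(1) by (simp add: fixing_def)
  then show ?thesis using that \<rho>(2,3) by blast
qed

lemma finite_orbit:
  assumes "algebraic x"
  shows "finite {\<sigma> x |\<sigma>. alg_aut \<sigma>}"
proof -
  obtain p where p: "\<forall>i. coeff p i \<in> \<rat>" "p \<noteq> 0" "poly p x = 0"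
    using assms unfolding algebraic_altdef by blast
  have "{\<sigma> x |\<sigma>. alg_aut \<sigma>} \<subseteq> {y. poly p y = 0}"
  proof
    fix y assume "y \<in> {\<sigma> x |\<sigma>. alg_aut \<sigma>}"
    then obtain \<sigma> where \<sigma>: "alg_aut \<sigma>" "y = \<sigma> x" by blast
    then show "y \<in> {y. poly p y = 0}"
      using alg_aut_poly(2)[OF \<sigma>(1) p(1) assms] p(3) by (simp add: alg_aut_0)
  qed
  then show ?thesis using poly_roots_finite[OF p(2)] finite_subset by blast
qed

text \<open>Its cardinality plays the role of the degree of \<rat>(C, as) over \<rat>(C). Tuples are
  lists, so that further generators are adjoined by appending.\<close>

definition orbit :: "complex set \<Rightarrow> complex list \<Rightarrow> complex list set"
  where "orbit C as = {map \<sigma> as |\<sigma>. fixing C \<sigma>}"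

lemma orbitI: "fixing C \<sigma> \<Longrightarrow> map \<sigma> as \<in> orbit C as"
  by (auto simp: orbit_def)

lemma orbitE:
  assumes "xs \<in> orbit C as"
  obtains \<sigma> where "fixing C \<sigma>" "xs = map \<sigma> as"
  using assms by (auto simp: orbit_def)

lemma finite_orbit_list:
  assumes "set as \<subseteq> alg_numbers"
  shows "finite (orbit C as)"
proof (rule finite_subset)
  define B where "B = (\<Union>x\<in>set as. {\<sigma> x |\<sigma>. alg_aut \<sigma>})"
  show "orbit C as \<subseteq> {xs. set xs \<subseteq> B \<and> length xs = length as}"
  proof
    fix xs assume "xs \<in> orbit C as"
    then obtain \<sigma> where \<sigma>: "fixing C \<sigma>" "xs = map \<sigma> as" by (rule orbitE)
    then have "\<sigma> x \<in> B" if "x \<in> set as" for x using that by (auto simp: B_def fixing_def)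
    then show "xs \<in> {xs. set xs \<subseteq> B \<and> length xs = length as}" using \<sigma>(2) by auto
  qed
  have "finite B" using assms unfolding B_def by (intro finite_UN_I finite_orbit) auto
  then show "finite {xs. set xs \<subseteq> B \<and> length xs = length as}"
    by (rule finite_lists_length_eq)
qed

text \<open>Automorphisms agreeing with \<open>\<tau>\<close> on \<open>as\<close> form the coset of
  \<open>\<tau>\<close> modulo the stabiliser of \<open>as\<close>.\<close>

lemma orbit_fiber:
  assumes C: "C \<subseteq> alg_numbers" and b: "set bs \<subseteq> alg_numbers" and a: "set as \<subseteq> alg_numbers"
    and \<tau>: "fixing C \<tau>"
  shows "{map \<sigma> bs |\<sigma>. fixing C \<sigma> \<and> map \<sigma> as = map \<tau> as} = map \<tau> ` orbit (C \<union> set as) bs"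
proof (intro equalityI subsetI)
  obtain \<rho> where \<rho>: "fixing C \<rho>" "\<And>x. algebraic x \<Longrightarrow> \<rho> (\<tau> x) = x"
      "\<And>x. algebraic x \<Longrightarrow> \<tau> (\<rho> x) = x"
    by (rule fixing_inv_exists[OF \<tau> C]) blast
  fix w assume "w \<in> {map \<sigma> bs |\<sigma>. fixing C \<sigma> \<and> map \<sigma> as = map \<tau> as}"
  then obtain \<sigma> where \<sigma>: "fixing C \<sigma>" "map \<sigma> as = map \<tau> as" "w = map \<sigma> bs" by blast
  have "fixing (C \<union> set as) (\<rho> \<circ> \<sigma>)"
    using fixing_comp[OF \<rho>(1) \<sigma>(1)] \<sigma>(2) \<rho>(2) a by (auto simp: fixing_def)
  then have "map (\<rho> \<circ> \<sigma>) bs \<in> orbit (C \<union> set as) bs" by (rule orbitI)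
  moreover have "w = map \<tau> (map (\<rho> \<circ> \<sigma>) bs)"
    using \<sigma>(3) \<rho>(3) b alg_aut_closed[OF fixing_alg_aut[OF \<sigma>(1)]] by auto
  ultimately show "w \<in> map \<tau> ` orbit (C \<union> set as) bs" by blast
next
  fix w assume "w \<in> map \<tau> ` orbit (C \<union> set as) bs"
  then obtain \<sigma> where \<sigma>: "fixing (C \<union> set as) \<sigma>" "w = map \<tau> (map \<sigma> bs)"
    by (auto elim: orbitE)
  then have "fixing C (\<tau> \<circ> \<sigma>)" "map (\<tau> \<circ> \<sigma>) as = map \<tau> as" "w = map (\<tau> \<circ> \<sigma>) bs"
    using fixing_comp[OF \<tau>, of \<sigma>] by (auto simp: fixing_def)
  then show "w \<in> {map \<sigma> bs |\<sigma>. fixing C \<sigma> \<and> map \<sigma> as = map \<tau> as}" by blast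
qed

lemma inj_on_map_orbit:
  assumes "alg_aut \<tau>" "set bs \<subseteq> alg_numbers"
  shows "inj_on (map \<tau>) (orbit C bs)"
proof (rule inj_on_mapI[OF inj_on_subset])
  show "inj_on \<tau> alg_numbers" using alg_aut_bij[OF assms(1)] by (simp add: bij_betw_def)
  show "\<Union> (set ` orbit C bs) \<subseteq> alg_numbers"
  proof
    fix x assume "x \<in> \<Union> (set ` orbit C bs)"
    then obtain xs where "xs \<in> orbit C bs" "x \<in> set xs" by blast
    moreover from this(1) obtain \<sigma> where "fixing C \<sigma>" "xs = map \<sigma> bs" by (rule orbitE)
    ultimately obtain y where "fixing C \<sigma>" "y \<in> set bs" "x = \<sigma> y" by auto
    then show "x \<in> alg_numbers"
      using assms(2) alg_aut_closed[OF fixing_alg_aut, of C \<sigma> y] by auto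
  qed
qed

text \<open>The tower law. Projecting to the first part has fibres of constant size, because
  \<open>\<tau>\<close> maps the orbit over \<open>C \<union> set as\<close> injectively onto the
  fibre above \<open>map \<tau> as\<close>.\<close>

lemma card_orbit_append:
  assumes C: "C \<subseteq> alg_numbers" and a: "set as \<subseteq> alg_numbers" and b: "set bs \<subseteq> alg_numbers"
  shows "card (orbit C (as @ bs)) = card (orbit C as) * card (orbit (C \<union> set as) bs)"
proof -
  define B where "B xs = {map \<sigma> bs |\<sigma>. fixing C \<sigma> \<and> map \<sigma> as = xs}" for xs
  have B: "card (B xs) = card (orbit (C \<union> set as) bs)" if xs: "xs \<in> orbit C as" for xs
  proof -
    obtain \<tau> where \<tau>: "fixing C \<tau>" "xs = map \<tau> as" using xs by (rule orbitE)
    show ?thesis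
      unfolding B_def \<tau>(2) orbit_fiber[OF C b a \<tau>(1)]
      by (rule card_image[OF inj_on_map_orbit[OF fixing_alg_aut[OF \<tau>(1)] b]])
  qed
  have eq: "orbit C (as @ bs) = (\<lambda>(xs, ys). xs @ ys) ` Sigma (orbit C as) B"
  proof (intro equalityI subsetI)
    fix zs assume "zs \<in> orbit C (as @ bs)"
    then obtain \<sigma> where \<sigma>: "fixing C \<sigma>" "zs = map \<sigma> as @ map \<sigma> bs" by (auto elim: orbitE)
    then have "(map \<sigma> as, map \<sigma> bs) \<in> Sigma (orbit C as) B" by (auto simp: B_def intro: orbitI)
    then show "zs \<in> (\<lambda>(xs, ys). xs @ ys) ` Sigma (orbit C as) B" using \<sigma>(2) by force
  next
    fix zs assume "zs \<in> (\<lambda>(xs, ys). xs @ ys) ` Sigma (orbit C as) B"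
    then obtain \<sigma> where "fixing C \<sigma>" "zs = map \<sigma> (as @ bs)" by (auto simp: B_def)
    then show "zs \<in> orbit C (as @ bs)" by (simp only: orbitI)
  qed
  have "inj_on (\<lambda>(xs, ys). xs @ ys) (Sigma (orbit C as) B)"
    by (rule inj_onI) (auto elim!: orbitE)
  then have "card (orbit C (as @ bs)) = card (Sigma (orbit C as) B)"
    unfolding eq by (rule card_image)
  also have "\<dots> = (\<Sum>xs\<in>orbit C as. card (B xs))"
  proof (rule card_SigmaI)
    show "finite (orbit C as)" by (rule finite_orbit_list[OF a])
    show "\<forall>xs\<in>orbit C as. finite (B xs)"
      using finite_orbit_list[OF b, of C] by (auto simp: B_def orbit_def elim!: rev_finite_subset)
  qed
  also have "\<dots> = (\<Sum>xs\<in>orbit C as. card (orbit (C \<union> set as) bs))" by (rule sum.cong) (simp_all add: B)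
  finally show ?thesis by simp
qed

text \<open>If \<open>as\<close> is determined by \<open>C\<close> and \<open>bs\<close>, appending
  it to \<open>bs\<close> does not change the orbit size. Applied in both directions, this compares
  lists that generate the same field.\<close>

lemma card_orbit_le:
  assumes C: "C \<subseteq> alg_numbers" and a: "set as \<subseteq> alg_numbers" and b: "set bs \<subseteq> alg_numbers"
    and fixed: "\<And>\<sigma> x. fixing (C \<union> set bs) \<sigma> \<Longrightarrow> x \<in> set as \<Longrightarrow> \<sigma> x = x"
  shows "card (orbit C as) \<le> card (orbit C bs)"
proof -
  have one: "orbit (C \<union> set bs) as = {as}"
  proof (intro equalityI subsetI)
    fix xs assume "xs \<in> orbit (C \<union> set bs) as"
    then obtain \<sigma> where "fixing (C \<union> set bs) \<sigma>" "xs = map \<sigma> as" by (rule orbitE)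
    moreover have "map \<sigma> as = as"
      by (rule map_idI) (rule fixed[OF \<open>fixing (C \<union> set bs) \<sigma>\<close>])
    ultimately show "xs \<in> {as}" by simp
  next
    fix xs assume "xs \<in> {as}"
    then show "xs \<in> orbit (C \<union> set bs) as" using orbitI[OF fixing_id[of "C \<union> set bs"], of as] by simp
  qed
  have "orbit C as \<subseteq> drop (length bs) ` orbit C (bs @ as)"
  proof
    fix xs assume "xs \<in> orbit C as"
    then obtain \<sigma> where \<sigma>: "fixing C \<sigma>" "xs = map \<sigma> as" by (rule orbitE)
    have "xs = drop (length bs) (map \<sigma> (bs @ as))" using \<sigma>(2) by simp
    then show "xs \<in> drop (length bs) ` orbit C (bs @ as)" using orbitI[OF \<sigma>(1)] by blast
  qed
  then have "card (orbit C as) \<le> card (drop (length bs) ` orbit C (bs @ as))"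
    using a b by (intro card_mono finite_imageI finite_orbit_list) auto
  also have "\<dots> \<le> card (orbit C (bs @ as))"
    using a b by (intro card_image_le finite_orbit_list) auto
  also have "\<dots> = card (orbit C bs)"
    unfolding card_orbit_append[OF C b a] one by simp
  finally show ?thesis .
qed

lemma card_orbit_singleton: "card (orbit C [a]) = card {\<sigma> a |\<sigma>. fixing C \<sigma>}"
proof -
  have "orbit C [a] = (\<lambda>x. [x]) ` {\<sigma> a |\<sigma>. fixing C \<sigma>}" by (auto simp: orbit_def)
  then show ?thesis by (simp add: card_image inj_on_def)
qed

section \<open>Conjugates of roots of unity\<close>

lemma zeta_power_eq_iff:
  assumes "n > 0"
  shows "zeta n ^ j = zeta n ^ k \<longleftrightarrow> j mod n = k mod n"
proof -
  have "zeta n ^ j = exp (2 * of_real pi * \<i> * of_nat j / of_nat n)" for j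
    by (simp add: zeta_def field_simps flip: exp_of_nat_mult)
  then show ?thesis using complex_root_unity_eq[of n j k] assms by simp
qed

lemma zeta_power_eq_1_iff: "n > 0 \<Longrightarrow> zeta n ^ j = 1 \<longleftrightarrow> n dvd j"
  using zeta_power_eq_iff[of n j 0] by (simp add: mod_eq_0_iff_dvd)

text \<open>Irreducibility yields all coprime exponents. No others occur: with
  \<open>d = gcd k n\<close>, the power \<open>zeta n ^ (n div d)\<close> is sent to 1, and
  injectivity forces \<open>d = 1\<close>.\<close>

lemma orbit_zeta:
  assumes n: "n > 0"
  shows "{\<sigma> (zeta n) |\<sigma>. alg_aut \<sigma>} = (\<lambda>k. zeta n ^ k) ` totatives n"
proof (intro equalityI subsetI)
  fix z assume "z \<in> (\<lambda>k. zeta n ^ k) ` totatives n"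
  then obtain k where k: "k \<in> totatives n" "z = zeta n ^ k" by blast
  obtain \<sigma> where "alg_aut \<sigma>" "\<sigma> (zeta n) = zeta n ^ k"
    by (rule alg_aut_root_of_unity_power[OF zeta_pow[OF n] n, of k]) (use k in \<open>auto simp: totatives_def\<close>)
  then show "z \<in> {\<sigma> (zeta n) |\<sigma>. alg_aut \<sigma>}"
    unfolding mem_Collect_eq k(2) by (intro exI[of _ \<sigma>]) simp
next
  fix z assume "z \<in> {\<sigma> (zeta n) |\<sigma>. alg_aut \<sigma>}"
  then obtain \<sigma> where \<sigma>: "alg_aut \<sigma>" "z = \<sigma> (zeta n)" by blast
  have "z ^ n = 1"
    using alg_aut_power[OF \<sigma>(1) algebraic_zeta[OF n], of n] \<sigma> zeta_pow[OF n] by (simp add: alg_aut_1)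
  then obtain j where j: "j < n" "z = zeta n ^ j" using roots_of_unity_eq_zeta_powers n by blast
  \<comment> \<open>Elements of \<open>totatives n\<close> lie between 1 and \<open>n\<close>, so
    the exponent 0 is replaced by \<open>n\<close>; this matters for \<open>n = 1\<close>.\<close>
  define k where "k = (if j = 0 then n else j)"
  have k: "0 < k" "k \<le> n" "z = zeta n ^ k" using j n zeta_pow[OF n] by (auto simp: k_def)
  define d where "d = gcd k n"
  have d: "d dvd k" "d dvd n" "d > 0" using n by (simp_all add: d_def)
  have "\<sigma> (zeta n ^ (n div d)) = zeta n ^ (k * (n div d))"
    using alg_aut_power[OF \<sigma>(1) algebraic_zeta[OF n]] \<sigma>(2) k(3) by (simp add: power_mult)
  also have "\<dots> = 1"
  proof -
    have "k * (n div d) = n * (k div d)" using d by (metis div_mult_swap mult.commute)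
    then show ?thesis using zeta_power_eq_1_iff[OF n] by simp
  qed
  finally have "\<sigma> (zeta n ^ (n div d)) = \<sigma> 1" using alg_aut_1[OF \<sigma>(1)] by simp
  then have "zeta n ^ (n div d) = 1"
    using alg_aut_inj[OF \<sigma>(1)] algebraic_zeta[OF n] by (simp add: algebraic_closed)
  then have "n dvd n div d" using zeta_power_eq_1_iff[OF n] by simp
  then have "n \<le> n div d" using n d by (intro dvd_imp_le) (auto simp: dvd_div_eq_0_iff)
  then have "d = 1" using n d(3) div_less_dividend[of d n] by linarith
  then show "z \<in> (\<lambda>k. zeta n ^ k) ` totatives n"
    using k by (auto simp: totatives_def d_def coprime_iff_gcd_eq_1)
qed

lemma card_orbit_zeta:
  assumes n: "n > 0"
  shows "card {\<sigma> (zeta n) |\<sigma>. alg_aut \<sigma>} = totient n"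
proof -
  have "inj_on (\<lambda>k. zeta n ^ k) (totatives n)"
  proof (rule inj_onI)
    fix j k assume *: "j \<in> totatives n" "k \<in> totatives n" "zeta n ^ j = zeta n ^ k"
    then have "j mod n = k mod n" using zeta_power_eq_iff[OF n] by blast
    moreover have "0 < j" "j \<le> n" "0 < k" "k \<le> n" using * by (auto simp: totatives_def)
    ultimately show "j = k"
      by (metis mod_less mod_self le_neq_implies_less less_numeral_extra(3))
  qed
  then show ?thesis unfolding orbit_zeta[OF n] by (simp add: card_image totient_def)
qed

lemma card_orbit_zeta_list:
  assumes "n > 0"
  shows "card (orbit {} [zeta n]) = totient n"
  using card_orbit_zeta[OF assms] by (simp add: card_orbit_singleton)

lemma card_orbit_zeta_fixing:
  assumes "n > 0" "m dvd n"
  shows "totient n = totient m * card (orbit {zeta m} [zeta n])"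
proof -
  have m: "m > 0" using assms by (auto intro: Nat.gr0I)
  have eq: "zeta n ^ (n div m) = zeta m" using zeta_power_dvd assms by blast
  note alg = algebraic_zeta[OF assms(1)] algebraic_zeta[OF m]
  have "\<sigma> (zeta m) = zeta m" if "alg_aut \<sigma>" "\<sigma> (zeta n) = zeta n" for \<sigma>
    using alg_aut_power[OF that(1) alg(1), of "n div m"] eq that(2) by simp
  then have "card (orbit {} ([zeta m] @ [zeta n])) \<le> card (orbit {} [zeta n])"
    using alg by (intro card_orbit_le) (auto simp: fixing_def)
  moreover have "card (orbit {} [zeta n]) \<le> card (orbit {} ([zeta m] @ [zeta n]))"
    using alg by (intro card_orbit_le) (auto simp: fixing_def)
  moreover have "card (orbit {} ([zeta m] @ [zeta n])) = card (orbit {} [zeta m]) * card (orbit {zeta m} [zeta n])"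
    using alg by (subst card_orbit_append) auto
  ultimately show ?thesis using card_orbit_zeta_list assms(1) m by simp
qed

text \<open>By Bezout, \<open>u\<close> is a quotient of a power of \<open>u ^ a\<close> and a power
  of \<open>u ^ b\<close>.\<close>

lemma alg_aut_fixed_by_coprime_powers:
  assumes \<sigma>: "alg_aut \<sigma>" "algebraic u" "u \<noteq> 0"
    and "\<sigma> (u ^ a) = u ^ a" "\<sigma> (u ^ b) = u ^ b" "coprime a b" "a > 0"
  shows "\<sigma> u = u"
proof -
  obtain x y where xy: "a * x = b * y + 1" using bezout_nat[of a b] assms by auto
  have "(u ^ a) ^ x = (u ^ b) ^ y * u" by (simp add: xy flip: power_mult)
  then have "\<sigma> ((u ^ a) ^ x) = \<sigma> ((u ^ b) ^ y * u)" by simp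
  then have "(u ^ a) ^ x = (u ^ b) ^ y * \<sigma> u"
    using assms by (simp add: alg_aut_power alg_aut_mult algebraic_closed)
  then have "(u ^ b) ^ y * u = (u ^ b) ^ y * \<sigma> u" by (simp add: \<open>(u ^ a) ^ x = (u ^ b) ^ y * u\<close>)
  then show ?thesis using assms(3) by simp
qed

section \<open>Stabilisation of relative degrees\<close>

context kummer
begin

abbreviation gens :: "nat \<Rightarrow> complex list"
  where "gens n \<equiv> [zeta n, r n]"

lemma gens_algebraic: "n > 0 \<Longrightarrow> set (gens n) \<subseteq> alg_numbers"
  by (simp add: algebraic_zeta algebraic_r)

lemma card_conjugates_eq_orbit: "card (conjugates n) = card (orbit {} (gens n))"
proof -
  have "orbit {} (gens n) = (\<lambda>(z, w). [z, w]) ` conjugates n"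
    by (auto simp: orbit_def conjugates_def)
  moreover have "inj_on (\<lambda>(z, w). [z, w]) (conjugates n)" by (auto simp: inj_on_def)
  ultimately show ?thesis by (simp add: card_image)
qed

lemma r_dvd:
  assumes "n > 0" "m dvd n"
  obtains j where "r m = r n ^ (n div m) * zeta n ^ j"
proof -
  have m: "m > 0" using assms by (auto intro: Nat.gr0I)
  have nm: "n div m * m = n" using assms by simp
  have "(r m / r n ^ (n div m)) ^ m = 1"
    using r_pow[OF m] r_pow[OF assms(1)] \<gamma>_nonzero nm by (simp add: power_divide flip: power_mult)
  then obtain k where k: "r m / r n ^ (n div m) = zeta m ^ k"
    using roots_of_unity_eq_zeta_powers[OF _ m] by blast
  have z: "zeta m = zeta n ^ (n div m)" using zeta_power_dvd[of m n] assms by simp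
  have "r m = r n ^ (n div m) * zeta m ^ k"
    using k r_nonzero[OF assms(1)] by (simp add: field_simps)
  then have "r m = r n ^ (n div m) * zeta n ^ (n div m * k)"
    unfolding z power_mult .
  then show ?thesis by (rule that)
qed

lemma gens_fixed_dvd:
  assumes "n > 0" "m dvd n" "fixing (set (gens n)) \<sigma>" "x \<in> set (gens m)"
  shows "\<sigma> x = x"
proof -
  have \<sigma>: "alg_aut \<sigma>" "\<sigma> (zeta n) = zeta n" "\<sigma> (r n) = r n" using assms(3) by (simp_all add: fixing_def)
  obtain j where j: "r m = r n ^ (n div m) * zeta n ^ j" using r_dvd[OF assms(1,2)] by blast
  have z: "zeta m = zeta n ^ (n div m)" using zeta_power_dvd[of m n] assms by simp
  show ?thesis
    using assms(4) \<sigma> algebraic_zeta[OF assms(1)] algebraic_r[OF assms(1)]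
    by (auto simp: z j alg_aut_power alg_aut_mult algebraic_closed)
qed

section \<open>Relative degrees and their upper bound\<close>

definition rel_degree :: "nat \<Rightarrow> nat \<Rightarrow> nat"
  where "rel_degree n m = card (orbit (set (gens m)) (gens n))"

text \<open>The degree of \<rat>(zeta_n) over \<rat>(zeta_m), times the largest possible degree n/m
  of a radical extension. By the lemma \<open>max_degree\<close> it is \<open>n * totient n\<close>
  divided by \<open>m * totient m\<close>.\<close>

definition max_degree :: "nat \<Rightarrow> nat \<Rightarrow> nat"
  where "max_degree n m = card (orbit {zeta m} [zeta n]) * (n div m)"

lemma card_conjugates_dvd:
  assumes "n > 0" "m dvd n"
  shows "card (conjugates n) = card (conjugates m) * rel_degree n m"
proof -
  have m: "m > 0" using assms by (auto intro: Nat.gr0I)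
  note alg = gens_algebraic[OF assms(1)] gens_algebraic[OF m]
  have "card (orbit {} (gens m @ gens n)) \<le> card (orbit {} (gens n))"
  proof (rule card_orbit_le)
    fix \<sigma> x assume *: "fixing ({} \<union> set (gens n)) \<sigma>" "x \<in> set (gens m @ gens n)"
    then have f: "fixing (set (gens n)) \<sigma>" by simp
    show "\<sigma> x = x"
    proof (cases "x \<in> set (gens m)")
      case True
      then show ?thesis by (rule gens_fixed_dvd[OF assms f])
    next
      case False
      then have "x \<in> set (gens n)" using *(2) by (metis Un_iff set_append)
      then show ?thesis using f by (simp only: fixing_def)
    qed
  qed (use alg in auto)
  moreover have "card (orbit {} (gens n)) \<le> card (orbit {} (gens m @ gens n))"
    using alg by (intro card_orbit_le) (auto simp: fixing_def)
  moreover have "card (orbit {} (gens m @ gens n)) = card (orbit {} (gens m)) * card (orbit ({} \<union> set (gens m)) (gens n))"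
    using alg by (intro card_orbit_append) simp_all
  ultimately show ?thesis by (simp add: card_conjugates_eq_orbit rel_degree_def)
qed

text \<open>
  The values at \<open>\<zeta>\<^sub>n\<close> and \<open>\<gamma>\<^bsup>1/n\<^esup>\<close> allowed to an automorphism fixing the generators of \<open>K\<^sub>m\<close>.
  The roots \<open>r m\<close> and \<open>r n\<close> are chosen independently, so they are related only up to some
  \<open>\<zeta>\<^sub>n\<^bsup>j\<^esup>\<close>.
\<close>

definition compatible :: "nat \<Rightarrow> nat \<Rightarrow> nat \<Rightarrow> complex list set"
  where "compatible n m j = (\<lambda>(z, w). [z, w]) `
    Sigma {\<sigma> (zeta n) |\<sigma>. fixing {zeta m} \<sigma>} (\<lambda>z. {w. w ^ (n div m) = r m * inverse z ^ j})"

text \<open>Applying an automorphism to the relation \<open>j\<close> between \<open>r m\<close> and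
  \<open>r n\<close> fixes the \<open>(n div m)\<close>-th power of the image of \<open>r n\<close>
  once the image of \<open>zeta n\<close> is known; this leaves \<open>n div m\<close> choices for
  each image of \<open>zeta n\<close>.\<close>

lemma compatible:
  assumes n: "n > 0" and m: "m dvd n" and j: "r m = r n ^ (n div m) * zeta n ^ j"
  shows "orbit (set (gens m)) (gens n) \<subseteq> compatible n m j"
    and "finite (compatible n m j)" and "card (compatible n m j) = max_degree n m"
proof -
  have m0: "m > 0" and nm: "n div m > 0" using m n by (auto intro: Nat.gr0I simp: dvd_div_eq_0_iff)
  note alg = algebraic_zeta[OF n] algebraic_r[OF n]
  show "orbit (set (gens m)) (gens n) \<subseteq> compatible n m j"
  proof
    fix xs assume "xs \<in> orbit (set (gens m)) (gens n)"
    then obtain \<sigma> where \<sigma>: "fixing (set (gens m)) \<sigma>" "xs = map \<sigma> (gens n)" by (rule orbitE)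
    then have s: "alg_aut \<sigma>" "fixing {zeta m} \<sigma>" "\<sigma> (r m) = r m" by (simp_all add: fixing_def)
    have "\<sigma> (r n ^ (n div m) * zeta n ^ j) = r m" using s(3) unfolding j[symmetric] .
    then have "\<sigma> (r n) ^ (n div m) * \<sigma> (zeta n) ^ j = r m"
      using s(1) alg by (simp add: alg_aut_power alg_aut_mult algebraic_closed)
    moreover have "\<sigma> (zeta n) \<noteq> 0" using alg_aut_eq_0_iff[OF s(1) alg(1)] by simp
    ultimately have "\<sigma> (r n) ^ (n div m) = r m * inverse (\<sigma> (zeta n)) ^ j"
      by (auto simp: field_simps)
    then show "xs \<in> compatible n m j" using \<sigma>(2) s(2) by (auto simp: compatible_def image_iff)
  qed
  define Z where "Z = {\<sigma> (zeta n) |\<sigma>. fixing {zeta m} \<sigma>}"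
  have "Z \<subseteq> {\<sigma> (zeta n) |\<sigma>. alg_aut \<sigma>}" by (auto simp: Z_def fixing_def)
  then have fZ: "finite Z" using finite_orbit[OF alg(1)] by (rule finite_subset)
  have nz: "r m * inverse z ^ j \<noteq> 0" if "z \<in> Z" for z
    using that r_nonzero[OF m0] alg_aut_eq_0_iff[OF fixing_alg_aut alg(1)] by (auto simp: Z_def)
  have fw: "finite {w. w ^ (n div m) = r m * inverse z ^ j}" for z
    by (rule finite_nth_roots[OF nm])
  show "finite (compatible n m j)"
    unfolding compatible_def Z_def[symmetric] using fZ fw by (intro finite_imageI finite_SigmaI) auto
  have "card (compatible n m j) = card (Sigma Z (\<lambda>z. {w. w ^ (n div m) = r m * inverse z ^ j}))"
    unfolding compatible_def Z_def[symmetric] by (rule card_image) (auto simp: inj_on_def)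
  also have "\<dots> = (\<Sum>z\<in>Z. card {w. w ^ (n div m) = r m * inverse z ^ j})"
    using fZ fw by (intro card_SigmaI) auto
  also have "\<dots> = (\<Sum>z\<in>Z. n div m)"
    by (rule sum.cong) (use nz card_nth_roots[OF _ nm] in auto)
  finally show "card (compatible n m j) = max_degree n m"
    by (simp add: max_degree_def card_orbit_singleton Z_def)
qed

lemma rel_degree_le: "n > 0 \<Longrightarrow> m dvd n \<Longrightarrow> rel_degree n m \<le> max_degree n m"
  unfolding rel_degree_def using compatible[of n m] r_dvd[of n m] card_mono by metis

lemma max_degree:
  assumes "n > 0" "m dvd n"
  shows "n * totient n = m * totient m * max_degree n m"
  using card_orbit_zeta_fixing[OF assms] assms(2) by (auto simp: max_degree_def elim!: dvdE)

text \<open>The function \<open>n * totient n\<close> has the same product at \<open>gcd n N\<close>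
  and \<open>lcm n N\<close> as at \<open>n\<close> and \<open>N\<close>.\<close>

lemma max_degree_lcm:
  assumes "n > 0" "N > 0"
  shows "max_degree (lcm n N) N = max_degree n (gcd n N)"
proof -
  define g L where "g = gcd n N" and "L = lcm n N"
  have pos: "g > 0" "L > 0" using assms by (simp_all add: g_def L_def lcm_pos_nat)
  have tot: "totient g * totient L = totient n * totient N" "g * L = n * N"
    by (simp_all add: g_def L_def totient_gcd_lcm prod_gcd_lcm_nat[symmetric])
  have a: "n * totient n = g * totient g * max_degree n g"
    using max_degree[of n g] assms by (simp add: g_def)
  have b: "L * totient L = N * totient N * max_degree L N"
    using max_degree[of L N] pos by (simp add: L_def)
  have "g * totient g * (N * totient N) * max_degree L N = (g * L) * (totient g * totient L)"
    using b by (simp add: mult_ac)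
  also have "\<dots> = (N * totient N) * (n * totient n)" unfolding tot by (simp add: mult_ac)
  also have "\<dots> = g * totient g * (N * totient N) * max_degree n g" unfolding a by (simp add: mult_ac)
  finally show ?thesis
    using pos assms by (simp add: g_def[symmetric] L_def[symmetric])
qed

text \<open>With L the lcm, the exponents L/n and L/N are coprime, so K_L is the composite of K_n
  and K_N. Over the base K_N the generators of K_n have at most as many conjugates as over the
  smaller base belonging to the gcd.\<close>

lemma rel_degree_lcm:
  assumes n: "n > 0" and N: "N > 0"
  shows "rel_degree (lcm n N) N \<le> rel_degree n (gcd n N)"
proof -
  define g L where "g = gcd n N" and "L = lcm n N"
  have pos: "g > 0" "L > 0" using assms by (simp_all add: g_def L_def lcm_pos_nat)
  have dvd: "n dvd L" "N dvd L" "g dvd N" "g dvd n" by (simp_all add: g_def L_def)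
  have cop: "coprime (L div n) (L div N)"
  proof -
    have "L div n = N div g" "L div N = n div g"
      using n N pos by (simp_all add: L_def g_def lcm_nat_def div_mult_div_if_dvd mult.commute)
        (metis div_mult_swap gcd_dvd1 gcd_dvd2 mult.commute nonzero_mult_div_cancel_left not_less0)+
    then show ?thesis using div_gcd_coprime[of n N] n unfolding g_def by (simp add: coprime_commute)
  qed
  have pos': "L div n > 0" using dvd pos n by (auto simp: dvd_div_eq_0_iff intro: Nat.gr0I)
  have "card (orbit (set (gens N)) (gens L)) \<le> card (orbit (set (gens N)) (gens n))"
  proof (rule card_orbit_le)
    fix \<sigma> x assume f: "fixing (set (gens N) \<union> set (gens n)) \<sigma>" and x: "x \<in> set (gens L)"
    then have \<sigma>: "alg_aut \<sigma>" "\<sigma> (zeta N) = zeta N" "\<sigma> (zeta n) = zeta n" "\<sigma> (r N) = r N" "\<sigma> (r n) = r n"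
      by (simp_all add: fixing_def)
    have zL: "\<sigma> (zeta L) = zeta L"
    proof (rule alg_aut_fixed_by_coprime_powers[OF \<sigma>(1) _ _ _ _ cop pos'])
      show "\<sigma> (zeta L ^ (L div n)) = zeta L ^ (L div n)"
        unfolding zeta_power_dvd[OF dvd(1) pos(2)] by (rule \<sigma>)
      show "\<sigma> (zeta L ^ (L div N)) = zeta L ^ (L div N)"
        unfolding zeta_power_dvd[OF dvd(2) pos(2)] by (rule \<sigma>)
    qed (use algebraic_zeta[OF pos(2)] in simp_all)
    have pw: "\<sigma> (r L ^ (L div k)) = r L ^ (L div k)"
      if k: "k dvd L" "\<sigma> (zeta k) = zeta k" "\<sigma> (r k) = r k" for k
    proof -
      have k0: "k > 0" using k pos by (auto intro: Nat.gr0I)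
      have "(r L ^ (L div k) / r k) ^ k = 1"
        using r_pow[OF pos(2)] r_pow[OF k0] \<gamma>_nonzero k(1) by (simp add: power_divide flip: power_mult)
      then obtain i where "r L ^ (L div k) / r k = zeta k ^ i"
        using roots_of_unity_eq_zeta_powers[OF _ k0] by blast
      then have eq: "r L ^ (L div k) = r k * zeta k ^ i" using r_nonzero[OF k0] by (simp add: field_simps)
      show ?thesis
        unfolding eq using \<sigma>(1) k k0 algebraic_zeta[OF k0] algebraic_r[OF k0]
        by (simp add: alg_aut_power alg_aut_mult algebraic_closed)
    qed
    have "\<sigma> (r L) = r L"
      by (rule alg_aut_fixed_by_coprime_powers[OF \<sigma>(1) algebraic_r[OF pos(2)] r_nonzero[OF pos(2)]
            pw[OF dvd(1) \<sigma>(3,5)] pw[OF dvd(2) \<sigma>(2,4)] cop pos'])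
    with zL show "\<sigma> x = x" using x by auto
  qed (use gens_algebraic[OF n] gens_algebraic[OF N] gens_algebraic[OF pos(2)] in simp_all)
  also have "orbit (set (gens N)) (gens n) \<subseteq> orbit (set (gens g)) (gens n)"
  proof
    fix xs assume "xs \<in> orbit (set (gens N)) (gens n)"
    then obtain \<sigma> where \<sigma>: "fixing (set (gens N)) \<sigma>" "xs = map \<sigma> (gens n)" by (rule orbitE)
    have "fixing (set (gens g)) \<sigma>"
      using \<sigma>(1) gens_fixed_dvd[OF N dvd(3) \<sigma>(1)] by (simp only: fixing_def) blast
    then show "xs \<in> orbit (set (gens g)) (gens n)" unfolding \<sigma>(2) by (rule orbitI)
  qed
  then have "card (orbit (set (gens N)) (gens n)) \<le> card (orbit (set (gens g)) (gens n))"
    by (intro card_mono finite_orbit_list gens_algebraic n)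
  finally show ?thesis by (simp only: rel_degree_def g_def L_def)
qed

text \<open>Let e be largest at N, and put g = gcd(n, N), L = lcm(n, N). From e(L) \<le> e(N) the
  degree of K_L over K_N is at least its upper bound, and the chain \<open>max_degree n g =
  max_degree L N \<le> rel_degree L N \<le> rel_degree n g \<le> max_degree n g\<close>
  closes.\<close>

lemma stable_degree:
  assumes bounded: "\<And>n. n > 0 \<Longrightarrow> \<exists>e\<le>B. card (conjugates n) * e = 2 * (n * totient n)"
  obtains N where "N > 0" "\<And>n. n > 0 \<Longrightarrow> rel_degree n (gcd n N) = max_degree n (gcd n N)"
proof -
  obtain e where e: "\<And>n. n > 0 \<Longrightarrow> e n \<le> B" "\<And>n. n > 0 \<Longrightarrow> card (conjugates n) * e n = 2 * (n * totient n)"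
    using bounded by metis
  have pos: "card (conjugates n) > 0" if "n > 0" for n
    using e(2)[OF that] that by (auto intro: Nat.gr0I)
  obtain N where N: "N > 0" "\<And>n. n > 0 \<Longrightarrow> e n \<le> e N"
  proof -
    have "\<exists>N. N > 0 \<and> (\<forall>n. n > 0 \<longrightarrow> e n \<le> e N)"
      using ex_has_greatest_nat[of "\<lambda>n. n > 0" 1 e "Suc B"] e(1) by (simp add: le_imp_less_Suc)
    then show ?thesis using that by blast
  qed
  have "rel_degree n (gcd n N) = max_degree n (gcd n N)" if n: "n > 0" for n
  proof -
    define L where "L = lcm n N"
    have L: "L > 0" "N dvd L" using n N by (simp_all add: L_def lcm_pos_nat)
    have "card (conjugates N) * rel_degree L N * e L = 2 * (L * totient L)"
      using e(2)[OF L(1)] card_conjugates_dvd[OF L] by simp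
    also have "\<dots> = 2 * (N * totient N) * max_degree L N" using max_degree[OF L] by simp
    also have "\<dots> = card (conjugates N) * e N * max_degree L N" using e(2)[OF N(1)] by simp
    finally have eq: "rel_degree L N * e L = e N * max_degree L N" using pos[OF N(1)] by simp
    have eN: "e N > 0" using e(2)[OF N(1)] N(1) by (auto intro: Nat.gr0I)
    have "e N * max_degree L N \<le> rel_degree L N * e N"
      unfolding eq[symmetric] using N(2)[OF L(1)] by simp
    then have "max_degree L N \<le> rel_degree L N" using eN by simp
    also have "\<dots> \<le> rel_degree n (gcd n N)" unfolding L_def by (rule rel_degree_lcm[OF n N(1)])
    finally have "max_degree n (gcd n N) \<le> rel_degree n (gcd n N)"
      unfolding L_def max_degree_lcm[OF n N(1)] .
    moreover have "rel_degree n (gcd n N) \<le> max_degree n (gcd n N)"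
      using n by (intro rel_degree_le) auto
    ultimately show ?thesis by simp
  qed
  then show ?thesis using that N(1) by blast
qed

section \<open>Passing inverting automorphisms between levels\<close>

lemma inverse_conjugate_dvd:
  assumes n: "n > 0" and m: "m dvd n" and inv: "(inverse (zeta n), inverse (r n)) \<in> conjugates n"
  shows "(inverse (zeta m), inverse (r m)) \<in> conjugates m"
proof -
  obtain \<sigma> where \<sigma>: "alg_aut \<sigma>" "\<sigma> (zeta n) = inverse (zeta n)" "\<sigma> (r n) = inverse (r n)"
    using inv by (auto simp: conjugates_def)
  obtain j where j: "r m = r n ^ (n div m) * zeta n ^ j" using r_dvd[OF n m] by blast
  have z: "zeta m = zeta n ^ (n div m)" using zeta_power_dvd[of m n] n m by simp
  have "\<sigma> (zeta m) = inverse (zeta m)" "\<sigma> (r m) = inverse (r m)"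
    unfolding z j using \<sigma> algebraic_zeta[OF n] algebraic_r[OF n]
    by (simp_all add: alg_aut_power alg_aut_mult algebraic_closed power_inverse)
  then show ?thesis
    unfolding conjugates_def mem_Collect_eq using \<sigma>(1) by (intro exI[of _ \<sigma>]) simp
qed

text \<open>Let \<open>\<sigma>\<close> invert the generators at level m. It is corrected by some
  \<open>\<tau>\<close> fixing them, such that \<open>\<sigma> \<circ> \<tau>\<close> inverts the
  generators at level n. The values required of \<open>\<tau>\<close> are compatible, and full
  degree means that all compatible values occur.\<close>

lemma inverse_conjugate_if_full_degree:
  assumes n: "n > 0" and m: "m dvd n" and full: "rel_degree n m = max_degree n m"
    and inv: "(inverse (zeta m), inverse (r m)) \<in> conjugates m"
  shows "(inverse (zeta n), inverse (r n)) \<in> conjugates n"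
proof -
  have m0: "m > 0" using m n by (auto intro: Nat.gr0I)
  obtain j where j: "r m = r n ^ (n div m) * zeta n ^ j" using r_dvd[OF n m] by blast
  have z: "zeta m = zeta n ^ (n div m)" using zeta_power_dvd[of m n] n m by simp
  note alg = algebraic_zeta[OF n] algebraic_r[OF n] algebraic_zeta[OF m0] algebraic_r[OF m0]
  have eq: "orbit (set (gens m)) (gens n) = compatible n m j"
    using compatible[OF n m j] full by (intro card_subset_eq) (simp_all add: rel_degree_def)
  obtain \<sigma> where \<sigma>: "alg_aut \<sigma>" "\<sigma> (zeta m) = inverse (zeta m)" "\<sigma> (r m) = inverse (r m)"
    using inv by (auto simp: conjugates_def)
  obtain \<rho> where \<rho>: "alg_aut \<rho>" "\<And>x. algebraic x \<Longrightarrow> \<rho> (\<sigma> x) = x"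
      "\<And>x. algebraic x \<Longrightarrow> \<sigma> (\<rho> x) = x"
    by (rule alg_aut_inv_exists[OF \<sigma>(1)]) blast
  have \<rho>m: "\<rho> (inverse (zeta m)) = zeta m" "\<rho> (inverse (r m)) = r m"
    using \<rho>(2)[of "zeta m"] \<rho>(2)[of "r m"] \<sigma> alg by simp_all
  \<comment> \<open>\<open>\<kappa>\<close> inverts \<open>zeta n\<close> with no control over
    \<open>r n\<close>. Then \<open>\<rho> \<circ> \<kappa>\<close> fixes \<open>zeta m\<close>,
    which shows that \<open>z'\<close> is an admissible first component.\<close>
  obtain \<kappa> where \<kappa>: "alg_aut \<kappa>" "\<kappa> (zeta n) = inverse (zeta n)"
  proof -
    have "coprime (n - 1) n" by (rule coprime_diff_one_left_nat[OF n])
    then obtain \<kappa> where "alg_aut \<kappa>" "\<kappa> (zeta n) = zeta n ^ (n - 1)"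
      by (rule alg_aut_root_of_unity_power[OF zeta_pow[OF n] n])
    moreover have "zeta n ^ (n - 1) = inverse (zeta n)"
      using zeta_pow[OF n] power_minus_mult[OF n, of "zeta n"] by (simp add: field_simps)
    ultimately show ?thesis using that by simp
  qed
  define z' where "z' = \<rho> (inverse (zeta n))"
  define w' where "w' = \<rho> (inverse (r n))"
  have "fixing {zeta m} (\<rho> \<circ> \<kappa>)"
  proof -
    have "\<kappa> (zeta m) = inverse (zeta m)"
      unfolding z using \<kappa> alg by (simp add: alg_aut_power power_inverse)
    then show ?thesis using \<rho>m(1) alg_aut_comp[OF \<rho>(1) \<kappa>(1)] by (simp add: fixing_def)
  qed
  moreover have "z' = (\<rho> \<circ> \<kappa>) (zeta n)" by (simp add: z'_def \<kappa>(2))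
  ultimately have "z' \<in> {\<sigma> (zeta n) |\<sigma>. fixing {zeta m} \<sigma>}" by blast
  moreover have "w' ^ (n div m) = r m * inverse z' ^ j"
  proof -
    have "r m = \<rho> (inverse (r n ^ (n div m) * zeta n ^ j))" using \<rho>m(2) j by simp
    also have "\<dots> = w' ^ (n div m) * z' ^ j"
      using \<rho>(1) alg by (simp add: w'_def z'_def alg_aut_mult alg_aut_power algebraic_closed flip: power_inverse)
    finally show ?thesis
      using alg_aut_eq_0_iff[OF \<rho>(1), of "inverse (zeta n)"] alg
      by (simp add: z'_def algebraic_closed field_simps)
  qed
  ultimately have "[z', w'] \<in> orbit (set (gens m)) (gens n)"
    unfolding eq compatible_def by (auto simp: image_iff)
  then obtain \<tau> where \<tau>: "fixing (set (gens m)) \<tau>" "[z', w'] = map \<tau> (gens n)" by (rule orbitE)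
  have "(\<sigma> \<circ> \<tau>) (zeta n) = inverse (zeta n)" "(\<sigma> \<circ> \<tau>) (r n) = inverse (r n)"
    using \<tau>(2) \<rho>(3)[of "inverse (zeta n)"] \<rho>(3)[of "inverse (r n)"] alg
    by (auto simp: z'_def w'_def algebraic_closed)
  then show ?thesis
    unfolding conjugates_def mem_Collect_eq
    using alg_aut_comp[OF \<sigma>(1) fixing_alg_aut[OF \<tau>(1)]] by (intro exI[of _ "\<sigma> \<circ> \<tau>"]) simp
qed

end

section \<open>Roots of bounded index\<close>

text \<open>Power sums of two numbers with product 1 and sum a/b, multiplied by b^k to become
  integers.\<close>

fun trace_num :: "int \<Rightarrow> int \<Rightarrow> nat \<Rightarrow> int" where
  "trace_num a b 0 = 2"
| "trace_num a b (Suc 0) = a"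
| "trace_num a b (Suc (Suc k)) = a * trace_num a b (Suc k) - b ^ 2 * trace_num a b k"

lemma trace_num_eq:
  fixes x :: complex
  assumes "x \<noteq> 0" "of_int b * (x + inverse x) = of_int a"
  shows "of_int b ^ k * (x ^ k + inverse x ^ k) = of_int (trace_num a b k)"
proof (induction k rule: induct_nat_012)
  case (ge2 k)
  define y where "y = inverse x"
  have "x ^ Suc (Suc k) + y ^ Suc (Suc k) = (x + y) * (x ^ Suc k + y ^ Suc k) - (x * y) * (x ^ k + y ^ k)"
    by (simp add: algebra_simps)
  also have "x * y = 1" using assms(1) by (simp add: y_def)
  finally have "of_int b ^ Suc (Suc k) * (x ^ Suc (Suc k) + y ^ Suc (Suc k)) =
      (of_int b * (x + y)) * (of_int b ^ Suc k * (x ^ Suc k + y ^ Suc k)) -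
      of_int b ^ 2 * (of_int b ^ k * (x ^ k + y ^ k))"
    by (simp add: algebra_simps power2_eq_square)
  then show ?case using ge2 assms(2) by (simp add: y_def)
qed (use assms in auto)

lemma trace_num_cong: "b dvd trace_num a b (Suc k) - a ^ Suc k"
proof (induction k)
  case (Suc k)
  have "trace_num a b (Suc (Suc k)) - a ^ Suc (Suc k) =
      a * (trace_num a b (Suc k) - a ^ Suc k) - b * (b * trace_num a b k)"
    by (simp add: algebra_simps power2_eq_square)
  then show ?case using Suc by simp
qed simp

text \<open>Modulo \<open>b\<close> the recursion keeps only \<open>a ^ k\<close>. Hence
  \<open>b ^ k\<close> is the exact denominator of \<open>x ^ k + inverse x ^ k\<close>.\<close>

lemma coprime_trace_num:
  assumes "coprime a b" "k > 0"
  shows "coprime (trace_num a b k) b"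
proof -
  obtain k' where k: "k = Suc k'" using assms(2) by (cases k) auto
  obtain c where "trace_num a b k - a ^ k = b * c" using trace_num_cong[of b a k'] unfolding k by auto
  then have "trace_num a b k = a ^ k + b * c" by simp
  moreover have "coprime (a ^ k) b" using assms(1) by simp
  ultimately show ?thesis
    by (metis add.commute coprime_iff_gcd_eq_1 gcd.commute gcd_add_mult mult.commute)
qed

text \<open>For these \<open>s\<close> the roots of X^2 - s X + 1 have order 1, 2, 3, 4 or 6, and 12
  is a common multiple.\<close>

lemma root_of_unity_if_small_trace:
  fixes x :: complex
  assumes "x \<noteq> 0" "x + inverse x = of_int s" "\<bar>s\<bar> \<le> 2"
  shows "x ^ 12 = 1"
proof -
  have q: "x ^ 2 = of_int s * x - 1"
  proof -
    have "(x + inverse x) * x = x ^ 2 + 1" using assms(1) by (simp add: distrib_right power2_eq_square)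
    then show ?thesis unfolding assms(2) by simp
  qed
  have p3: "x ^ 3 = x * x ^ 2" by (simp add: power3_eq_cube power2_eq_square)
  consider "s = 0" | "s = 1" | "s = -1" | "s = 2" | "s = -2" using assms(3) by linarith
  then show ?thesis
  proof cases
    case 1
    then have "x ^ 2 = -1" using q by simp
    then have "(x ^ 2) ^ 6 = 1" by simp
    then show ?thesis by (simp flip: power_mult)
  next
    case 2
    then have eq: "x ^ 2 = x - 1" using q by simp
    have "x ^ 3 = x ^ 2 - x" unfolding p3 by (subst eq) (simp add: algebra_simps power2_eq_square)
    then have "x ^ 3 = -1" using eq by simp
    then have "(x ^ 3) ^ 4 = 1" by simp
    then show ?thesis by (simp flip: power_mult)
  next
    case 3
    then have eq: "x ^ 2 = - x - 1" using q by simp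
    have "x ^ 3 = - (x ^ 2) - x" unfolding p3 by (subst eq) (simp add: algebra_simps power2_eq_square)
    then have "x ^ 3 = 1" using eq by simp
    then have "(x ^ 3) ^ 4 = 1" by simp
    then show ?thesis by (simp flip: power_mult)
  next
    case 4
    then have "(x - 1) ^ 2 = 0" using q by (simp add: power2_eq_square algebra_simps)
    then show ?thesis by simp
  next
    case 5
    have "(x + 1) ^ 2 = x ^ 2 + 2 * x + 1" by (simp add: power2_eq_square algebra_simps)
    then have "(x + 1) ^ 2 = 0" using q 5 by simp
    then have "x = -1" by (simp add: add_eq_0_iff2)
    then show ?thesis by simp
  qed
qed

text \<open>If t and 1/t are both below 2, then (t - 2)(2t - 1) < 0, which means t + 1/t <
  5/2.\<close>

lemma norm_large_if_large_trace:
  fixes x :: complex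
  assumes "x \<noteq> 0" "x + inverse x = of_int s" "\<bar>s\<bar> \<ge> 3"
  shows "norm x \<ge> 2 \<or> norm (inverse x) \<ge> 2"
proof (rule ccontr)
  define t where "t = norm x"
  have t: "t > 0" using assms(1) by (simp add: t_def)
  assume "\<not> ?thesis"
  then have lt: "t < 2" "inverse t < 2" by (auto simp: t_def norm_inverse)
  have "3 \<le> norm (x + inverse x)" using assms(2,3) by simp
  also have "\<dots> \<le> t + inverse t" unfolding t_def norm_inverse[symmetric] by (rule norm_triangle_ineq)
  finally have "3 * t \<le> (t + inverse t) * t" using t by (intro mult_right_mono) simp_all
  also have "\<dots> = t * t + 1" using t by (simp add: distrib_right)
  finally have "3 * t \<le> t * t + 1" .
  moreover have "(t - 2) * (2 * t - 1) < 0"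
  proof (rule mult_neg_pos)
    have "inverse t * t < 2 * t" using lt(2) t by (rule mult_strict_right_mono)
    then show "0 < 2 * t - 1" using t by simp
  qed (use lt in simp)
  ultimately show False using t by (simp add: algebra_simps)
qed

text \<open>Let x + 1/x = a/b in lowest terms. If b > 1, then b^d is the denominator of the trace of
  \<eta>, so 2^d is at most a fixed \<open>q\<close>. If b = 1, then \<bar>a\<bar> \<ge> 3, since
  otherwise \<eta> would be a root of unity; so x or 1/x has absolute value at least 2, and \<eta>
  or its inverse at least 2^d.\<close>

lemma root_index_bounded:
  fixes \<eta> :: complex
  assumes nz: "\<eta> \<noteq> 0" and nr: "\<not> root_of_unity \<eta>"
  shows "\<exists>B. \<forall>x d. d > 0 \<longrightarrow> x + inverse x \<in> \<rat> \<longrightarrow> x ^ d = \<eta> \<longrightarrow> d \<le> B"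
proof -
  \<comment> \<open>A denominator of the trace of \<open>\<eta>\<close>, with dummy value 1 if that
    trace is irrational; in the case b > 1 below it is found to be rational.\<close>
  obtain q :: int where q: "q > 0" "\<eta> + inverse \<eta> \<in> \<rat> \<Longrightarrow> of_int q * (\<eta> + inverse \<eta>) \<in> \<int>"
  proof (cases "\<eta> + inverse \<eta> \<in> \<rat>")
    case True
    then obtain a b where "b > 0" "\<eta> + inverse \<eta> = of_int a / of_int b"
      by (auto elim!: Rats_cases')
    then show ?thesis using that[of b] by simp
  qed (use that[of 1] in auto)
  define B where "B = max (nat q) (nat \<lceil>max (norm \<eta>) (norm (inverse \<eta>))\<rceil>)"
  have "d \<le> B" if d: "d > 0" and rat: "x + inverse x \<in> \<rat>" and x: "x ^ d = \<eta>" for x d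
  proof -
    have x0: "x \<noteq> 0" using nz x d by (auto simp: power_0_left)
    have \<eta>': "inverse \<eta> = inverse x ^ d" using x by (simp add: power_inverse)
    obtain a b where ab: "b > 0" "coprime a b" "x + inverse x = of_int a / of_int b"
      using rat by (auto elim!: Rats_cases')
    then have ab': "of_int b * (x + inverse x) = of_int a" by simp
    have two: "int d < 2 ^ d" by (metis less_exp of_nat_less_iff of_nat_numeral of_nat_power)
    show ?thesis
    proof (cases "b = 1")
      case False
      have eq: "of_int b ^ d * (\<eta> + inverse \<eta>) = of_int (trace_num a b d)"
        using trace_num_eq[OF x0 ab', of d] x \<eta>' by simp
      then have "\<eta> + inverse \<eta> = of_int (trace_num a b d) / of_int (b ^ d)"
        using ab(1) by (simp add: field_simps)
      then have "\<eta> + inverse \<eta> \<in> \<rat>" by (metis Rats_divide Rats_of_int)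
      then obtain m where m: "of_int q * (\<eta> + inverse \<eta>) = of_int m" using q(2) by (auto elim: Ints_cases)
      have "(of_int (b ^ d * m) :: complex) = of_int (q * trace_num a b d)"
        by (simp flip: m eq) 
      then have "b ^ d * m = q * trace_num a b d" by (simp only: of_int_eq_iff)
      then have "b ^ d dvd q * trace_num a b d" by (metis dvd_triv_left)
      moreover have "coprime (b ^ d) (trace_num a b d)"
        using coprime_trace_num[OF ab(2) d] by (simp add: coprime_commute)
      ultimately have "b ^ d dvd q" by (simp add: coprime_dvd_mult_left_iff)
      then have "b ^ d \<le> q" using q(1) by (intro zdvd_imp_le)
      moreover have "(2::int) ^ d \<le> b ^ d" using False ab(1) by (intro power_mono) auto
      ultimately have "int d \<le> q" using two by linarith
      then have "d \<le> nat q" by linarith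
      then show ?thesis by (simp add: B_def)
    next
      case True
      then have s: "x + inverse x = of_int a" using ab(3) by simp
      have "\<bar>a\<bar> \<ge> 3"
      proof (rule ccontr)
        assume "\<not> \<bar>a\<bar> \<ge> 3"
        then have "x ^ 12 = 1" using root_of_unity_if_small_trace[OF x0 s] by simp
        then have "\<eta> ^ 12 = 1" using x by (metis mult.commute power_mult power_one)
        then have "root_of_unity \<eta>" unfolding root_of_unity_def by (intro exI[of _ 12]) simp
        then show False using nr by simp
      qed
      from norm_large_if_large_trace[OF x0 s this]
      have "2 ^ d \<le> max (norm \<eta>) (norm (inverse \<eta>))"
      proof
        assume "norm x \<ge> 2"
        then have "2 ^ d \<le> norm x ^ d" by (intro power_mono) auto
        then show ?thesis using x by (simp flip: norm_power)
      next
        assume "norm (inverse x) \<ge> 2"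
        then have "2 ^ d \<le> norm (inverse x) ^ d" by (intro power_mono) auto
        then show ?thesis unfolding \<eta>' by (simp add: norm_power)
      qed
      moreover have "real d < 2 ^ d" using two by (metis less_exp of_nat_less_iff of_nat_numeral of_nat_power)
      ultimately have "real d \<le> of_int \<lceil>max (norm \<eta>) (norm (inverse \<eta>))\<rceil>" by linarith
      then have "int d \<le> \<lceil>max (norm \<eta>) (norm (inverse \<eta>))\<rceil>" by linarith
      then have "d \<le> nat \<lceil>max (norm \<eta>) (norm (inverse \<eta>))\<rceil>" by linarith
      then show ?thesis by (simp add: B_def)
    qed
  qed
  then show ?thesis by blast
qed

text \<open>Lagrange's theorem: multiplication by \<open>w\<close> permutes the finite set
  \<open>M\<close>, so the product over \<open>M\<close> equals \<open>w ^ card M\<close> times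
  itself.\<close>

lemma mult_closed_power_card:
  fixes M :: "complex set"
  assumes "finite M" "0 \<notin> M" "\<And>v w. v \<in> M \<Longrightarrow> w \<in> M \<Longrightarrow> v * w \<in> M" "w \<in> M"
  shows "w ^ card M = 1"
proof -
  have "(\<lambda>v. w * v) ` M = M"
  proof (rule card_subset_eq[OF assms(1)])
    show "(\<lambda>v. w * v) ` M \<subseteq> M" using assms by blast
    have "w \<noteq> 0" using assms by blast
    then show "card ((\<lambda>v. w * v) ` M) = card M" by (intro card_image) (simp add: inj_on_def)
  qed
  moreover have "inj_on (\<lambda>v. w * v) M"
    using assms(2,4) by (auto simp: inj_on_def)
  ultimately have "(\<Prod>v\<in>M. v) = (\<Prod>v\<in>M. w * v)"
    by (metis prod.reindex_cong)
  also have "\<dots> = w ^ card M * (\<Prod>v\<in>M. v)" by (simp add: prod.distrib)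
  finally show ?thesis using assms(1,2) by (simp add: prod_zero_iff)
qed

section \<open>Schinzel's argument on roots of \<gamma> in abelian extensions\<close>

context kummer
begin

lemma alg_aut_commute_gens:
  assumes n: "n > 0" and \<sigma>: "alg_aut \<sigma>" and \<tau>: "alg_aut \<tau>"
  shows "\<sigma> (\<tau> (zeta n)) = \<tau> (\<sigma> (zeta n))" "\<sigma> (\<tau> \<gamma>) = \<tau> (\<sigma> \<gamma>)"
proof -
  have pw: "\<exists>k. \<sigma> (zeta n) = zeta n ^ k" if "alg_aut \<sigma>" for \<sigma>
  proof -
    have "\<sigma> (zeta n) ^ n = 1"
      using alg_aut_power[OF that algebraic_zeta[OF n], of n] alg_aut_1[OF that] zeta_pow[OF n] by simp
    then show ?thesis using roots_of_unity_eq_zeta_powers[OF _ n] by blast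
  qed
  obtain a b where "\<sigma> (zeta n) = zeta n ^ a" "\<tau> (zeta n) = zeta n ^ b" using pw \<sigma> \<tau> by blast
  then show "\<sigma> (\<tau> (zeta n)) = \<tau> (\<sigma> (zeta n))"
    using \<sigma> \<tau> algebraic_zeta[OF n] by (simp add: alg_aut_power mult.commute flip: power_mult)
  show "\<sigma> (\<tau> \<gamma>) = \<tau> (\<sigma> \<gamma>)"
    using \<gamma>_conjugate[OF \<sigma>] \<gamma>_conjugate[OF \<tau>] \<sigma> \<tau> algebraic_\<gamma> by (auto simp: alg_aut_inverse)
qed

text \<open>The Galois group of \<open>K(\<zeta>\<^sub>n)\<close> over the rationals is abelian.\<close>

lemma alg_aut_commute:
  assumes n: "n > 0" and y: "algebraic y"
    and fixed: "\<And>\<sigma>. fixing {zeta n, \<gamma>} \<sigma> \<Longrightarrow> \<sigma> y = y"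
    and \<sigma>: "alg_aut \<sigma>" and \<tau>: "alg_aut \<tau>"
  shows "\<sigma> (\<tau> y) = \<tau> (\<sigma> y)"
proof -
  have c: "alg_aut (\<tau> \<circ> \<sigma>)" using alg_aut_comp[OF \<tau> \<sigma>] .
  obtain \<rho> where \<rho>: "alg_aut \<rho>" "\<And>x. algebraic x \<Longrightarrow> \<rho> ((\<tau> \<circ> \<sigma>) x) = x"
      "\<And>x. algebraic x \<Longrightarrow> (\<tau> \<circ> \<sigma>) (\<rho> x) = x"
    by (rule alg_aut_inv_exists[OF c]) blast
  have "fixing {zeta n, \<gamma>} (\<rho> \<circ> (\<sigma> \<circ> \<tau>))"
    using \<rho>(2)[OF algebraic_zeta[OF n]] \<rho>(2)[OF algebraic_\<gamma>] alg_aut_commute_gens[OF n \<sigma> \<tau>]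
      alg_aut_comp[OF \<rho>(1) alg_aut_comp[OF \<sigma> \<tau>]] by (simp add: fixing_def)
  then have "\<rho> (\<sigma> (\<tau> y)) = y" using fixed[of "\<rho> \<circ> (\<sigma> \<circ> \<tau>)"] by simp
  then show ?thesis
    using \<rho>(3)[of "\<sigma> (\<tau> y)"] alg_aut_closed \<sigma> \<tau> y by simp
qed

text \<open>All automorphisms inverting \<gamma> act on \<open>c\<close> like one involution
  \<open>\<iota>\<close>, so the norm \<open>p = c * \<iota> c\<close> is rational. Since \<iota>
  inverts \<open>\<delta>\<close>, \<open>p ^ d = 1\<close>, hence p is 1 or -1. The possible sign
  is the reason for passing to \<open>c ^ 2\<close>, whose image under \<open>\<iota>\<close> is its
  inverse.\<close>

lemma rational_trace_if_fixed:
  assumes c: "algebraic c" "c \<noteq> 0"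
    and fixed: "\<And>\<sigma>. fixing {\<gamma>} \<sigma> \<Longrightarrow> \<sigma> c = c"
    and cd: "c ^ d = \<delta>" "d > 0" and \<delta>: "\<And>\<sigma>. alg_aut \<sigma> \<Longrightarrow> \<sigma> \<gamma> = inverse \<gamma> \<Longrightarrow> \<sigma> \<delta> = inverse \<delta>"
  shows "c ^ 2 + inverse (c ^ 2) \<in> \<rat>"
proof -
  have \<delta>0: "\<delta> \<noteq> 0" using cd c by auto
  obtain \<iota> where \<iota>: "alg_aut \<iota>" "\<iota> \<gamma> = inverse \<gamma>" using \<gamma>_inverted by blast
  have ic: "\<sigma> c = \<iota> c" if "alg_aut \<sigma>" "\<sigma> \<gamma> = inverse \<gamma>" for \<sigma>
  proof -
    obtain \<rho> where \<rho>: "alg_aut \<rho>" "\<And>x. algebraic x \<Longrightarrow> \<rho> (\<iota> x) = x"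
        "\<And>x. algebraic x \<Longrightarrow> \<iota> (\<rho> x) = x"
      by (rule alg_aut_inv_exists[OF \<iota>(1)]) blast
    have "\<rho> (inverse \<gamma>) = \<gamma>" using \<rho>(2)[OF algebraic_\<gamma>] \<iota>(2) by simp
    then have "fixing {\<gamma>} (\<rho> \<circ> \<sigma>)"
      using alg_aut_comp[OF \<rho>(1) that(1)] that(2) by (simp add: fixing_def)
    then have "\<rho> (\<sigma> c) = c" using fixed[of "\<rho> \<circ> \<sigma>"] by simp
    then show ?thesis using \<rho>(3)[OF alg_aut_closed[OF that(1) c(1)]] by simp
  qed
  have alg': "algebraic (\<iota> c)" using alg_aut_closed[OF \<iota>(1) c(1)] .
  have iic: "\<sigma> (\<iota> c) = c" if "alg_aut \<sigma>" "\<sigma> \<gamma> = inverse \<gamma>" for \<sigma>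
  proof -
    have "fixing {\<gamma>} (\<sigma> \<circ> \<iota>)"
      using that \<iota> alg_aut_comp[OF that(1) \<iota>(1)] algebraic_\<gamma> by (simp add: fixing_def alg_aut_inverse)
    then show ?thesis using fixed[of "\<sigma> \<circ> \<iota>"] by simp
  qed
  have fic: "\<sigma> (\<iota> c) = \<iota> c" if "alg_aut \<sigma>" "\<sigma> \<gamma> = \<gamma>" for \<sigma>
  proof -
    have "(\<sigma> \<circ> \<iota>) \<gamma> = inverse \<gamma>" using that \<iota> algebraic_\<gamma> by (simp add: alg_aut_inverse)
    then show ?thesis using ic[OF alg_aut_comp[OF that(1) \<iota>(1)]] by simp
  qed
  define p where "p = c * \<iota> c"
  have "p \<in> \<rat>"
  proof (rule in_Rats_if_alg_aut_fixed)
    show "algebraic p" using c alg' by (simp add: p_def algebraic_closed)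
    fix \<sigma> assume \<sigma>: "alg_aut \<sigma>"
    show "\<sigma> p = p"
    proof (cases "\<sigma> \<gamma> = \<gamma>")
      case True
      then have "\<sigma> c = c" using fixed[of \<sigma>] \<sigma> by (simp add: fixing_def)
      then show ?thesis using fic[OF \<sigma> True] alg' c \<sigma> by (simp add: p_def alg_aut_mult)
    next
      case False
      then have inv: "\<sigma> \<gamma> = inverse \<gamma>" using \<gamma>_conjugate[OF \<sigma>] by blast
      then show ?thesis using ic[OF \<sigma> inv] iic[OF \<sigma> inv] alg' c \<sigma> by (simp add: p_def alg_aut_mult mult.commute)
    qed
  qed
  then have "p \<in> \<real>" by (metis Rats_cases' Reals_divide Reals_of_int)
  have "p ^ d = \<delta> * \<iota> \<delta>"
    using cd alg_aut_power[OF \<iota>(1) c(1), of d] by (simp add: p_def power_mult_distrib)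
  then have "p ^ d = 1" using \<delta>[OF \<iota>] \<delta>0 by simp
  then have "norm p = 1" using cd(2) by (metis norm_one norm_power power_eq_1_iff norm_ge_zero less_not_refl)
  then have p2: "p ^ 2 = 1" using \<open>p \<in> \<real>\<close> by (auto elim!: Reals_cases simp: abs_if split: if_splits)
  have p2': "(\<iota> c) ^ 2 = inverse (c ^ 2)"
    using p2 c(2) by (simp add: p_def power_mult_distrib field_simps)
  show ?thesis
  proof (rule in_Rats_if_alg_aut_fixed)
    show "algebraic (c ^ 2 + inverse (c ^ 2))" using c by (simp add: algebraic_closed)
    fix \<sigma> assume \<sigma>: "alg_aut \<sigma>"
    have *: "\<sigma> (c ^ 2 + inverse (c ^ 2)) = \<sigma> c ^ 2 + inverse (\<sigma> c ^ 2)"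
      using \<sigma> c by (simp add: alg_aut_add alg_aut_inverse alg_aut_power algebraic_closed)
    show "\<sigma> (c ^ 2 + inverse (c ^ 2)) = c ^ 2 + inverse (c ^ 2)"
    proof (cases "\<sigma> \<gamma> = \<gamma>")
      case True
      then have "\<sigma> c = c" using fixed[of \<sigma>] \<sigma> by (simp add: fixing_def)
      then show ?thesis unfolding * by simp
    next
      case False
      then have "\<sigma> c = \<iota> c" using ic[OF \<sigma>] \<gamma>_conjugate[OF \<sigma>] by blast
      then show ?thesis unfolding * using p2' by simp
    qed
  qed
qed

text \<open>An automorphism \<open>\<sigma>\<close> fixing \<gamma> multiplies \<open>y\<close> by
  some power of \<open>zeta d\<close>. As \<open>\<sigma>\<close> and \<open>\<tau>\<close> commute
  on \<open>y\<close>, it multiplies \<open>\<tau> y\<close> and \<open>y ^ k\<close> by the same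
  root of unity, so it fixes the quotient \<open>c\<close>. This places \<open>c\<close> in K, and
  its square is the required \<open>x\<close>.\<close>

lemma root_in_abelian_extension:
  assumes n: "n > 0" and y: "y ^ d = \<gamma>"
    and fixed: "\<And>\<sigma>. fixing {zeta n, \<gamma>} \<sigma> \<Longrightarrow> \<sigma> y = y"
    and d: "d > 0" and j: "coprime j d" "j > 0"
  shows "\<exists>x. x + inverse x \<in> \<rat> \<and> x ^ d = inverse \<gamma> ^ (2 * (j ^ 2 - 1))"
proof -
  have alg: "algebraic y" using algebraic_root[OF y d algebraic_\<gamma>] .
  have y0: "y \<noteq> 0" using y d \<gamma>_nonzero by (auto simp: power_0_left)
  define k where "k = j ^ 2"
  have k: "k = Suc (k - 1)" using j(2) by (simp add: k_def)
  obtain \<tau>0 where \<tau>0: "alg_aut \<tau>0" "\<tau>0 (zeta d) = zeta d ^ j"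
    by (rule alg_aut_root_of_unity_power[OF zeta_pow[OF d] d j(1)])
  \<comment> \<open>\<open>\<tau>0\<close> may invert \<gamma>, but its square fixes \<gamma>; this
    is why the exponent is \<open>j ^ 2\<close> instead of \<open>j\<close>.\<close>
  define \<tau> where "\<tau> = \<tau>0 \<circ> \<tau>0"
  have \<tau>: "alg_aut \<tau>" unfolding \<tau>_def by (rule alg_aut_comp[OF \<tau>0(1) \<tau>0(1)])
  have \<tau>\<gamma>: "\<tau> \<gamma> = \<gamma>"
    using \<gamma>_conjugate[OF \<tau>0(1)] \<tau>0(1) algebraic_\<gamma> by (auto simp: \<tau>_def alg_aut_inverse)
  have \<tau>z: "\<tau> (zeta d) = zeta d ^ k"
    using \<tau>0 algebraic_zeta[OF d] by (simp add: \<tau>_def alg_aut_power k_def power2_eq_square power_mult)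
  define c where "c = \<tau> y / y ^ k"
  have algc: "algebraic c" using alg alg_aut_closed[OF \<tau> alg] by (simp add: c_def algebraic_closed)
  have c0: "c \<noteq> 0" using y0 alg_aut_eq_0_iff[OF \<tau> alg] by (simp add: c_def)
  have cd: "c ^ d = inverse \<gamma> ^ (k - 1)"
  proof -
    have "c ^ d = \<tau> (y ^ d) / (y ^ d) ^ k"
      unfolding c_def power_divide alg_aut_power[OF \<tau> alg] by (simp add: mult.commute flip: power_mult)
    also have "\<dots> = \<gamma> / \<gamma> ^ k" unfolding y \<tau>\<gamma> ..
    also have "\<dots> = inverse \<gamma> ^ (k - 1)" using \<gamma>_nonzero by (subst k) (simp add: field_simps)
    finally show ?thesis .
  qed
  have fc: "\<sigma> c = c" if "fixing {\<gamma>} \<sigma>" for \<sigma>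
  proof -
    have \<sigma>: "alg_aut \<sigma>" "\<sigma> \<gamma> = \<gamma>" using that by (simp_all add: fixing_def)
    have "(\<sigma> y / y) ^ d = 1"
      using alg_aut_power[OF \<sigma>(1) alg, of d] \<sigma>(2) y \<gamma>_nonzero by (simp add: power_divide)
    then obtain i where i: "\<sigma> y / y = zeta d ^ i" using roots_of_unity_eq_zeta_powers[OF _ d] by blast
    then have \<sigma>y: "\<sigma> y = zeta d ^ i * y" using y0 by (simp add: field_simps)
    have "\<sigma> (\<tau> y) = \<tau> (\<sigma> y)" by (rule alg_aut_commute[OF n alg _ \<sigma>(1) \<tau>]) (rule fixed)
    also have "\<dots> = (zeta d ^ i) ^ k * \<tau> y"
      using \<tau> alg algebraic_zeta[OF d] unfolding \<sigma>y
      by (simp add: alg_aut_mult alg_aut_power algebraic_closed \<tau>z mult.commute flip: power_mult)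
    finally have "\<sigma> (\<tau> y) = (zeta d ^ i) ^ k * \<tau> y" .
    moreover have "\<sigma> (y ^ k) = (zeta d ^ i) ^ k * y ^ k"
      using alg_aut_power[OF \<sigma>(1) alg] \<sigma>y by (simp add: power_mult_distrib)
    ultimately show ?thesis
      using \<sigma>(1) alg alg_aut_closed[OF \<tau> alg] unfolding c_def
      by (simp add: alg_aut_divide algebraic_closed)
  qed
  have "c ^ 2 + inverse (c ^ 2) \<in> \<rat>"
  proof (rule rational_trace_if_fixed[OF algc c0 _ cd d])
    show "\<sigma> c = c" if "fixing {\<gamma>} \<sigma>" for \<sigma> by (rule fc[OF that])
    fix \<sigma> assume "alg_aut \<sigma>" "\<sigma> \<gamma> = inverse \<gamma>"
    then show "\<sigma> (inverse \<gamma> ^ (k - 1)) = inverse (inverse \<gamma> ^ (k - 1))"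
      using algebraic_\<gamma> by (simp add: alg_aut_power alg_aut_inverse algebraic_closed power_inverse)
  qed
  moreover have "(c ^ 2) ^ d = inverse \<gamma> ^ (2 * (j ^ 2 - 1))"
  proof -
    have "(c ^ 2) ^ d = (c ^ d) ^ 2" by (simp add: mult.commute flip: power_mult)
    then show ?thesis unfolding cd by (simp add: k_def mult.commute flip: power_mult)
  qed
  ultimately show ?thesis by blast
qed

text \<open>The exponents 16 and 6 are 2 (j^2 - 1) for j = 3 and j = 2, used for the power of two in
  \<open>d\<close> and for its odd part. Each part has its root of \<gamma> among the powers of
  \<open>y\<close>, and the product of the two bounds serves for \<open>d\<close>.\<close>

lemma power_index_bounded:
  obtains B where "\<And>n y d. n > 0 \<Longrightarrow> d > 0 \<Longrightarrow> y ^ d = \<gamma> \<Longrightarrow>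
    (\<And>\<sigma>. fixing {zeta n, \<gamma>} \<sigma> \<Longrightarrow> \<sigma> y = y) \<Longrightarrow> d \<le> B"
proof -
  have "\<exists>B. \<forall>x d. d > 0 \<longrightarrow> x + inverse x \<in> \<rat> \<longrightarrow> x ^ d = inverse \<gamma> ^ m \<longrightarrow> d \<le> B" if "m > 0" for m
  proof (rule root_index_bounded)
    show "inverse \<gamma> ^ m \<noteq> 0" using \<gamma>_nonzero by simp
    show "\<not> root_of_unity (inverse \<gamma> ^ m)"
    proof
      assume "root_of_unity (inverse \<gamma> ^ m)"
      then obtain l where "l > 0" "(inverse \<gamma> ^ m) ^ l = 1" by (auto simp: root_of_unity_def)
      then have "\<gamma> ^ (m * l) = 1" by (simp add: power_inverse power_mult)
      then show False using \<gamma>_power_neq_1[of "m * l"] that \<open>l > 0\<close> by simp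
    qed
  qed
  then obtain B where B: "\<And>m x d. m > 0 \<Longrightarrow> d > 0 \<Longrightarrow> x + inverse x \<in> \<rat> \<Longrightarrow> x ^ d = inverse \<gamma> ^ m \<Longrightarrow> d \<le> B m"
    by metis
  have "d \<le> B 16 * B 6" if n: "n > 0" and d: "d > 0" and y: "y ^ d = \<gamma>"
    and fixed: "\<And>\<sigma>. fixing {zeta n, \<gamma>} \<sigma> \<Longrightarrow> \<sigma> y = y" for n y d
  proof -
    obtain a q where aq: "d = 2 ^ a * q" "odd q"
      using d by (metis multiplicity_decompose' not_gr_zero odd_one prime_elem_multiplicity_eq_zero_iff two_is_prime_nat not_prime_unit)
    have alg: "algebraic y" using algebraic_root[OF y d algebraic_\<gamma>] .
    have f: "\<sigma> (y ^ i) = y ^ i" if "fixing {zeta n, \<gamma>} \<sigma>" for \<sigma> i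
      using alg_aut_power[OF fixing_alg_aut[OF that] alg] fixed[OF that] by simp
    have "(y ^ q) ^ (2 ^ a) = \<gamma>" using y by (simp add: aq(1) mult.commute flip: power_mult)
    then have "\<exists>x. x + inverse x \<in> \<rat> \<and> x ^ (2 ^ a) = inverse \<gamma> ^ (2 * (3 ^ 2 - 1))"
      by (rule root_in_abelian_extension[OF n]) (rule f, simp_all)
    then obtain x where x: "x + inverse x \<in> \<rat>" "x ^ (2 ^ a) = inverse \<gamma> ^ 16" by auto
    have 1: "2 ^ a \<le> B 16" by (rule B[OF _ _ x]) simp_all
    have "(y ^ (2 ^ a)) ^ q = \<gamma>" using y by (simp add: aq(1) flip: power_mult)
    then have "\<exists>x. x + inverse x \<in> \<rat> \<and> x ^ q = inverse \<gamma> ^ (2 * (2 ^ 2 - 1))"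
      by (rule root_in_abelian_extension[OF n]) (rule f, use aq(2) in \<open>auto intro: Nat.gr0I\<close>)
    then obtain x where x: "x + inverse x \<in> \<rat>" "x ^ q = inverse \<gamma> ^ 6" by auto
    have 2: "q \<le> B 6" by (rule B[OF _ _ x]) (use aq(2) in \<open>auto intro: Nat.gr0I\<close>)
    show ?thesis unfolding aq(1) by (rule mult_le_mono[OF 1 2])
  qed
  then show ?thesis using that by blast
qed

end

section \<open>The degree of the Kummer field up to a bounded factor\<close>

context kummer
begin

text \<open>The factors by which automorphisms over K(zeta_n) multiply \<open>r n\<close> form a
  finite group \<open>M\<close> of roots of unity. With g its order, \<open>M\<close> consists of
  all g-th roots of unity, so g divides n and \<open>y = r n ^ g\<close> is fixed.\<close>

lemma kummer_index:
  assumes n: "n > 0"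
  obtains y d where "d > 0" "y ^ d = \<gamma>" "\<And>\<sigma>. fixing {zeta n, \<gamma>} \<sigma> \<Longrightarrow> \<sigma> y = y"
    "n = card (orbit {zeta n, \<gamma>} [r n]) * d"
proof -
  note alg = algebraic_zeta[OF n] algebraic_r[OF n]
  note r0 = r_nonzero[OF n]
  define M where "M = (\<lambda>y. y / r n) ` {\<sigma> (r n) |\<sigma>. fixing {zeta n, \<gamma>} \<sigma>}"
  have ME: "\<exists>\<sigma>. fixing {zeta n, \<gamma>} \<sigma> \<and> \<sigma> (r n) = w * r n" if "w \<in> M" for w
    using that r0 by (auto simp: M_def)
  have MI: "w \<in> M" if "fixing {zeta n, \<gamma>} \<sigma>" "\<sigma> (r n) = w * r n" for w \<sigma>
  proof -
    have "w = \<sigma> (r n) / r n" using that r0 by simp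
    then show ?thesis using that(1) unfolding M_def by blast
  qed
  have root: "w ^ n = 1" if w: "w \<in> M" for w
  proof -
    obtain \<sigma> where \<sigma>: "fixing {zeta n, \<gamma>} \<sigma>" "\<sigma> (r n) = w * r n" using ME[OF w] by blast
    have "\<sigma> (r n) ^ n = \<gamma>"
      using alg_aut_power[OF fixing_alg_aut[OF \<sigma>(1)] alg(2), of n] \<sigma>(1) r_pow[OF n] by (simp add: fixing_def)
    then show ?thesis using \<sigma>(2) r_pow[OF n] \<gamma>_nonzero by (simp add: power_mult_distrib)
  qed
  have fin: "finite M"
    by (rule finite_subset[of _ "{w. w ^ n = 1}"]) (use root finite_nth_roots[OF n] in auto)
  define g where "g = card M"
  have "1 \<in> M" using MI[OF fixing_id, of 1] by simp
  then have g: "g > 0" using fin by (auto simp: g_def card_gt_0_iff)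
  have closed: "v * w \<in> M" if "v \<in> M" "w \<in> M" for v w
  proof -
    obtain \<sigma> where \<sigma>: "fixing {zeta n, \<gamma>} \<sigma>" "\<sigma> (r n) = v * r n" using ME[OF \<open>v \<in> M\<close>] by blast
    obtain \<tau> where \<tau>: "fixing {zeta n, \<gamma>} \<tau>" "\<tau> (r n) = w * r n" using ME[OF \<open>w \<in> M\<close>] by blast
    obtain k where k: "w = zeta n ^ k" using roots_of_unity_eq_zeta_powers[OF root[OF \<open>w \<in> M\<close>] n] by blast
    have "\<sigma> (w * r n) = \<sigma> (zeta n) ^ k * \<sigma> (r n)"
      unfolding k using fixing_alg_aut[OF \<sigma>(1)] alg by (simp add: alg_aut_mult alg_aut_power algebraic_closed)
    then have "(\<sigma> \<circ> \<tau>) (r n) = (v * w) * r n" using \<sigma> \<tau>(2) k by (simp add: fixing_def)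
    then show ?thesis by (rule MI[OF fixing_comp[OF \<sigma>(1) \<tau>(1)]])
  qed
  have pow: "w ^ g = 1" if "w \<in> M" for w
    unfolding g_def
  proof (rule mult_closed_power_card[OF fin _ _ that])
    show "0 \<notin> M" using root[of 0] n by (auto simp: power_0_left)
  qed (rule closed)
  have "M = {w. w ^ g = 1}"
    by (rule card_subset_eq) (use pow g card_roots_unity_eq[OF g] finite_nth_roots[OF g] in \<open>auto simp: g_def\<close>)
  then have "zeta g \<in> M" using zeta_pow[OF g] by simp
  then have "zeta g ^ n = 1" by (rule root)
  then have "g dvd n" using zeta_power_eq_1_iff[OF g] by blast
  then obtain d where d: "n = g * d" by (auto simp: dvd_def)
  show ?thesis
  proof (rule that)
    show "d > 0" using n d by (auto intro: Nat.gr0I)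
    show "(r n ^ g) ^ d = \<gamma>" using r_pow[OF n] unfolding d by (simp add: power_mult)
    show "\<sigma> (r n ^ g) = r n ^ g" if "fixing {zeta n, \<gamma>} \<sigma>" for \<sigma>
    proof -
      have "\<sigma> (r n) / r n \<in> M" using that unfolding M_def by blast
      then have "(\<sigma> (r n) / r n) ^ g = 1" by (rule pow)
      then show ?thesis
        using alg_aut_power[OF fixing_alg_aut[OF that] alg(2)] r0 by (simp add: power_divide)
    qed
    have "card M = card {\<sigma> (r n) |\<sigma>. fixing {zeta n, \<gamma>} \<sigma>}"
      unfolding M_def using r0 by (intro card_image) (simp add: inj_on_def)
    then show "n = card (orbit {zeta n, \<gamma>} [r n]) * d"
      by (simp add: card_orbit_singleton g_def d)
  qed
qed

text \<open>The tower \<rat>, \<rat>(zeta_n), K(zeta_n), K_n. Inserting \<gamma> before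
  \<open>r n\<close> changes no orbit size, as \<gamma> is a power of \<open>r n\<close>.\<close>

lemma card_conjugates_decomposition:
  assumes n: "n > 0"
  shows "card (conjugates n) = totient n * (card (orbit {zeta n} [\<gamma>]) * card (orbit {zeta n, \<gamma>} [r n]))"
proof -
  note alg = algebraic_zeta[OF n] algebraic_r[OF n] algebraic_\<gamma>
  have "card (conjugates n) = card (orbit {} ([zeta n] @ [r n]))"
    by (simp add: card_conjugates_eq_orbit)
  also have "\<dots> = card (orbit {} [zeta n]) * card (orbit ({} \<union> set [zeta n]) [r n])"
    using alg by (intro card_orbit_append) simp_all
  also have "\<dots> = totient n * card (orbit {zeta n} [r n])"
    using card_orbit_zeta_list[OF n] by simp
  also have "card (orbit {zeta n} [r n]) = card (orbit {zeta n} ([\<gamma>] @ [r n]))"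
  proof (rule antisym)
    show "card (orbit {zeta n} [r n]) \<le> card (orbit {zeta n} ([\<gamma>] @ [r n]))"
      using alg by (intro card_orbit_le) (auto simp: fixing_def)
    have "\<sigma> \<gamma> = \<gamma>" if "alg_aut \<sigma>" "\<sigma> (r n) = r n" for \<sigma>
      using alg_aut_power[OF that(1) alg(2), of n] that(2) r_pow[OF n] by simp
    then show "card (orbit {zeta n} ([\<gamma>] @ [r n])) \<le> card (orbit {zeta n} [r n])"
      using alg by (intro card_orbit_le) (auto simp: fixing_def)
  qed
  also have "\<dots> = card (orbit {zeta n} [\<gamma>]) * card (orbit ({zeta n} \<union> set [\<gamma>]) [r n])"
    using alg by (intro card_orbit_append) simp_all
  finally show ?thesis by (simp add: insert_commute)
qed

lemma card_orbit_\<gamma>: "card (orbit {zeta n} [\<gamma>]) \<in> {1, 2}"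
proof -
  have sub: "orbit {zeta n} [\<gamma>] \<subseteq> {[\<gamma>], [inverse \<gamma>]}"
    using \<gamma>_conjugate by (auto simp: orbit_def dest!: fixing_alg_aut)
  have "orbit {zeta n} [\<gamma>] \<noteq> {}"
    using orbitI[OF fixing_id[of "{zeta n}"], of "[\<gamma>]"] by auto
  then have "card (orbit {zeta n} [\<gamma>]) > 0"
    using finite_subset[OF sub] by (simp add: card_gt_0_iff)
  moreover have "card (orbit {zeta n} [\<gamma>]) \<le> card {[\<gamma>], [inverse \<gamma>]}"
    by (rule card_mono[OF _ sub]) simp
  then have "card (orbit {zeta n} [\<gamma>]) \<le> 2"
    by (rule order.trans) (simp add: card_insert_le_m1)
  ultimately show ?thesis by force
qed

text \<open>With \<open>d\<close> from \<open>kummer_index\<close>, the quotient e(n) is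
  \<open>2 * d\<close> when every automorphism fixing \<open>zeta n\<close> fixes \<gamma>, and
  \<open>d\<close> otherwise.\<close>

lemma degree_index_bounded:
  obtains B where "\<And>n. n > 0 \<Longrightarrow> \<exists>e\<le>B. card (conjugates n) * e = 2 * (n * totient n)"
proof -
  obtain B where B: "\<And>n y d. n > 0 \<Longrightarrow> d > 0 \<Longrightarrow> y ^ d = \<gamma> \<Longrightarrow>
    (\<And>\<sigma>. fixing {zeta n, \<gamma>} \<sigma> \<Longrightarrow> \<sigma> y = y) \<Longrightarrow> d \<le> B"
    by (rule power_index_bounded) blast
  have "\<exists>e\<le>2 * B. card (conjugates n) * e = 2 * (n * totient n)" if n: "n > 0" for n
  proof -
    obtain y d where d: "d > 0" "y ^ d = \<gamma>" "\<And>\<sigma>. fixing {zeta n, \<gamma>} \<sigma> \<Longrightarrow> \<sigma> y = y"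
      "n = card (orbit {zeta n, \<gamma>} [r n]) * d"
      by (rule kummer_index[OF n]) blast
    have "d \<le> B" by (rule B[OF n d(1,2)]) (rule d(3))
    define g where "g = card (orbit {zeta n, \<gamma>} [r n])"
    have c: "card (conjugates n) = totient n * (card (orbit {zeta n} [\<gamma>]) * g)"
      using card_conjugates_decomposition[OF n] by (simp add: g_def)
    have ng: "n = g * d" using d(4) by (simp add: g_def)
    consider "card (orbit {zeta n} [\<gamma>]) = 1" | "card (orbit {zeta n} [\<gamma>]) = 2"
      using card_orbit_\<gamma>[of n] by auto
    then show ?thesis
    proof cases
      case 1
      then have "card (conjugates n) * (2 * d) = 2 * (g * d * totient n)" using c by simp
      then show ?thesis using \<open>d \<le> B\<close> ng by (intro exI[of _ "2 * d"]) simp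
    next
      case 2
      then have "card (conjugates n) * d = 2 * (g * d * totient n)" using c by simp
      then show ?thesis using \<open>d \<le> B\<close> ng by (intro exI[of _ d]) simp
    qed
  qed
  then show ?thesis by (rule that)
qed

text \<open>From \<open>gcd n N\<close> to \<open>n\<close> the degree and
  \<open>n * totient n\<close> grow by the same factor \<open>max_degree\<close>, and an inverting
  automorphism exists at one level exactly if it does at the other. So the normalised term
  \<open>c\<close> takes equal values at both.\<close>

theorem density_term_depends_on_gcd:
  obtains N c where "N > 0" "\<And>n. c n \<in> \<rat>"
    "\<And>n. n > 0 \<Longrightarrow> real (card (C_set D r n)) / real (degree_over_rats (kummer_field D r n)) =
      c (gcd n N) / (real n * real (totient n))"
proof -
  obtain B where B: "\<And>n. n > 0 \<Longrightarrow> \<exists>e\<le>B. card (conjugates n) * e = 2 * (n * totient n)"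
    by (rule degree_index_bounded) blast
  obtain N where N: "N > 0" "\<And>n. n > 0 \<Longrightarrow> rel_degree n (gcd n N) = max_degree n (gcd n N)"
  proof (rule stable_degree)
    show "\<exists>e\<le>B. card (conjugates n) * e = 2 * (n * totient n)" if "n > 0" for n
      by (rule B[OF that])
  qed blast
  define c where "c n = real (card (C_set D r n)) / real (card (conjugates n)) * (real n * real (totient n))" for n
  show ?thesis
  proof (rule that[of N c])
    show "N > 0" by (rule N(1))
    show "c n \<in> \<rat>" for n by (simp add: c_def)
    fix n :: nat assume n: "n > 0"
    define g where "g = gcd n N"
    have g: "g > 0" "g dvd n" using n by (simp_all add: g_def)
    have full: "rel_degree n g = max_degree n g" using N(2)[OF n] by (simp add: g_def)
    have C: "card (C_set D r n) = card (C_set D r g)"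
      using inverse_conjugate_dvd[OF n g(2)] inverse_conjugate_if_full_degree[OF n g(2) full]
        card_C_set[OF n] card_C_set[OF g(1)] by auto
    have deg: "card (conjugates n) = card (conjugates g) * max_degree n g"
      using card_conjugates_dvd[OF n g(2)] full by simp
    have md: "real n * real (totient n) = real g * real (totient g) * real (max_degree n g)"
      using max_degree[OF n g(2)] by (metis of_nat_mult)
    have "real n * real (totient n) \<noteq> 0" using n by simp
    then have nz: "max_degree n g \<noteq> 0" "totient g \<noteq> 0" unfolding md by simp_all
    show "real (card (C_set D r n)) / real (degree_over_rats (kummer_field D r n)) =
      c (gcd n N) / (real n * real (totient n))"
      unfolding degree_kummer_field[OF n] c_def g_def[symmetric] md C deg
      using nz g(1) by (simp add: field_simps)
  qed
qed

end

section \<open>Sums over squarefree numbers\<close>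

definition primes_upto :: "nat \<Rightarrow> nat set"
  where "primes_upto x = {p. prime p \<and> p \<le> x}"

lemma finite_primes_upto [simp]: "finite (primes_upto x)"
  by (rule finite_subset[of _ "{..x}"]) (auto simp: primes_upto_def)

lemma primes_uptoD: "p \<in> primes_upto x \<Longrightarrow> prime p"
  by (simp add: primes_upto_def)

lemma prime_not_dvd_prod_primes:
  fixes S :: "nat set"
  assumes "finite S" "\<And>p. p \<in> S \<Longrightarrow> prime p" "prime p" "p \<notin> S"
  shows "\<not> p dvd \<Prod>S"
proof
  assume "p dvd \<Prod>S"
  then obtain q where "q \<in> S" "p dvd q" using assms(1,3) by (auto simp: prime_dvd_prod_iff)
  then have "p = q" using assms(2,3) primes_dvd_imp_eq by blast
  then show False using \<open>q \<in> S\<close> assms(4) by simp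
qed

lemma prod_primes_facts:
  fixes S :: "nat set"
  assumes "finite S" "\<And>p. p \<in> S \<Longrightarrow> prime p"
  shows "squarefree (\<Prod>S)" "prime_factors (\<Prod>S) = S" "\<Prod>S \<noteq> 0"
proof -
  have "squarefree (\<Prod>S) \<and> prime_factors (\<Prod>S) = S \<and> \<Prod>S \<noteq> 0"
    using assms
  proof (induction S rule: finite_induct)
    case (insert p S)
    then have p: "prime p" and S: "\<And>q. q \<in> S \<Longrightarrow> prime q" by simp_all
    have IH: "squarefree (\<Prod>S)" "prime_factors (\<Prod>S) = S" "\<Prod>S \<noteq> 0"
      using insert.IH[OF S] by simp_all
    have "coprime p (\<Prod>S)"
      using prime_not_dvd_prod_primes[OF insert.hyps(1) S p insert.hyps(2)] p by (rule prime_imp_coprime[rotated])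
    moreover have "\<Prod>(insert p S) = p * \<Prod>S" using insert.hyps by simp
    ultimately show ?case
      using IH p prime_gt_0_nat[OF p]
      by (simp add: squarefree_mult_coprime squarefree_prime prime_factors_product prime_prime_factors)
  qed simp
  then show "squarefree (\<Prod>S)" "prime_factors (\<Prod>S) = S" "\<Prod>S \<noteq> 0" by simp_all
qed

lemma squarefree_eq_prod_prime_factors:
  fixes m :: nat
  assumes "squarefree m"
  shows "\<Prod>(prime_factors m) = m"
proof -
  have m: "m \<noteq> 0" using assms by (metis not_squarefree_0)
  have "(\<Prod>p\<in>prime_factors m. p ^ multiplicity p m) = m"
    using prod_prime_factors[OF m] by simp
  moreover have "(\<Prod>p\<in>prime_factors m. p ^ multiplicity p m) = \<Prod>(prime_factors m)"
  proof (rule prod.cong)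
    fix p assume "p \<in> prime_factors m"
    then have "multiplicity p m = 1" using assms squarefree_factorial_semiring'[OF m] by blast
    then show "p ^ multiplicity p m = p" by simp
  qed simp
  ultimately show ?thesis by simp
qed

text \<open>The factor by which \<open>t * totient t\<close> grows when \<open>t\<close> is
  multiplied by a prime \<open>p\<close>.\<close>

definition weight :: "nat \<Rightarrow> nat \<Rightarrow> real"
  where "weight t p = (if p dvd t then real p ^ 2 else real p * (real p - 1))"

lemma totient_step:
  assumes p: "prime p" and k: "k > 0"
  shows "real (p * k) * real (totient (p * k)) = weight k p * (real k * real (totient k))"
proof (cases "p dvd k")
  case True
  then have "gcd p k = p" by (rule gcd_nat.absorb1)
  then have "totient (p * k) * totient p = totient p * totient k * p"
    using totient_gcd[of p k] by simp
  moreover have "totient p > 0" using prime_gt_0_nat[OF p] by simp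
  ultimately have "totient (p * k) = p * totient k" by simp
  then show ?thesis using True by (simp add: weight_def power2_eq_square)
next
  case False
  then have "coprime p k" using p by (simp add: prime_imp_coprime)
  then have "totient (p * k) = (p - 1) * totient k"
    using p by (simp add: totient_mult_coprime totient_prime)
  moreover have "real (p - 1) = real p - 1" using prime_gt_0_nat[OF p] by (simp add: of_nat_diff)
  ultimately show ?thesis using False by (simp add: weight_def)
qed

lemma weight_ge: "prime p \<Longrightarrow> weight t p \<ge> real p * (real p - 1)"
  by (auto simp: weight_def power2_eq_square mult_left_mono)

lemma prime_term_pos:
  assumes "prime p"
  shows "real p * (real p - 1) \<ge> 2"
proof -
  have "real p \<ge> 2" using prime_ge_2_nat[OF assms] by simp
  then have "real p * (real p - 1) \<ge> 2 * 1" by (intro mult_mono) auto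
  then show ?thesis by simp
qed

lemma weight_pos: "prime p \<Longrightarrow> weight t p \<ge> 2"
  by (rule order.trans[OF prime_term_pos weight_ge])

lemma sum_Pow_insert:
  fixes f :: "'a set \<Rightarrow> real"
  assumes "finite A" "p \<notin> A"
  shows "sum f (Pow (insert p A)) = sum f (Pow A) + (\<Sum>S\<in>Pow A. f (insert p S))"
proof -
  have "inj_on (insert p) (Pow A)"
  proof (rule inj_onI)
    fix S T assume "S \<in> Pow A" "T \<in> Pow A" "insert p S = insert p T"
    then show "S = T" using assms(2) insert_ident[of p S T] by auto
  qed
  moreover have "Pow A \<inter> insert p ` Pow A = {}" using assms(2) by auto
  ultimately show ?thesis
    unfolding Pow_insert using assms(1) by (subst sum.union_disjoint) (simp_all add: sum.reindex)
qed

lemma sum_Pow_prod: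
  fixes u :: "'a \<Rightarrow> real"
  assumes "finite A"
  shows "(\<Sum>S\<in>Pow A. \<Prod>p\<in>S. u p) = (\<Prod>p\<in>A. 1 + u p)"
  using assms
proof (induction A rule: finite_induct)
  case (insert p A)
  have "(\<Sum>S\<in>Pow A. \<Prod>q\<in>insert p S. u q) = (\<Sum>S\<in>Pow A. u p * (\<Prod>q\<in>S. u q))"
    by (rule sum.cong) (use insert in \<open>auto intro!: prod.insert dest: finite_subset\<close>)
  then show ?case
    using insert by (simp add: sum_Pow_insert distrib_right flip: sum_distrib_left)
qed simp

lemma sum_reciprocal_bound: "(\<Sum>p\<in>primes_upto x. 1 / (real p * (real p - 1))) \<le> 1"
proof -
  have "(\<Sum>p\<in>primes_upto x. 1 / (real p * (real p - 1))) \<le> (\<Sum>n\<in>{2..x}. 1 / (real n * (real n - 1)))"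
    by (rule sum_mono2) (auto simp: primes_upto_def intro: prime_ge_2_nat)
  also have "\<dots> \<le> 1"
  proof (cases "x \<ge> 1")
    case True
    then have "(\<Sum>n\<in>{2..x}. 1 / (real n * (real n - 1))) = 1 - 1 / real x"
    proof (induction x rule: dec_induct)
      case (step m)
      have "{2..Suc m} = insert (Suc m) {2..m}" using step by auto
      then have "(\<Sum>n\<in>{2..Suc m}. 1 / (real n * (real n - 1))) = 1 / (real (Suc m) * real m) + (1 - 1 / real m)"
        using step by simp
      also have "1 / (real (Suc m) * real m) = 1 / real m - 1 / real (Suc m)"
        using step.hyps by (simp add: diff_frac_eq mult.commute)
      also have "1 / real m - 1 / real (Suc m) + (1 - 1 / real m) = 1 - 1 / real (Suc m)" by simp
      finally show ?case .
    qed simp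
    then show ?thesis by simp
  qed simp
  finally show ?thesis .
qed

lemma prod_reciprocal_bound: "(\<Prod>p\<in>primes_upto x. 1 + 1 / (real p * (real p - 1))) \<le> exp 1"
proof -
  have "(\<Prod>p\<in>primes_upto x. 1 + 1 / (real p * (real p - 1))) \<le> (\<Prod>p\<in>primes_upto x. exp (1 / (real p * (real p - 1))))"
  proof (rule prod_mono)
    fix p assume "p \<in> primes_upto x"
    then have "real p * (real p - 1) \<ge> 2" using prime_term_pos primes_uptoD by blast
    then show "0 \<le> 1 + 1 / (real p * (real p - 1)) \<and> 1 + 1 / (real p * (real p - 1)) \<le> exp (1 / (real p * (real p - 1)))"
      using exp_ge_add_one_self by simp
  qed
  also have "\<dots> = exp (\<Sum>p\<in>primes_upto x. 1 / (real p * (real p - 1)))" by (simp add: exp_sum)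
  also have "\<dots> \<le> exp 1" using sum_reciprocal_bound by simp
  finally show ?thesis .
qed

text \<open>The bound is on the prime factors, not on the number, so that sums over this set become
  finite Euler products.\<close>

definition squarefree_upto :: "nat \<Rightarrow> nat set"
  where "squarefree_upto x = (\<lambda>S. \<Prod>S) ` Pow (primes_upto x)"

lemma squarefree_upto_iff:
  "m \<in> squarefree_upto x \<longleftrightarrow> squarefree m \<and> prime_factors m \<subseteq> primes_upto x"
proof
  assume "m \<in> squarefree_upto x"
  then obtain S where "S \<subseteq> primes_upto x" "m = \<Prod>S" by (auto simp: squarefree_upto_def)
  moreover from this have "finite S" using finite_subset finite_primes_upto by blast
  ultimately show "squarefree m \<and> prime_factors m \<subseteq> primes_upto x"
    using prod_primes_facts[of S] primes_uptoD by blast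
next
  assume "squarefree m \<and> prime_factors m \<subseteq> primes_upto x"
  then show "m \<in> squarefree_upto x"
    unfolding squarefree_upto_def using squarefree_eq_prod_prime_factors[of m] by (metis PowI imageI)
qed

lemma finite_squarefree_upto [simp]: "finite (squarefree_upto x)"
  by (simp add: squarefree_upto_def)

lemma sum_squarefree_upto: "sum a (squarefree_upto x) = (\<Sum>S\<in>Pow (primes_upto x). a (\<Prod>S))"
proof -
  have "inj_on (\<lambda>S. \<Prod>S) (Pow (primes_upto x))"
  proof (rule inj_onI)
    fix S T assume *: "S \<in> Pow (primes_upto x)" "T \<in> Pow (primes_upto x)" "\<Prod>S = \<Prod>T"
    then have "finite S" "finite T" using finite_subset finite_primes_upto by blast+
    have "prime_factors (\<Prod>S) = S"
      by (rule prod_primes_facts(2)[OF \<open>finite S\<close>]) (use *(1) primes_uptoD in blast)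
    moreover have "prime_factors (\<Prod>T) = T"
      by (rule prod_primes_facts(2)[OF \<open>finite T\<close>]) (use *(2) primes_uptoD in blast)
    ultimately show "S = T" using *(3) by metis
  qed
  then show ?thesis unfolding squarefree_upto_def by (simp add: sum.reindex)
qed

lemma squarefree_subset_squarefree_upto:
  assumes "F \<subseteq> {m. squarefree m}" "finite F"
  obtains x where "\<And>y. y \<ge> x \<Longrightarrow> F \<subseteq> squarefree_upto y"
proof (rule that)
  fix y assume y: "y \<ge> \<Sum>F"
  show "F \<subseteq> squarefree_upto y"
  proof
    fix m assume m: "m \<in> F"
    then have "m \<le> y" using y assms(2) member_le_sum[of m F "\<lambda>x. x"] by auto
    moreover have "squarefree m" "m > 0" using m assms(1) by (auto intro!: Nat.gr0I)
    ultimately show "m \<in> squarefree_upto y"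
      unfolding squarefree_upto_iff by (auto simp: primes_upto_def in_prime_factors_iff dest!: dvd_imp_le)
  qed
qed

text \<open>The bound on \<open>a\<close> compares finite sums of absolute values with a finite
  Euler product, which stays below \<open>K * exp 1\<close>; hence absolute convergence. The sets
  \<open>squarefree_upto x\<close> eventually contain every finite set of squarefree numbers, so the
  sum may be computed along them.\<close>

theorem squarefree_sum_limit:
  fixes a :: "nat \<Rightarrow> real"
  assumes bound: "\<And>x S. S \<subseteq> primes_upto x \<Longrightarrow> \<bar>a (\<Prod>S)\<bar> \<le> K * (\<Prod>p\<in>S. 1 / (real p * (real p - 1)))"
    and K: "K \<ge> 0" and zero: "\<And>m. \<not> squarefree m \<Longrightarrow> a m = 0"
  shows "(\<lambda>x. sum a (squarefree_upto x)) \<longlonglongrightarrow> (\<Sum>\<^sub>\<infinity>m\<in>{1..}. a m)"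
proof -
  have "(\<lambda>m. \<bar>a m\<bar>) summable_on {m. squarefree m}"
  proof (rule nonneg_bdd_above_summable_on)
    show "bdd_above (sum (\<lambda>m. \<bar>a m\<bar>) ` {F. F \<subseteq> {m. squarefree m} \<and> finite F})"
    proof (rule bdd_aboveI, clarify)
      fix F :: "nat set" assume F: "F \<subseteq> {m. squarefree m}" "finite F"
      obtain x where x: "\<And>y. y \<ge> x \<Longrightarrow> F \<subseteq> squarefree_upto y"
        by (rule squarefree_subset_squarefree_upto[OF F]) blast
      have "sum (\<lambda>m. \<bar>a m\<bar>) F \<le> sum (\<lambda>m. \<bar>a m\<bar>) (squarefree_upto x)"
        by (rule sum_mono2) (use x in auto)
      also have "\<dots> = (\<Sum>S\<in>Pow (primes_upto x). \<bar>a (\<Prod>S)\<bar>)" by (rule sum_squarefree_upto)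
      also have "\<dots> \<le> (\<Sum>S\<in>Pow (primes_upto x). K * (\<Prod>p\<in>S. 1 / (real p * (real p - 1))))"
        by (rule sum_mono) (use bound in auto)
      also have "\<dots> = K * (\<Prod>p\<in>primes_upto x. 1 + 1 / (real p * (real p - 1)))"
        by (simp add: sum_Pow_prod flip: sum_distrib_left)
      also have "\<dots> \<le> K * exp 1" using prod_reciprocal_bound K by (intro mult_left_mono) auto
      finally show "sum (\<lambda>m. \<bar>a m\<bar>) F \<le> K * exp 1" .
    qed
  qed simp
  then have "a summable_on {m. squarefree m}"
    using summable_on_iff_abs_summable_on_real[of a] by simp
  then have "(a has_sum infsum a {m. squarefree m}) {m. squarefree m}" by (rule has_sum_infsum)
  then have lim: "(sum a \<longlongrightarrow> infsum a {m. squarefree m}) (finite_subsets_at_top {m. squarefree m})"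
    by (simp add: has_sum_def)
  have "filterlim squarefree_upto (finite_subsets_at_top {m. squarefree m}) sequentially"
    unfolding filterlim_finite_subsets_at_top
  proof (intro allI impI)
    fix F :: "nat set" assume "finite F \<and> F \<subseteq> {m. squarefree m}"
    then have F: "F \<subseteq> {m. squarefree m}" "finite F" by simp_all
    obtain x where x: "\<And>y. y \<ge> x \<Longrightarrow> F \<subseteq> squarefree_upto y"
      by (rule squarefree_subset_squarefree_upto[OF F]) blast
    show "\<forall>\<^sub>F y in sequentially. finite (squarefree_upto y) \<and> F \<subseteq> squarefree_upto y \<and> squarefree_upto y \<subseteq> {m. squarefree m}"
      unfolding eventually_sequentially
      by (intro exI[of _ x] allI impI conjI x) (auto simp: squarefree_upto_iff)
  qed
  from filterlim_compose[OF lim this]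
  have "(\<lambda>x. sum a (squarefree_upto x)) \<longlonglongrightarrow> infsum a {m. squarefree m}" .
  also have "infsum a {m. squarefree m} = infsum a {1..}"
    by (rule infsum_cong_neutral) (use zero in \<open>auto simp: not_less_eq_eq\<close>)
  finally show ?thesis .
qed

text \<open>Identifying \<open>prodinf\<close> with the limit of partial products requires
  convergence of the product, which follows from summability of 1/(p(p-1)).\<close>

lemma artin_constant_limit:
  "(\<lambda>x. \<Prod>p\<in>primes_upto x. 1 - 1 / (real p * (real p - 1))) \<longlonglongrightarrow> artin_constant"
proof -
  define f :: "nat \<Rightarrow> real" where
    "f p = (if prime p then 1 - 1 / (real p * (real p - 1)) else 1)" for p
  have "summable (\<lambda>i. norm (f i - 1))"
  proof (rule summableI_nonneg_bounded)
    fix n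
    have "(\<Sum>i<n. norm (f i - 1)) = (\<Sum>p\<in>{p. p < n \<and> prime p}. norm (f p - 1))"
      by (rule sum.mono_neutral_right) (auto simp: f_def)
    also have "\<dots> = (\<Sum>p\<in>{p. p < n \<and> prime p}. 1 / (real p * (real p - 1)))"
    proof (rule sum.cong)
      fix p assume "p \<in> {p. p < n \<and> prime p}"
      then have p: "prime p" by simp
      have "norm (f p - 1) = \<bar>1 / (real p * (real p - 1))\<bar>" using p by (simp add: f_def)
      also have "\<dots> = 1 / (real p * (real p - 1))" using prime_term_pos[OF p] by simp
      finally show "norm (f p - 1) = 1 / (real p * (real p - 1))" .
    qed simp
    also have "\<dots> \<le> (\<Sum>p\<in>primes_upto n. 1 / (real p * (real p - 1)))"
    proof (rule sum_mono2)
      fix p assume "p \<in> primes_upto n - {p. p < n \<and> prime p}"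
      then have "real p * (real p - 1) \<ge> 2" using prime_term_pos primes_uptoD by blast
      then show "0 \<le> 1 / (real p * (real p - 1))" by simp
    qed (auto simp: primes_upto_def)
    also have "\<dots> \<le> 1" by (rule sum_reciprocal_bound)
    finally show "(\<Sum>i<n. norm (f i - 1)) \<le> 1" .
  qed simp
  then have "convergent_prod f"
    by (intro abs_convergent_prod_imp_convergent_prod summable_imp_abs_convergent_prod)
  then have "(\<lambda>n. \<Prod>i\<le>n. f i) \<longlonglongrightarrow> prodinf f" by (rule convergent_prod_LIMSEQ)
  moreover have "(\<Prod>i\<le>n. f i) = (\<Prod>p\<in>primes_upto n. 1 - 1 / (real p * (real p - 1)))" for n
  proof -
    have "(\<Prod>i\<le>n. f i) = (\<Prod>p\<in>primes_upto n. f p)"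
      by (rule prod.mono_neutral_right) (auto simp: f_def primes_upto_def)
    also have "\<dots> = (\<Prod>p\<in>primes_upto n. 1 - 1 / (real p * (real p - 1)))"
      by (rule prod.cong) (auto simp: f_def primes_upto_def)
    finally show ?thesis .
  qed
  moreover have "artin_constant = prodinf f"
    unfolding artin_constant_def f_def[abs_def] ..
  ultimately show ?thesis by simp
qed

section \<open>Moebius sums as Euler products\<close>

lemma totient_prod_primes_mult:
  assumes "finite S" "\<And>p. p \<in> S \<Longrightarrow> prime p" "t > 0"
  shows "real (\<Prod>S * t) * real (totient (\<Prod>S * t)) = (\<Prod>p\<in>S. weight t p) * (real t * real (totient t))"
  using assms
proof (induction S rule: finite_induct)
  case (insert p S)
  have p: "prime p" and S: "\<And>q. q \<in> S \<Longrightarrow> prime q" using insert by simp_all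
  have pos: "\<Prod>S * t > 0" using prod_primes_facts(3)[OF insert.hyps(1) S] insert.prems by simp
  have eq: "\<Prod>(insert p S) * t = p * (\<Prod>S * t)" using insert.hyps by (simp add: mult.assoc)
  have "p dvd \<Prod>S * t \<longleftrightarrow> p dvd t"
    using prime_not_dvd_prod_primes[OF insert.hyps(1) S p insert.hyps(2)] p by (simp add: prime_dvd_mult_iff)
  then have w: "weight (\<Prod>S * t) p = weight t p" by (simp add: weight_def)
  have "real (\<Prod>(insert p S) * t) * real (totient (\<Prod>(insert p S) * t)) =
      weight t p * (real (\<Prod>S * t) * real (totient (\<Prod>S * t)))"
    unfolding eq totient_step[OF p pos] w ..
  also have "\<dots> = weight t p * ((\<Prod>p\<in>S. weight t p) * (real t * real (totient t)))"
    using insert.IH[OF S] insert.prems by simp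
  finally show ?case using insert.hyps by (simp add: mult.assoc)
qed simp

lemma moebius_prod_primes:
  assumes "finite S" "\<And>p. p \<in> S \<Longrightarrow> prime p"
  shows "moebius (\<Prod>S) = (-1) ^ card S"
  using prod_primes_facts(1,2)[OF assms] by (simp add: moebius_def)

definition artin_factor :: "nat \<Rightarrow> real"
  where "artin_factor p = 1 - 1 / (real p * (real p - 1))"

text \<open>The Euler factor at a prime dividing \<open>t\<close>, replacing
  \<open>artin_factor\<close> there.\<close>

definition square_factor :: "nat \<Rightarrow> real"
  where "square_factor p = 1 - 1 / real p ^ 2"

lemma artin_factor_nonzero: "prime p \<Longrightarrow> artin_factor p \<noteq> 0"
  using prime_term_pos[of p] by (simp add: artin_factor_def field_simps)

lemma square_factor_nonzero:
  assumes "prime p"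
  shows "square_factor p \<noteq> 0"
proof -
  have "real p ^ 2 > 1" using prime_gt_1_nat[OF assms] by (intro one_less_power) auto
  then show ?thesis by (auto simp: square_factor_def)
qed

lemma one_minus_weight: "1 - 1 / weight t p = (if p dvd t then square_factor p else artin_factor p)"
  by (simp add: weight_def square_factor_def artin_factor_def)

text \<open>Multiplying by an odd prime does not affect a gcd with 2, so the factors of
  \<open>F_fun\<close> reduce to quotients of the two local factors.\<close>

lemma F_fun_2:
  "F_fun 2 t = real (gcd t 2) / (real (totient t) * real t) *
     (\<Prod>p | prime p \<and> p > 2 \<and> p dvd t. square_factor p / artin_factor p)"
proof -
  have "(1 - real (gcd (p * t) 2) / (real p ^ 2 * real (gcd t 2))) * inverse (1 - real (gcd p 2) / (real p * (real p - 1))) =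
      square_factor p / artin_factor p" if "prime p" "p > 2" for p
  proof -
    have "coprime 2 p" using that prime_odd_nat by auto
    then have "gcd (p * t) 2 = gcd t 2" "gcd p 2 = 1"
      by (simp_all add: gcd_mult_left_left_cancel coprime_iff_gcd_eq_1 gcd.commute)
    moreover have "gcd t 2 > 0" by simp
    ultimately show ?thesis by (simp add: square_factor_def artin_factor_def divide_inverse)
  qed
  then show ?thesis unfolding F_fun_def by (intro arg_cong2[of _ _ _ _ "(*)"] prod.cong) auto
qed

text \<open>A prime not dividing \<open>N\<close> is invisible to the gcd with \<open>N\<close> and
  contributes a plain Euler factor; the primes dividing \<open>N\<close> leave a finite sum
  \<open>T t\<close>. Evenness of \<open>N\<close> puts the prime 2 among the latter, matching the
  product over odd primes in \<open>F_fun\<close>, and makes \<open>gcd t 2\<close> periodic modulo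
  \<open>N\<close>.\<close>

theorem density_sum_factorization:
  fixes c :: "nat \<Rightarrow> real"
  assumes N: "N > 0" "even N" and rat: "\<And>n. c n \<in> \<rat>"
  shows "\<exists>G :: nat \<Rightarrow> rat. periodic_on_positive G \<and> (\<forall>t>0.
    (\<Sum>\<^sub>\<infinity>n\<in>{1..}. of_int (moebius n) * (c (gcd (n * t) N) / (real (n * t) * real (totient (n * t))))) =
    artin_constant * F_fun 2 t * of_rat (G t))"
proof -
  define PN where "PN = prime_factors N"
  have PN: "finite PN" "\<And>p. p \<in> PN \<longleftrightarrow> prime p \<and> p dvd N"
    using N(1) by (auto simp: PN_def in_prime_factors_iff)
  have two: "2 \<in> PN" using N(2) by (simp add: PN(2))
  \<comment> \<open>Up to the factor \<open>t * totient t\<close>, the term of the series at the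
    squarefree number \<open>\<Prod>S\<close>.\<close>
  define s where "s t S = (-1) ^ card S * c (gcd (\<Prod>S * t) N) / (\<Prod>p\<in>S. weight t p)" for t S
  define T where "T t = (\<Sum>S\<in>Pow PN. s t S)" for t
  \<comment> \<open>\<open>T t\<close> divided by what \<open>artin_constant\<close> and
    \<open>F_fun 2 t\<close> already contain at the primes of \<open>N\<close>, and by the factor
    \<open>gcd t 2\<close> of \<open>F_fun 2 t\<close>.\<close>
  define G where "G t = T t / (\<Prod>p\<in>PN. artin_factor p) / real (gcd t 2) /
    (\<Prod>p | p \<in> PN \<and> p > 2 \<and> p dvd t. square_factor p / artin_factor p)" for t

  have formula: "(\<Sum>\<^sub>\<infinity>n\<in>{1..}. of_int (moebius n) * (c (gcd (n * t) N) / (real (n * t) * real (totient (n * t))))) =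
      artin_constant * F_fun 2 t * G t" if t: "t > 0" for t
  proof -
    define a where "a n = of_int (moebius n) * (c (gcd (n * t) N) / (real (n * t) * real (totient (n * t))))" for n
    have a: "a (\<Prod>S) = s t S / (real t * real (totient t))" if S: "S \<subseteq> primes_upto x" for S x
    proof -
      have "finite S" "\<And>p. p \<in> S \<Longrightarrow> prime p"
        using S finite_subset[OF S finite_primes_upto] primes_uptoD by blast+
      from totient_prod_primes_mult[OF this t] moebius_prod_primes[OF this]
      show ?thesis by (simp add: a_def s_def)
    qed
    have tt: "real t * real (totient t) > 0" using t by simp
    \<comment> \<open>A gcd with \<open>N\<close> is at most \<open>N\<close>, so only finitely many
      values of \<open>c\<close> occur and the sum of their absolute values bounds them all.\<close>
    define K where "K = (\<Sum>g\<le>N. \<bar>c g\<bar>) / (real t * real (totient t))"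
    have K: "K \<ge> 0" using tt by (simp add: K_def sum_nonneg)
    have lim: "(\<lambda>x. sum a (squarefree_upto x)) \<longlonglongrightarrow> (\<Sum>\<^sub>\<infinity>n\<in>{1..}. a n)"
    proof (rule squarefree_sum_limit[OF _ K])
      show "a m = 0" if "\<not> squarefree m" for m using that by (simp add: a_def moebius_def)
      fix x S assume S: "S \<subseteq> primes_upto x"
      have prime: "prime p" if "p \<in> S" for p using S that primes_uptoD by blast
      have "\<bar>c (gcd (\<Prod>S * t) N)\<bar> \<le> (\<Sum>g\<le>N. \<bar>c g\<bar>)"
        by (rule member_le_sum[of "gcd (\<Prod>S * t) N" "{..N}" "\<lambda>g. \<bar>c g\<bar>"]) (use N(1) in \<open>auto intro: gcd_le2_nat\<close>)
      moreover have "(\<Prod>p\<in>S. 1 / weight t p) \<le> (\<Prod>p\<in>S. 1 / (real p * (real p - 1)))"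
      proof (rule prod_mono)
        fix p assume "p \<in> S"
        then have "real p * (real p - 1) \<ge> 2" "weight t p \<ge> real p * (real p - 1)"
          using prime prime_term_pos weight_ge by blast+
        then show "0 \<le> 1 / weight t p \<and> 1 / weight t p \<le> 1 / (real p * (real p - 1))"
          by (auto intro!: divide_left_mono)
      qed
      moreover have "(\<Prod>p\<in>S. 1 / weight t p) \<ge> 0"
        by (rule prod_nonneg) (use weight_pos[OF prime, of _ t] in force)
      ultimately have "\<bar>c (gcd (\<Prod>S * t) N)\<bar> * (\<Prod>p\<in>S. 1 / weight t p) \<le>
          (\<Sum>g\<le>N. \<bar>c g\<bar>) * (\<Prod>p\<in>S. 1 / (real p * (real p - 1)))"
        by (intro mult_mono) (auto intro: sum_nonneg)
      moreover have "\<bar>s t S\<bar> = \<bar>c (gcd (\<Prod>S * t) N)\<bar> * (\<Prod>p\<in>S. 1 / weight t p)"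
        using \<open>(\<Prod>p\<in>S. 1 / weight t p) \<ge> 0\<close>
        by (simp add: s_def abs_mult abs_divide power_abs prod_dividef flip: abs_prod)
      ultimately show "\<bar>a (\<Prod>S)\<bar> \<le> K * (\<Prod>p\<in>S. 1 / (real p * (real p - 1)))"
        using tt unfolding a[OF S] K_def by (simp add: abs_divide divide_right_mono)
    qed
    have insert_prime: "s t (insert p S) = - (1 / weight t p) * s t S"
      if S: "finite S" "p \<notin> S" and p: "prime p" "\<not> p dvd N" for p S
    proof -
      have "coprime N p" using p by (metis coprime_commute prime_imp_coprime)
      then have "gcd (p * (\<Prod>S * t)) N = gcd (\<Prod>S * t) N" by (rule gcd_mult_left_left_cancel)
      then show ?thesis using S by (simp add: s_def mult.assoc)
    qed
    \<comment> \<open>Adjoining a prime outside \<open>N\<close> pairs each \<open>S\<close> with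
      \<open>insert p S\<close>, which multiplies the whole sum by one Euler factor.\<close>
    have sums: "(\<Sum>S\<in>Pow (PN \<union> B). s t S) = T t * (\<Prod>p\<in>B. 1 - 1 / weight t p)"
      if "finite B" "\<And>p. p \<in> B \<Longrightarrow> prime p \<and> \<not> p dvd N" for B
      using that
    proof (induction B rule: finite_induct)
      case (insert p B)
      have p: "prime p" "\<not> p dvd N" using insert.prems by blast+
      have pn: "p \<notin> PN \<union> B" using insert.hyps p PN(2) by blast
      have "(\<Sum>S\<in>Pow (PN \<union> B). s t (insert p S)) = (\<Sum>S\<in>Pow (PN \<union> B). - (1 / weight t p) * s t S)"
      proof (rule sum.cong)
        fix S assume "S \<in> Pow (PN \<union> B)"
        then show "s t (insert p S) = - (1 / weight t p) * s t S"
          using insert.hyps(1) PN(1) pn by (intro insert_prime p) (auto dest: finite_subset)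
      qed simp
      also have "\<dots> = - (1 / weight t p) * (\<Sum>S\<in>Pow (PN \<union> B). s t S)" by (rule sum_distrib_left[symmetric])
      finally have "(\<Sum>S\<in>Pow (insert p (PN \<union> B)). s t S) = (1 - 1 / weight t p) * (\<Sum>S\<in>Pow (PN \<union> B). s t S)"
        using insert.hyps(1) PN(1) pn by (subst sum_Pow_insert) (simp_all add: algebra_simps)
      also have "(\<Sum>S\<in>Pow (PN \<union> B). s t S) = T t * (\<Prod>p\<in>B. 1 - 1 / weight t p)"
        by (rule insert.IH) (use insert.prems in blast)
      finally show ?case using insert.hyps by (simp add: mult_ac)
    qed (simp add: T_def)
    define Q where "Q = {p. prime p \<and> p dvd t \<and> \<not> p dvd N}"
    define C where "C = T t / (real t * real (totient t)) / (\<Prod>p\<in>PN. artin_factor p) *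
      (\<Prod>p\<in>Q. square_factor p / artin_factor p)"
    \<comment> \<open>Once \<open>x\<close> exceeds all prime divisors of \<open>N\<close> and
      \<open>t\<close>, the partial sum is an exact constant multiple of the partial Artin
      product.\<close>
    have partial: "sum a (squarefree_upto x) = C * (\<Prod>p\<in>primes_upto x. artin_factor p)" if x: "x \<ge> N + t" for x
    proof -
      define B where "B = primes_upto x - PN"
      have B: "finite B" "\<And>p. p \<in> B \<Longrightarrow> prime p \<and> \<not> p dvd N"
        by (auto simp: B_def PN(2) primes_upto_def)
      have sub: "PN \<subseteq> primes_upto x"
        using x N(1) by (auto simp: PN(2) primes_upto_def dest!: dvd_imp_le)
      then have P: "primes_upto x = PN \<union> B" by (auto simp: B_def)
      have "p \<le> x" if "p dvd t" for p
        using x dvd_imp_le[OF that t] by simp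
      then have QB: "{p\<in>B. p dvd t} = Q"
        by (auto simp: B_def Q_def PN(2) primes_upto_def)
      have "sum a (squarefree_upto x) = (\<Sum>S\<in>Pow (primes_upto x). s t S / (real t * real (totient t)))"
        unfolding sum_squarefree_upto by (rule sum.cong) (use a in auto)
      also have "\<dots> = (\<Sum>S\<in>Pow (PN \<union> B). s t S) / (real t * real (totient t))"
        unfolding P by (rule sum_divide_distrib[symmetric])
      also have "\<dots> = T t / (real t * real (totient t)) * (\<Prod>p\<in>B. 1 - 1 / weight t p)"
        using sums[OF B] by simp
      also have "(\<Prod>p\<in>B. 1 - 1 / weight t p) =
          (\<Prod>p\<in>B. artin_factor p * (if p dvd t then square_factor p / artin_factor p else 1))"
        by (rule prod.cong) (use B artin_factor_nonzero in \<open>auto simp: one_minus_weight\<close>)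
      also have "\<dots> = (\<Prod>p\<in>B. artin_factor p) * (\<Prod>p\<in>Q. square_factor p / artin_factor p)"
        using B(1) unfolding prod.distrib QB[symmetric] by (simp add: prod.inter_filter)
      also have "(\<Prod>p\<in>B. artin_factor p) = (\<Prod>p\<in>primes_upto x. artin_factor p) / (\<Prod>p\<in>PN. artin_factor p)"
      proof -
        have "(\<Prod>p\<in>primes_upto x. artin_factor p) = (\<Prod>p\<in>PN. artin_factor p) * (\<Prod>p\<in>B. artin_factor p)"
          unfolding P using PN(1) B(1) by (intro prod.union_disjoint) (auto simp: B_def)
        moreover have "(\<Prod>p\<in>PN. artin_factor p) \<noteq> 0"
          using PN artin_factor_nonzero by auto
        ultimately show ?thesis by simp
      qed
      finally show ?thesis by (simp add: C_def)
    qed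
    have "(\<lambda>x. C * (\<Prod>p\<in>primes_upto x. artin_factor p)) \<longlonglongrightarrow> C * artin_constant"
      unfolding artin_factor_def by (intro tendsto_mult tendsto_const artin_constant_limit)
    moreover have "\<forall>\<^sub>F x in sequentially. C * (\<Prod>p\<in>primes_upto x. artin_factor p) = sum a (squarefree_upto x)"
      unfolding eventually_sequentially using partial by (intro exI[of _ "N + t"]) simp
    ultimately have "(\<lambda>x. sum a (squarefree_upto x)) \<longlonglongrightarrow> C * artin_constant"
      by (rule Lim_transform_eventually)
    then have "(\<Sum>\<^sub>\<infinity>n\<in>{1..}. a n) = C * artin_constant" using lim LIMSEQ_unique by blast
    also have "C = F_fun 2 t * G t"
    proof -
      \<comment> \<open>The odd primes dividing \<open>t\<close> split into \<open>Q\<close>,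
        outside \<open>N\<close>, and \<open>R\<close>, inside \<open>N\<close>. \<open>Q\<close>
        needs no condition \<open>p > 2\<close> because \<open>N\<close> is even.\<close>
      define R where "R = {p. p \<in> PN \<and> p > 2 \<and> p dvd t}"
      have "finite Q" by (rule finite_subset[of _ "{..t}"]) (use t in \<open>auto simp: Q_def dest: dvd_imp_le\<close>)
      moreover have "finite R" using PN(1) by (simp add: R_def)
      moreover have "Q \<inter> R = {}" by (auto simp: Q_def R_def PN(2))
      moreover have "{p. prime p \<and> p > 2 \<and> p dvd t} = Q \<union> R"
      proof -
        have "p > 2" if "prime p" "\<not> p dvd N" for p
          using that N(2) prime_ge_2_nat[of p] by (cases "p = 2") auto
        then show ?thesis by (auto simp: Q_def R_def PN(2))
      qed
      ultimately have "(\<Prod>p | prime p \<and> p > 2 \<and> p dvd t. square_factor p / artin_factor p) =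
          (\<Prod>p\<in>Q. square_factor p / artin_factor p) * (\<Prod>p\<in>R. square_factor p / artin_factor p)"
        by (simp add: prod.union_disjoint)
      moreover have "(\<Prod>p\<in>R. square_factor p / artin_factor p) \<noteq> 0"
        using \<open>finite R\<close> square_factor_nonzero artin_factor_nonzero by (auto simp: R_def PN(2))
      moreover have "real (gcd t 2) > 0" by simp
      ultimately show ?thesis
        unfolding F_fun_2 G_def C_def R_def[symmetric] by (simp add: field_simps)
    qed
    finally show ?thesis by (simp add: a_def mult_ac)
  qed

  have Rats: "G t \<in> \<rat>" for t
  proof -
    have w: "weight t p \<in> \<rat>" "artin_factor p \<in> \<rat>" "square_factor p \<in> \<rat>" for p
      by (auto simp: weight_def artin_factor_def square_factor_def)
    have prods: "(\<Prod>p\<in>S. f p) \<in> \<rat>" if "\<And>p. f p \<in> \<rat>" for f :: "nat \<Rightarrow> real" and S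
      using that by (induction S rule: infinite_finite_induct) auto
    have sums: "(\<Sum>p\<in>S. f p) \<in> \<rat>" if "\<And>p. f p \<in> \<rat>" for f :: "nat set \<Rightarrow> real" and S
      using that by (induction S rule: infinite_finite_induct) auto
    have "s t S \<in> \<rat>" for S unfolding s_def using w rat by (intro Rats_divide Rats_mult prods) auto
    then show ?thesis unfolding G_def T_def using w by (intro Rats_divide prods sums) auto
  qed
  have per: "G (t + N) = G t" for t
  proof -
    have "gcd (k * (t + N)) N = gcd (k * t) N" for k
      by (metis add.commute distrib_left gcd.commute gcd_add_mult mult.commute)
    moreover have "gcd (t + N) 2 = gcd t 2"
    proof -
      have "gcd m 2 = (if even m then 2 else 1)" for m :: nat
        by (simp add: gcd_nat.absorb2 flip: coprime_iff_gcd_eq_1)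
      then show ?thesis using N(2) by simp
    qed
    moreover have dvd: "p dvd t + N \<longleftrightarrow> p dvd t" if "p \<in> PN" for p
      using that PN(2) by (simp add: dvd_add_left_iff)
    moreover have "(\<Prod>p\<in>S. weight (t + N) p) = (\<Prod>p\<in>S. weight t p)" if "S \<subseteq> PN" for S
      by (rule prod.cong) (use that dvd in \<open>auto simp: weight_def\<close>)
    then have "T (t + N) = T t"
      unfolding T_def s_def by (intro sum.cong) (simp_all add: \<open>\<And>k. gcd (k * (t + N)) N = gcd (k * t) N\<close>)
    moreover have "{p. p \<in> PN \<and> p > 2 \<and> p dvd t + N} = {p. p \<in> PN \<and> p > 2 \<and> p dvd t}"
      using dvd by blast
    ultimately show ?thesis unfolding G_def by simp
  qed
  \<comment> \<open>Rational preimages of the real values. The choice depends on \<open>G t\<close>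
    alone, so it inherits the period.\<close>
  define G' where "G' t = (SOME q. of_rat q = G t)" for t
  have G': "of_rat (G' t) = G t" for t
    unfolding G'_def using Rats[of t] by (intro someI_ex[of "\<lambda>q. of_rat q = G t"]) (auto elim: Rats_cases)
  have "periodic_on_positive G'"
    unfolding periodic_on_positive_def G'_def using N(1) per by (intro exI[of _ N]) simp
  then show ?thesis using formula G' by (intro exI[of _ G']) simp
qed

section \<open>The density of primes with given index of appearance\<close>

lemma csqrt_int_not_rational:
  assumes "\<not> is_square (D :: int)"
  shows "csqrt (of_int D) \<notin> \<rat>"
proof
  assume "csqrt (of_int D) \<in> \<rat>"
  then obtain q where q: "csqrt (of_int D) = of_rat q" by (auto elim: Rats_cases)
  have "(of_rat (q ^ 2) :: complex) = of_rat (of_int D)"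
    using arg_cong[OF q, of "\<lambda>z. z ^ 2"] by (simp add: of_rat_power)
  then have "q ^ 2 = of_int D" by (simp only: of_rat_eq_iff)
  moreover obtain a b where ab: "b > 0" "coprime a b" "q = of_int a / of_int b"
    by (cases q) (auto simp: Fract_of_int_quotient)
  ultimately have "of_int (a ^ 2) = (of_int (D * b ^ 2) :: rat)"
    by (simp add: power_divide field_simps)
  then have eq: "a ^ 2 = D * b ^ 2" by (simp only: of_int_eq_iff)
  then have "b ^ 2 dvd a ^ 2" by simp
  then have "b dvd a" by simp
  then have "is_unit b" using ab(2) by (intro coprime_common_divisor[of a b]) auto
  then have "b = 1" using ab(1) by simp
  then have "D = a ^ 2" using eq by simp
  then have "is_square D" unfolding is_nth_power_def by blast
  then show False using assms by simp
qed

text \<open>Automorphisms permute the two roots, and a swap inverts \<gamma>. The square root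
  \<open>s\<close> of the discriminant is the difference of the roots up to sign, so if no
  automorphism swapped them, \<open>s\<close> would be fixed by all and hence rational.\<close>

lemma kummer_if_lucas:
  assumes lucas: "lucas_sequence a1 a2 u" and roots: "characteristic_roots a1 a2 \<alpha> \<beta>"
    and \<gamma>: "\<gamma> = \<alpha> / \<beta>" and nondeg: "\<not> root_of_unity \<gamma>"
    and nonsquare: "\<not> is_square (lucas_discr a1 a2)"
    and r: "\<And>n. n > 0 \<Longrightarrow> r n ^ n = \<gamma>"
  shows "kummer (lucas_discr a1 a2) \<gamma> r"
proof -
  define D where "D = lucas_discr a1 a2"
  define s where "s = csqrt (of_int D)"
  have a2: "a2 \<noteq> 0" using lucas by (simp add: lucas_sequence_def)
  have set: "z ^ 2 - of_int a1 * z - of_int a2 = 0 \<longleftrightarrow> z = \<alpha> \<or> z = \<beta>" for z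
    using roots unfolding characteristic_roots_def by auto
  have s2: "s ^ 2 = of_int a1 ^ 2 + 4 * of_int a2" by (simp add: s_def D_def lucas_discr_def)
  have sroot: "z = (of_int a1 + s) / 2 \<or> z = (of_int a1 - s) / 2 \<longleftrightarrow> z ^ 2 - of_int a1 * z - of_int a2 = 0" for z
  proof -
    have "4 * (z ^ 2 - of_int a1 * z - of_int a2) = (2 * z - of_int a1 - s) * (2 * z - of_int a1 + s)"
      using s2 by (simp add: algebra_simps power2_eq_square)
    then have "z ^ 2 - of_int a1 * z - of_int a2 = 0 \<longleftrightarrow> 2 * z - of_int a1 - s = 0 \<or> 2 * z - of_int a1 + s = 0"
      by (metis mult_eq_0_iff zero_neq_numeral)
    also have "\<dots> \<longleftrightarrow> z = (of_int a1 + s) / 2 \<or> z = (of_int a1 - s) / 2"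
      by (auto simp: field_simps)
    finally show ?thesis by simp
  qed
  have s_notin: "s \<notin> \<rat>" unfolding s_def by (rule csqrt_int_not_rational) (use nonsquare in \<open>simp add: D_def\<close>)
  have "{\<alpha>, \<beta>} = {(of_int a1 + s) / 2, (of_int a1 - s) / 2}"
    using set sroot by blast
  then consider "\<alpha> = (of_int a1 + s) / 2" "\<beta> = (of_int a1 - s) / 2"
    | "\<alpha> = (of_int a1 - s) / 2" "\<beta> = (of_int a1 + s) / 2"
    by (auto simp: doubleton_eq_iff)
  then have diff: "s = \<alpha> - \<beta> \<or> s = \<beta> - \<alpha>"
  proof cases
    case 1
    have "\<alpha> - \<beta> = s" unfolding 1 diff_divide_distrib[symmetric] by simp
    then show ?thesis by simp
  next
    case 2
    have "\<beta> - \<alpha> = s" unfolding 2 diff_divide_distrib[symmetric] by simp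
    then show ?thesis by simp
  qed
  have nz: "\<alpha> \<noteq> 0" "\<beta> \<noteq> 0" using set[of 0] a2 by auto
  have \<gamma>0: "\<gamma> \<noteq> 0" using nz \<gamma> by simp
  have algs: "algebraic s" unfolding s_def
    by (rule algebraic_root[of _ 2 "of_int D"]) (simp_all add: algebraic_Rats)
  have algr: "algebraic z" if "z = \<alpha> \<or> z = \<beta>" for z
  proof -
    have "algebraic ((of_int a1 + s) / 2)" "algebraic ((of_int a1 - s) / 2)"
      using algs by (simp_all add: algebraic_closed algebraic_Rats)
    moreover have "z = (of_int a1 + s) / 2 \<or> z = (of_int a1 - s) / 2" using that set sroot by blast
    ultimately show ?thesis by metis
  qed
  have alg: "algebraic \<alpha>" "algebraic \<beta>" using algr by auto
  have algg: "algebraic \<gamma>" unfolding \<gamma> using alg by (simp add: algebraic_closed)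
  have ne: "\<gamma> \<noteq> inverse \<gamma>"
  proof
    assume "\<gamma> = inverse \<gamma>"
    then have "\<gamma> ^ 2 = 1" using \<gamma>0 by (simp add: power2_eq_square field_simps)
    then show False using nondeg unfolding root_of_unity_def by (metis zero_less_numeral)
  qed
  have perm: "(\<sigma> \<alpha> = \<alpha> \<and> \<sigma> \<beta> = \<beta>) \<or> (\<sigma> \<alpha> = \<beta> \<and> \<sigma> \<beta> = \<alpha>)" if \<sigma>: "alg_aut \<sigma>" for \<sigma>
  proof -
    have "\<sigma> z = \<alpha> \<or> \<sigma> z = \<beta>" if z: "z = \<alpha> \<or> z = \<beta>" for z
    proof -
      have "\<sigma> (z ^ 2 - of_int a1 * z - of_int a2) = \<sigma> z ^ 2 - of_int a1 * \<sigma> z - of_int a2"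
        using \<sigma> algr[OF z]
        by (simp add: alg_aut_diff alg_aut_mult alg_aut_power algebraic_closed algebraic_Rats alg_aut_Rats)
      moreover have "z ^ 2 - of_int a1 * z - of_int a2 = 0" using set[of z] z by blast
      ultimately have "\<sigma> z ^ 2 - of_int a1 * \<sigma> z - of_int a2 = 0" using alg_aut_0[OF \<sigma>] by simp
      then show ?thesis using set by blast
    qed
    moreover have "\<sigma> \<alpha> = \<sigma> \<beta> \<Longrightarrow> \<alpha> = \<beta>" using alg_aut_inj[OF \<sigma> alg] by simp
    ultimately show ?thesis by metis
  qed
  have on_\<gamma>: "\<sigma> \<gamma> = \<sigma> \<alpha> / \<sigma> \<beta>" if "alg_aut \<sigma>" for \<sigma>
    unfolding \<gamma> using that alg by (simp add: alg_aut_divide)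
  have inv: "\<sigma> \<gamma> = inverse \<gamma>" if "alg_aut \<sigma>" "\<sigma> \<alpha> = \<beta> \<and> \<sigma> \<beta> = \<alpha>" for \<sigma>
    using on_\<gamma>[OF that(1)] that(2) \<gamma> by simp
  have fix_s: "\<sigma> s = s" if "alg_aut \<sigma>" "\<sigma> \<alpha> = \<alpha> \<and> \<sigma> \<beta> = \<beta>" for \<sigma>
    using diff that alg by (auto simp: alg_aut_diff)
  show ?thesis
    unfolding D_def[symmetric]
  proof
    show "\<not> root_of_unity \<gamma>" by fact
    show "r n ^ n = \<gamma>" if "n > 0" for n using r that .
    show "algebraic \<gamma>" by fact
    show "\<gamma> \<noteq> 0" by fact
    show "\<sigma> \<gamma> = \<gamma> \<or> \<sigma> \<gamma> = inverse \<gamma>" if "alg_aut \<sigma>" for \<sigma>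
      using perm[OF that] on_\<gamma>[OF that] inv[OF that] \<gamma> by auto
    show "\<sigma> (csqrt (of_int D)) = csqrt (of_int D)" if "alg_aut \<sigma>" "\<sigma> \<gamma> = \<gamma>" for \<sigma>
      using perm[OF that(1)] inv[OF that(1)] fix_s[OF that(1)] that(2) ne by (auto simp: s_def)
    show "\<exists>\<sigma>. alg_aut \<sigma> \<and> \<sigma> \<gamma> = inverse \<gamma>"
    proof (rule ccontr)
      assume no: "\<nexists>\<sigma>. alg_aut \<sigma> \<and> \<sigma> \<gamma> = inverse \<gamma>"
      have "s \<in> \<rat>"
      proof (rule in_Rats_if_alg_aut_fixed[OF algs])
        fix \<sigma> assume \<sigma>: "alg_aut \<sigma>"
        then show "\<sigma> s = s" using perm[OF \<sigma>] inv[OF \<sigma>] fix_s[OF \<sigma>] no by blast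
      qed
      then show False using s_notin by simp
    qed
  qed
qed

theorem theorem1p2:
  fixes a1 a2 :: int and u :: "nat \<Rightarrow> int"
    and \<alpha> \<beta> \<gamma> :: complex and r :: "nat \<Rightarrow> complex"
  assumes "lucas_sequence a1 a2 u"
    and "characteristic_roots a1 a2 \<alpha> \<beta>"
    and "\<gamma> = \<alpha> / \<beta>"
    and "\<not> root_of_unity \<gamma>"
    and "\<not> is_square (lucas_discr a1 a2)"
    and "\<not> has_field_discriminant (quadratic_field (lucas_discr a1 a2)) (-3)"
    and "\<not> has_field_discriminant (quadratic_field (lucas_discr a1 a2)) (-4)"
    and "\<And>n. n > 0 \<Longrightarrow> r n ^ n = \<gamma>"
  shows "\<exists>h>0. \<exists>G :: nat \<Rightarrow> rat. periodic_on_positive G \<and>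
    (\<forall>t>0. lucas_delta a1 a2 r t = artin_constant * F_fun (2 * h) t * of_rat (G t))"
proof -
  define D where "D = lucas_discr a1 a2"
  interpret kummer D \<gamma> r
    unfolding D_def by (rule kummer_if_lucas[OF assms(1-5)]) (rule assms(8))
  obtain N c where N: "N > 0" and c: "\<And>n. c n \<in> \<rat>"
    and ratio: "\<And>n. n > 0 \<Longrightarrow> real (card (C_set D r n)) / real (degree_over_rats (kummer_field D r n)) =
      c (gcd n N) / (real n * real (totient n))"
    by (rule density_term_depends_on_gcd) blast
  \<comment> \<open>\<open>density_sum_factorization\<close> asks for an even modulus, so
    \<open>N\<close> is doubled and the inner gcd with \<open>N\<close> recovers the original
    argument.\<close>
  have "gcd (gcd n (2 * N)) N = gcd n N" for n
    by (simp add: gcd.assoc gcd_nat.absorb2)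
  then have ratio': "real (card (C_set D r n)) / real (degree_over_rats (kummer_field D r n)) =
      (\<lambda>g. c (gcd g N)) (gcd n (2 * N)) / (real n * real (totient n))" if "n > 0" for n
    using ratio[OF that] by simp
  obtain G :: "nat \<Rightarrow> rat" where G: "periodic_on_positive G"
    "\<And>t. t > 0 \<Longrightarrow> (\<Sum>\<^sub>\<infinity>n\<in>{1..}. of_int (moebius n) * ((\<lambda>g. c (gcd g N)) (gcd (n * t) (2 * N)) /
        (real (n * t) * real (totient (n * t))))) = artin_constant * F_fun 2 t * of_rat (G t)"
    using density_sum_factorization[of "2 * N" "\<lambda>g. c (gcd g N)"] N c by auto
  have "lucas_delta a1 a2 r t = artin_constant * F_fun (2 * 1) t * of_rat (G t)" if t: "t > 0" for t
  proof -
    have "lucas_delta a1 a2 r t = (\<Sum>\<^sub>\<infinity>n\<in>{1..}. of_int (moebius n) *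
        ((\<lambda>g. c (gcd g N)) (gcd (n * t) (2 * N)) / (real (n * t) * real (totient (n * t)))))"
      unfolding lucas_delta_def D_def[symmetric]
    proof (rule infsum_cong)
      fix n :: nat assume "n \<in> {1..}"
      then have "n * t > 0" using t by simp
      from ratio'[OF this] show "of_int (moebius n) * real (card (C_set D r (n * t))) /
          real (degree_over_rats (kummer_field D r (n * t))) = of_int (moebius n) *
          ((\<lambda>g. c (gcd g N)) (gcd (n * t) (2 * N)) / (real (n * t) * real (totient (n * t))))"
        by (metis times_divide_eq_right)
    qed
    then show ?thesis using G(2)[OF t] by simp
  qed
  then show ?thesis using G(1) by (intro exI[of _ "1 :: nat"]) auto
qed

end
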